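(* Consider the real-power model and the RMPE algorithm with the gapless signal-processing routine and the real-power gapless rule for $m_\ell$ (all described in the context). Let $\epsilon>0$, $\rho\in(0,1)$, $\tau=\frac1\pi\log\frac{12}{\beta-\omega}$, and let $\alpha$ be a constant with $0<\alpha<\frac{\beta-\omega}{3}$. Let $\eta\le\frac{1}{8S(2S-1)}$, let $K$ be an integer with $K\ge3\eta^{-1}\tau$, and let $$N_{\mathrm{HR}}=2\left\lceil\frac{4}{\alpha^2}\left(\log\frac4\rho+\log\left(\left\lceil\log_2\frac{\eta}{\epsilon}\right\rceil+1\right)+\log(K+1)\right)\right\rceil.$$ Then with probability at least $1-\rho$ the output $E_L$ satisfies $\Lambda\subset E_L\subset B(\Lambda,\epsilon)$. The maximum runtime and total runtime are $T_{\max}=O(\eta K\epsilon^{-1})$ and $T_{\mathrm{total}}=O(\eta K^2N_{\mathrm{HR}}\epsilon^{-1})$.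
   Context: Real-power model: $H$ is a Hermitian operator with eigenvalues in $[0,1]$, and for every real $t\ge0$ one can apply (controlled) $U^t:=e^{-2\pi iHt}$ at cost (circuit depth) $t$. The initial state is $|\psi\rangle=\sum_{s=1}^Sc_s|\psi_s\rangle+c_{\mathrm{res}}|\psi_{\mathrm{res}}\rangle$ with $|\psi_s\rangle$ orthonormal, $H|\psi_s\rangle=\lambda_s|\psi_s\rangle$, $|\psi_{\mathrm{res}}\rangle$ a unit vector orthogonal to all $|\psi_s\rangle$, $\min_s|c_s|^2\ge\beta>0$, $|c_{\mathrm{res}}|^2\le\omega<\beta$; $\Lambda=\{\lambda_1,\dots,\lambda_S\}$, and it is assumed that $\Lambda\subset[0,0.9]$. Notation: $\mathbb{T}=\mathbb{R}/\mathbb{Z}$; $B(T,\eta)=\bigcup_{x\in T}[x-\eta,x+\eta]$ for $T\subset\mathbb{R}$, and $B_{\mathbb{T}}$ is the analogue on $\mathbb{T}$; $|\cdot|$ is Lebesgue measure. Hadamard test: one run with time $t$ uses one ancilla qubit and controlled-$U^t$ on $|\psi\rangle$ and returns an independent random $\pm1$ whose mean is $\mathrm{Re}\langle\psi|U^t|\psi\rangle$ (first variant) or $\mathrm{Im}\langle\psi|U^t|\psi\rangle$ (second variant); its cost is $t$. RMPE algorithm (parameters $\eta,K,N_{\mathrm{HR}}$, target $\epsilon$): set $E_{-1}=[0,0.9]$, $M_0=1$. For $\ell=0,1,2,\dots$: (i) if $\ell\ge1$ choose $m_\ell\ge2$ by the rule below and set $M_\ell=M_{\ell-1}m_\ell$;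 (ii) for each $k=0,\dots,K$ run the Hadamard test with $t=M_\ell k$ $N_{\mathrm{HR}}/2$ times for each variant, and let $y_\ell(k)$ be (average of real-variant outcomes)$+i\,$(average of imaginary-variant outcomes); set $y_\ell(-k)=\overline{y_\ell(k)}$; (iii) compute $Y_\ell\subset\mathbb{T}$ by the signal-processing routine; (iv) write $Y_\ell$ as a disjoint union of closed arcs, lift each arc to an interval of $\mathbb{R}$ and divide by $M_\ell$, obtaining intervals $I'_{\ell,1},\dots,I'_{\ell,S_\ell}$; for each $i$ pick an integer $q_{\ell,i}$ with $(I'_{\ell,i}+q_{\ell,i}/M_\ell)\cap E_{\ell-1}\ne\varnothing$, set $I_{\ell,i}=I'_{\ell,i}+q_{\ell,i}/M_\ell$ and $E_\ell=\bigcup_iI_{\ell,i}$; (v) if $\eta/M_\ell\le\epsilon$, stop and output $E_L:=E_\ell$. $T_{\max}$ is the largest $t$ used in any Hadamard test, $T_{\mathrm{total}}$ the sum of $t$ over all runs. Gapless signal-processing routine: with $\tau=\frac1\pi\log\frac{12}{\beta-\omega}$, $\sigma=\sqrt\tau$, $\hat\phi(k)=e^{-\pi(k\sigma/K)^2}$, $\phi_s=\sum_{k\in\mathbb{Z}}\hat\phi(k)$, let $X_\ell=\{x\in\mathbb{T}:|\sum_{|k|\le K}y_\ell(k)\hat\phi(k)e^{2\pi ikx}|>\frac{6\beta+5\omega}{11}\phi_s\}$; write $X_\ell$ as disjoint open arcs $(a_1,b_1),\dots,(a_q,b_q)$ in cyclic order, let $J$ be the set of $j$ with $a_j-b_{j-1}<\tau/K$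 (for $j=1$: $a_1+1-b_q<\tau/K$), and set $Y_\ell=\bigcup_i[a_i,b_i]\cup\bigcup_{j\in J}[b_{j-1},a_j]$ (modulo 1, $b_0:=b_q$). Rule for $m_\ell$ (real-power, gapless): choose $m_\ell\in[2,4]$ such that, with $G=B(E_{\ell-1},\frac{\eta}{2M_{\ell-1}})$, $(G+\frac{q}{M_{\ell-1}m_\ell})\cap G=\varnothing$ for all $q\in\mathbb{Z}\setminus\{0\}$.
   Formalization: The formal theorem assumes ε ≤ η: for ε ≥ 2η the term log(⌈log₂(η/ε)⌉+1) in N_HR is undefined and T_max = K need not be O(ηK/ε); for η < ε < 2η the run and N_HR coincide with those for ε = η, so the claim follows from that case. *)

theory Defs
  imports "HOL-Probability.Probability" "Jordan_Normal_Form.Schur_Decomposition"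
begin

definition hermitian_mat :: "complex mat \<Rightarrow> bool" where
  "hermitian_mat H \<longleftrightarrow> H \<in> carrier_mat (dim_row H) (dim_row H) \<and> mat_adjoint H = H"

text \<open>U t = exp(-2 pi i H t): the (unique, since H is Hermitian hence diagonalisable)
  n x n matrix acting on every eigenvector of H with eigenvalue lam by the scalar
  exp(-2 pi i lam t).\<close>
definition is_evolution :: "complex mat \<Rightarrow> (real \<Rightarrow> complex mat) \<Rightarrow> bool" where
  "is_evolution H U \<longleftrightarrow> (\<forall>t. U t \<in> carrier_mat (dim_row H) (dim_row H) \<and>
     (\<forall>v lam. eigenvector H v lam \<longrightarrow>
        U t *\<^sub>v v = exp (- 2 * pi * \<i> * lam * complex_of_real t) \<cdot>\<^sub>v v))"

definition overlap :: "(real \<Rightarrow> complex mat) \<Rightarrow> complex vec \<Rightarrow> real \<Rightarrow> complex" where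
  "overlap U psi t = (U t *\<^sub>v psi) \<bullet>c psi"

definition pm1_pmf :: "real \<Rightarrow> real pmf" where
  "pm1_pmf a = map_pmf (\<lambda>b. if b then 1 else -1) (bernoulli_pmf ((1 + a) / 2))"

fun iid_pmf :: "nat \<Rightarrow> 'a pmf \<Rightarrow> 'a list pmf" where
  "iid_pmf 0 p = return_pmf []"
| "iid_pmf (Suc n) p = bind_pmf p (\<lambda>x. map_pmf (\<lambda>xs. x # xs) (iid_pmf n p))"

fun seq_pmf :: "'a pmf list \<Rightarrow> 'a list pmf" where
  "seq_pmf [] = return_pmf []"
| "seq_pmf (p # ps) = bind_pmf p (\<lambda>x. map_pmf (\<lambda>xs. x # xs) (seq_pmf ps))"

definition avg :: "real list \<Rightarrow> real" where
  "avg xs = sum_list xs / real (length xs)"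

text \<open>y(k) for one time t: N/2 runs of each variant of the Hadamard test.\<close>
definition estimate_pmf :: "(real \<Rightarrow> complex) \<Rightarrow> nat \<Rightarrow> real \<Rightarrow> complex pmf" where
  "estimate_pmf g N t =
     bind_pmf (iid_pmf (N div 2) (pm1_pmf (Re (g t)))) (\<lambda>xs.
     map_pmf (\<lambda>zs. Complex (avg xs) (avg zs)) (iid_pmf (N div 2) (pm1_pmf (Im (g t)))))"

definition level_pmf :: "(real \<Rightarrow> complex) \<Rightarrow> nat \<Rightarrow> nat \<Rightarrow> real \<Rightarrow> complex list pmf" where
  "level_pmf g N K M = seq_pmf (map (\<lambda>k. estimate_pmf g N (M * real k)) [0..<K+1])"

section \<open>Gapless signal processing (subsets of the torus represented as 1-periodic subsets of R)\<close>

definition yext :: "complex list \<Rightarrow> int \<Rightarrow> complex" where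
  "yext ys k = (if k \<ge> 0 then ys ! nat k else cnj (ys ! nat (- k)))"

definition phihat :: "real \<Rightarrow> nat \<Rightarrow> int \<Rightarrow> real" where
  "phihat \<sigma> K k = exp (- pi * (real_of_int k * \<sigma> / real K)\<^sup>2)"

definition phis :: "real \<Rightarrow> nat \<Rightarrow> real" where
  "phis \<sigma> K = (\<Sum>\<^sub>\<infinity>k::int. phihat \<sigma> K k)"

definition filt :: "real \<Rightarrow> nat \<Rightarrow> complex list \<Rightarrow> real \<Rightarrow> complex" where
  "filt \<sigma> K ys x = (\<Sum>k\<in>{- int K..int K}. yext ys k * complex_of_real (phihat \<sigma> K k)
                        * exp (2 * pi * \<i> * of_int k * complex_of_real x))"

definition tau_of :: "real \<Rightarrow> real \<Rightarrow> real" where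
  "tau_of \<beta> \<omega> = (1 / pi) * ln (12 / (\<beta> - \<omega>))"

definition Xset :: "real \<Rightarrow> real \<Rightarrow> nat \<Rightarrow> complex list \<Rightarrow> real set" where
  "Xset \<beta> \<omega> K ys = (let \<sigma> = sqrt (tau_of \<beta> \<omega>) in
     {x. cmod (filt \<sigma> K ys x) > (6 * \<beta> + 5 * \<omega>) / 11 * phis \<sigma> K})"

text \<open>Y = closed arcs [a_i,b_i] together with the gaps [b_(j-1),a_j] of length < tau/K;
  the gaps are exactly the connected components of the complement of X.\<close>
definition Yset :: "real \<Rightarrow> real \<Rightarrow> nat \<Rightarrow> complex list \<Rightarrow> real set" where
  "Yset \<beta> \<omega> K ys = (let X = Xset \<beta> \<omega> K ys in
     closure X \<union> \<Union>{C. C \<in> components (- X) \<and>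
                        emeasure lborel C < ennreal (tau_of \<beta> \<omega> / real K)})"

text \<open>The lifts to R of the closed arc of the torus whose preimage-component is C
  (the whole circle lifts to intervals of length 1).\<close>
definition arc_lifts :: "real set \<Rightarrow> real set set" where
  "arc_lifts C = (if C = UNIV then {{x..x + 1} | x. True}
                  else {(\<lambda>z. z + real_of_int n) ` C | n. True})"

definition arcs :: "real set \<Rightarrow> real set set set" where
  "arcs Y = arc_lifts ` components Y"

definition Bset :: "real set \<Rightarrow> real \<Rightarrow> real set" where
  "Bset T \<eta> = (\<Union>x\<in>T. {x - \<eta>..x + \<eta>})"

definition valid_m :: "real \<Rightarrow> real set \<Rightarrow> real \<Rightarrow> real \<Rightarrow> bool" where
  "valid_m \<eta> E Mp m \<longleftrightarrow> 2 \<le> m \<and> m \<le> 4 \<and>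
     (let G = Bset E (\<eta> / (2 * Mp)) in
      \<forall>q::int. q \<noteq> 0 \<longrightarrow> ((\<lambda>z. z + real_of_int q / (Mp * m)) ` G) \<inter> G = {})"

definition valid_lift :: "real \<Rightarrow> real set \<Rightarrow> real set \<Rightarrow> bool" where
  "valid_lift M E J \<longleftrightarrow> ((\<lambda>z. z / M) ` J) \<inter> E \<noteq> {}"

text \<open>One run of RMPE, with choice functions mch (for m_l) and lch (for the lift of each
  arc, i.e. the interval I_(l,i) times M_l). Result: the list of M_l actually used for
  Hadamard tests, and Some E_L on normal termination, None if the algorithm gets stuck
  (no admissible choice) or runs out of fuel.\<close>
fun rmpe_run ::
  "(real \<Rightarrow> complex) \<Rightarrow> real \<Rightarrow> real \<Rightarrow> real \<Rightarrow> nat \<Rightarrow> nat \<Rightarrow> real \<Rightarrow>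
   (nat \<Rightarrow> real \<Rightarrow> real set \<Rightarrow> real) \<Rightarrow>
   (nat \<Rightarrow> real \<Rightarrow> real set \<Rightarrow> real set \<Rightarrow> real set set \<Rightarrow> real set) \<Rightarrow>
   nat \<Rightarrow> nat \<Rightarrow> real \<Rightarrow> real set \<Rightarrow> (real list \<times> real set option) pmf" where
  "rmpe_run g \<beta> \<omega> \<eta> K N \<epsilon> mch lch 0 l Mp E = return_pmf ([], None)"
| "rmpe_run g \<beta> \<omega> \<eta> K N \<epsilon> mch lch (Suc f) l Mp E =
     (let m = (if l = 0 then 1 else mch l Mp E) in
      if l \<noteq> 0 \<and> \<not> valid_m \<eta> E Mp m then return_pmf ([], None) else
      (let M = Mp * m in
       bind_pmf (level_pmf g N K M) (\<lambda>ys.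
         (let Y = Yset \<beta> \<omega> K ys; J = lch l M E Y in
          if \<not> (\<forall>A\<in>arcs Y. J A \<in> A \<and> valid_lift M E (J A)) then return_pmf ([M], None) else
          (let E' = (\<Union>A\<in>arcs Y. (\<lambda>z. z / M) ` J A) in
           if \<eta> / M \<le> \<epsilon> then return_pmf ([M], Some E')
           else map_pmf (\<lambda>(Ms, r). (M # Ms, r))
                  (rmpe_run g \<beta> \<omega> \<eta> K N \<epsilon> mch lch f (Suc l) M E'))))))"

text \<open>Full algorithm: E_(-1) = [0, 0.9], M_0 = 1. The fuel ceil(log2(eta/eps)) + 1 is never
  exhausted, since M_l \<ge> 2^l.\<close>
definition rmpe :: "(real \<Rightarrow> complex) \<Rightarrow> real \<Rightarrow> real \<Rightarrow> real \<Rightarrow> nat \<Rightarrow> nat \<Rightarrow> real \<Rightarrow>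
   (nat \<Rightarrow> real \<Rightarrow> real set \<Rightarrow> real) \<Rightarrow>
   (nat \<Rightarrow> real \<Rightarrow> real set \<Rightarrow> real set \<Rightarrow> real set set \<Rightarrow> real set) \<Rightarrow>
   (real list \<times> real set option) pmf" where
  "rmpe g \<beta> \<omega> \<eta> K N \<epsilon> mch lch =
     rmpe_run g \<beta> \<omega> \<eta> K N \<epsilon> mch lch (nat \<lceil>log 2 (\<eta> / \<epsilon>)\<rceil> + 1) 0 1 {0..9/10}"

definition good_choices :: "real \<Rightarrow> (nat \<Rightarrow> real \<Rightarrow> real set \<Rightarrow> real) \<Rightarrow>
   (nat \<Rightarrow> real \<Rightarrow> real set \<Rightarrow> real set \<Rightarrow> real set set \<Rightarrow> real set) \<Rightarrow> bool" where
  "good_choices \<eta> mch lch \<longleftrightarrow>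
     (\<forall>l Mp E. (\<exists>m. valid_m \<eta> E Mp m) \<longrightarrow> valid_m \<eta> E Mp (mch l Mp E)) \<and>
     (\<forall>l M E Y A. (\<exists>J\<in>A. valid_lift M E J) \<longrightarrow> lch l M E Y A \<in> A \<and> valid_lift M E (lch l M E Y A))"

text \<open>Costs: each time t = M k (k = 0..K) is used in N_HR Hadamard tests (N_HR/2 per variant).\<close>
definition T_max :: "nat \<Rightarrow> real list \<Rightarrow> real" where
  "T_max K Ms = (if Ms = [] then 0 else Max (set Ms) * real K)"

definition T_total :: "nat \<Rightarrow> nat \<Rightarrow> real list \<Rightarrow> real" where
  "T_total K N Ms = (\<Sum>M\<leftarrow>Ms. \<Sum>k\<le>K. real N * (M * real k))"

definition N_HR :: "real \<Rightarrow> real \<Rightarrow> real \<Rightarrow> real \<Rightarrow> nat \<Rightarrow> nat" where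
  "N_HR \<alpha> \<rho> \<eta> \<epsilon> K = 2 * nat \<lceil>4 / \<alpha>\<^sup>2 * (ln (4 / \<rho>) + ln (real_of_int \<lceil>log 2 (\<eta> / \<epsilon>)\<rceil> + 1)
                                       + ln (real K + 1))\<rceil>"

end

theory Submission
  imports Defs
begin

text \<open>
  Expanding the initial state in eigenvectors of \<open>H\<close> shows that \<open>\<langle>\<psi>|U\<^sup>t|\<psi>\<rangle>\<close> is a sum of phases
  \<open>e\<^sup>-\<^sup>2\<^sup>\<pi>\<^sup>i\<^sup>\<lambda>\<^sup>t\<close> with nonnegative weights: weight at least \<open>\<beta>\<close> on each \<open>\<lambda>\<^sub>s\<close>, at most \<open>\<omega>\<close> in total elsewhere.
  By Hoeffding's inequality and a union bound, with probability at least \<open>1 - \<rho>\<close> all the estimates are within \<open>\<alpha>\<close>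
  of these overlaps. By Poisson summation the untruncated filter is a periodised Gaussian, hence nonnegative and of
  relative size at most about \<open>(\<beta> - \<omega>) / 12\<close> beyond distance \<open>\<tau> / K\<close>, which is also the size of the truncation
  error. So \<open>X\<^sub>\<ell>\<close> contains all \<open>M\<^sub>\<ell>\<lambda>\<^sub>s\<close> and stays within \<open>\<tau> / K\<close> of them; after closing the gaps, every arc of
  \<open>Y\<^sub>\<ell>\<close> contains some \<open>M\<^sub>\<ell>\<lambda>\<^sub>s\<close> modulo 1 and stays within \<open>\<eta> / 2\<close> of these points. The rule for \<open>m\<^sub>\<ell>\<close> makes the
  admissible lift unique, which propagates \<open>\<Lambda> \<subseteq> E\<^sub>\<ell> \<subseteq> B(\<Lambda>, \<eta> / (2 M\<^sub>\<ell>))\<close>. An admissible \<open>m\<^sub>\<ell>\<close> always exists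
  because the values of \<open>1 / m\<^sub>\<ell>\<close> excluded by pairs of eigenvalues have total length below \<open>1 / 4\<close>.
\<close>

unbundle no vec_syntax

section \<open>Spectral decomposition of the overlap\<close>

text \<open>No gap between eigenvalues is assumed, so eigenphases may cluster and the arcs around
  them may merge into arcs of any length. Error bounds therefore measure the distance to the set
  \<Lambda>, never to an individual eigenvalue, and an arc is lifted as a whole. Two dangers shape
  the argument: an arc without an eigenphase, for which no integer shift is right, and an arc
  reaching phases that belong to different integer translates of the spectrum. Filling gaps shorter
  than the localisation radius \<tau>/K excludes the first, because a stray arc lies closer than
  that to an eigenphase; the separation demanded of \<open>m\<close> excludes the second. The
  constant 3 in the bound on K is 2 * (1 + 1/2): the radius \<tau>/K plus half a filled gap must not
  exceed \<eta>/2. The bound on \<eta> makes the lengths excluded by S(S-1)/2 pairs, 8\<eta> each,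
  sum to less than 1/4. The residual state need not be an eigenvector and its phases are unknown:
  only the bound \<omega> on its weight is available, which is why the threshold lies above
  \<omega>.\<close>

definition lincomb_vec :: "nat \<Rightarrow> 'i set \<Rightarrow> ('i \<Rightarrow> complex) \<Rightarrow> ('i \<Rightarrow> complex vec) \<Rightarrow> complex vec" where
  "lincomb_vec n I a f = vec n (\<lambda>i. \<Sum>s\<in>I. a s * f s $ i)"

lemma lincomb_vec_carrier [simp]: "lincomb_vec n I a f \<in> carrier_vec n"
  by (simp add: lincomb_vec_def)

lemma mult_mat_lincomb_vec:
  assumes A: "A \<in> carrier_mat n n" and f: "\<And>s. s \<in> I \<Longrightarrow> f s \<in> carrier_vec n"
  shows "A *\<^sub>v lincomb_vec n I a f = lincomb_vec n I a (\<lambda>s. A *\<^sub>v f s)"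
proof (rule eq_vecI)
  fix i assume "i < dim_vec (lincomb_vec n I a (\<lambda>s. A *\<^sub>v f s))"
  then have i: "i < n" by (simp add: lincomb_vec_def)
  have "(A *\<^sub>v lincomb_vec n I a f) $ i = (\<Sum>j=0..<n. A $$ (i,j) * (\<Sum>s\<in>I. a s * f s $ j))"
    using A i by (auto simp: scalar_prod_def lincomb_vec_def)
  also have "\<dots> = (\<Sum>s\<in>I. \<Sum>j=0..<n. a s * (A $$ (i,j) * f s $ j))"
    by (subst sum.swap) (simp add: sum_distrib_left mult_ac)
  also have "\<dots> = lincomb_vec n I a (\<lambda>s. A *\<^sub>v f s) $ i"
  proof -
    have "(\<Sum>j=0..<n. a s * (A $$ (i,j) * f s $ j)) = a s * (A *\<^sub>v f s) $ i" if "s \<in> I" for s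
      using A i f[OF that] by (auto simp: scalar_prod_def sum_distrib_left)
    then show ?thesis using i by (simp add: lincomb_vec_def)
  qed
  finally show "(A *\<^sub>v lincomb_vec n I a f) $ i = lincomb_vec n I a (\<lambda>s. A *\<^sub>v f s) $ i" .
qed (use A in \<open>auto simp: lincomb_vec_def\<close>)

lemma cscalar_prod_lincomb_left:
  assumes f: "\<And>s. s \<in> I \<Longrightarrow> f s \<in> carrier_vec n" and w: "w \<in> carrier_vec n"
  shows "lincomb_vec n I a f \<bullet>c w = (\<Sum>s\<in>I. a s * (f s \<bullet>c w))"
proof -
  have "lincomb_vec n I a f \<bullet>c w = (\<Sum>j=0..<n. (\<Sum>s\<in>I. a s * f s $ j) * conjugate (w $ j))"
    using w by (auto simp: scalar_prod_def lincomb_vec_def)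
  also have "\<dots> = (\<Sum>s\<in>I. \<Sum>j=0..<n. a s * (f s $ j * conjugate (w $ j)))"
    by (subst sum.swap) (simp add: sum_distrib_left mult_ac)
  also have "\<dots> = (\<Sum>s\<in>I. a s * (f s \<bullet>c w))"
    using w f by (intro sum.cong) (auto simp: scalar_prod_def sum_distrib_left)
  finally show ?thesis .
qed

lemma cscalar_prod_cnj:
  assumes "v \<in> carrier_vec n" and "w \<in> carrier_vec n"
  shows "v \<bullet>c w = cnj (w \<bullet>c v)"
  using assms by (auto simp: scalar_prod_def mult_ac)

lemma cscalar_prod_lincomb_right:
  assumes f: "\<And>s. s \<in> I \<Longrightarrow> f s \<in> carrier_vec n" and w: "w \<in> carrier_vec n"
  shows "w \<bullet>c lincomb_vec n I a f = (\<Sum>s\<in>I. cnj (a s) * (w \<bullet>c f s))"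
proof -
  have "w \<bullet>c lincomb_vec n I a f = cnj (\<Sum>s\<in>I. a s * (f s \<bullet>c w))"
    unfolding cscalar_prod_cnj[OF w lincomb_vec_carrier] by (subst cscalar_prod_lincomb_left[OF f w]) auto
  also have "\<dots> = (\<Sum>s\<in>I. cnj (a s) * (w \<bullet>c f s))"
    by (simp add: cscalar_prod_cnj[OF w f] cong: sum.cong)
  finally show ?thesis .
qed

lemma cscalar_prod_hermitian:
  assumes H: "hermitian_mat H" and n: "dim_row H = n"
    and v: "v \<in> carrier_vec n" and w: "w \<in> carrier_vec n"
  shows "(H *\<^sub>v v) \<bullet>c w = v \<bullet>c (H *\<^sub>v w)"
proof -
  have Hc: "H \<in> carrier_mat n n" and adj: "mat_adjoint H = H"
    using H n by (auto simp: hermitian_mat_def)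
  have sym: "H $$ (i,j) = cnj (H $$ (j,i))" if "i < n" "j < n" for i j
  proof -
    have "mat_adjoint H $$ (i,j) = cnj (H $$ (j,i))"
      using Hc that by (auto simp: mat_adjoint_def mat_of_rows_def)
    then show ?thesis by (simp add: adj)
  qed
  have "(H *\<^sub>v v) \<bullet>c w = (\<Sum>i=0..<n. \<Sum>j=0..<n. H $$ (i,j) * v $ j * cnj (w $ i))"
    using Hc v w by (auto simp: scalar_prod_def sum_distrib_right intro!: sum.cong)
  also have "\<dots> = (\<Sum>j=0..<n. \<Sum>i=0..<n. H $$ (i,j) * v $ j * cnj (w $ i))"
    by (rule sum.swap)
  also have "\<dots> = (\<Sum>j=0..<n. \<Sum>i=0..<n. v $ j * cnj (H $$ (j,i) * w $ i))"
    by (intro sum.cong refl) (auto simp: sym[symmetric] mult_ac)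
  also have "\<dots> = v \<bullet>c (H *\<^sub>v w)"
    using Hc v w by (auto simp: scalar_prod_def sum_distrib_left intro!: sum.cong)
  finally show ?thesis .
qed

text \<open>One component per eigenvalue, so distinct components are orthogonal when
  \<open>H\<close> is Hermitian and \<open>F\<close> is real. Components may vanish, which lets a
  single finite set \<open>F\<close> serve all vectors at once.\<close>

definition spectral_sum :: "complex mat \<Rightarrow> complex set \<Rightarrow> complex vec \<Rightarrow> bool" where
  "spectral_sum H F w \<longleftrightarrow> (\<exists>f. (\<forall>\<mu>\<in>F. f \<mu> \<in> carrier_vec (dim_row H) \<and> H *\<^sub>v f \<mu> = \<mu> \<cdot>\<^sub>v f \<mu>) \<and>
     w = lincomb_vec (dim_row H) F (\<lambda>_. 1) f)"

lemma spectral_sum_lincomb: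
  assumes H: "H \<in> carrier_mat n n"
    and w: "\<And>s. s \<in> I \<Longrightarrow> spectral_sum H F (w s)"
  shows "spectral_sum H F (lincomb_vec n I a w)"
proof -
  have n: "dim_row H = n" using H by auto
  obtain f where fc: "\<And>s \<mu>. s \<in> I \<Longrightarrow> \<mu> \<in> F \<Longrightarrow> f s \<mu> \<in> carrier_vec n"
    and fe: "\<And>s \<mu>. s \<in> I \<Longrightarrow> \<mu> \<in> F \<Longrightarrow> H *\<^sub>v f s \<mu> = \<mu> \<cdot>\<^sub>v f s \<mu>"
    and fw: "\<And>s. s \<in> I \<Longrightarrow> w s = lincomb_vec n F (\<lambda>_. 1) (f s)"
    using w unfolding spectral_sum_def n by metis
  let ?g = "\<lambda>\<mu>. lincomb_vec n I a (\<lambda>s. f s \<mu>)"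
  have "H *\<^sub>v ?g \<mu> = \<mu> \<cdot>\<^sub>v ?g \<mu>" if "\<mu> \<in> F" for \<mu>
  proof -
    have "H *\<^sub>v ?g \<mu> = lincomb_vec n I a (\<lambda>s. H *\<^sub>v f s \<mu>)"
      using mult_mat_lincomb_vec[OF H, of I "\<lambda>s. f s \<mu>" a] fc that by blast
    also have "\<dots> = \<mu> \<cdot>\<^sub>v ?g \<mu>"
      by (rule eq_vecI) (use carrier_vecD[OF fc] fe that in \<open>auto simp: lincomb_vec_def sum_distrib_left mult_ac intro!: sum.cong\<close>)
    finally show ?thesis .
  qed
  moreover have "lincomb_vec n I a w = lincomb_vec n F (\<lambda>_. 1) ?g"
  proof (rule eq_vecI)
    fix i assume "i < dim_vec (lincomb_vec n F (\<lambda>_. 1) ?g)"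
    then have i: "i < n" by (simp add: lincomb_vec_def)
    have "lincomb_vec n I a w $ i = (\<Sum>s\<in>I. \<Sum>\<mu>\<in>F. a s * f s \<mu> $ i)"
      using i fw by (auto simp: lincomb_vec_def sum_distrib_left intro!: sum.cong)
    also have "\<dots> = lincomb_vec n F (\<lambda>_. 1) ?g $ i"
      using i by (subst sum.swap) (simp add: lincomb_vec_def)
    finally show "lincomb_vec n I a w $ i = lincomb_vec n F (\<lambda>_. 1) ?g $ i" .
  qed (simp add: lincomb_vec_def)
  ultimately show ?thesis
    unfolding spectral_sum_def n by (intro exI[of _ ?g]) auto
qed

text \<open>A Hermitian matrix has no Jordan block of size two, so adjoining one more generalised
  eigenvector stays inside the span of the eigenvectors.\<close>
lemma spectral_sum_step:
  assumes herm: "hermitian_mat H" and n: "dim_row H = n" and F: "finite F"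
    and \<mu>: "\<mu> \<in> F" "\<mu> \<in> \<real>"
    and p: "p \<in> carrier_vec n"
    and v: "spectral_sum H F v" and Hp: "H *\<^sub>v p = \<mu> \<cdot>\<^sub>v p + v"
  shows "spectral_sum H F p"
proof -
  have H: "H \<in> carrier_mat n n" using herm n by (auto simp: hermitian_mat_def)
  obtain f where fc: "\<And>\<nu>. \<nu> \<in> F \<Longrightarrow> f \<nu> \<in> carrier_vec n"
    and fe: "\<And>\<nu>. \<nu> \<in> F \<Longrightarrow> H *\<^sub>v f \<nu> = \<nu> \<cdot>\<^sub>v f \<nu>"
    and fv: "v = lincomb_vec n F (\<lambda>_. 1) f"
    using v unfolding spectral_sum_def n by metis
  \<comment> \<open>\<open>w\<close> solves \<open>(H - \<mu>) w = v - f \<mu>\<close>, by dividing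
    each component by \<open>\<nu> - \<mu>\<close>. Subtracting it from \<open>p\<close> leaves only
    the resonant part: \<open>(H - \<mu>) u = f \<mu>\<close>.\<close>
  define w where "w = lincomb_vec n (F - {\<mu>}) (\<lambda>\<nu>. 1 / (\<nu> - \<mu>)) f"
  define u where "u = p - w"
  have wc [simp]: "w \<in> carrier_vec n" and uc [simp]: "u \<in> carrier_vec n"
    using p by (auto simp: w_def u_def lincomb_vec_def)
  have fmc [simp]: "f \<mu> \<in> carrier_vec n" using fc \<mu> by auto
  have Hw: "H *\<^sub>v w = lincomb_vec n (F - {\<mu>}) (\<lambda>\<nu>. 1 / (\<nu> - \<mu>)) (\<lambda>\<nu>. H *\<^sub>v f \<nu>)"
    unfolding w_def using mult_mat_lincomb_vec[OF H, of "F - {\<mu>}" f] fc by blast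
  have Hwi: "(H *\<^sub>v w) $ i = \<mu> * w $ i + (\<Sum>\<nu>\<in>F - {\<mu>}. f \<nu> $ i)" if i: "i < n" for i
  proof -
    have "(H *\<^sub>v w) $ i = (\<Sum>\<nu>\<in>F - {\<mu>}. 1 / (\<nu> - \<mu>) * (\<nu> * f \<nu> $ i))"
      unfolding Hw using i fe carrier_vecD[OF fc] by (auto simp: lincomb_vec_def intro!: sum.cong)
    also have "\<dots> = (\<Sum>\<nu>\<in>F - {\<mu>}. \<mu> * (1 / (\<nu> - \<mu>) * f \<nu> $ i) + f \<nu> $ i)"
      by (intro sum.cong refl) (auto simp: field_simps)
    finally show ?thesis
      using i by (simp add: w_def lincomb_vec_def sum.distrib sum_distrib_left)
  qed
  have Hu: "H *\<^sub>v u = \<mu> \<cdot>\<^sub>v u + f \<mu>"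
  proof (rule eq_vecI)
    fix i assume "i < dim_vec (\<mu> \<cdot>\<^sub>v u + f \<mu>)"
    then have i: "i < n" using fmc by auto
    have "(H *\<^sub>v u) $ i = (H *\<^sub>v p) $ i - (H *\<^sub>v w) $ i"
      using H p wc i by (auto simp: u_def mult_minus_distrib_mat_vec)
    also have "\<dots> = (\<mu> \<cdot>\<^sub>v u + f \<mu>) $ i"
      using i unfolding Hp fv Hwi[OF i] u_def
      by (simp add: lincomb_vec_def algebra_simps sum.remove[OF F \<mu>(1)]
          carrier_vecD[OF fmc] carrier_vecD[OF wc] carrier_vecD[OF p])
    finally show "(H *\<^sub>v u) $ i = (\<mu> \<cdot>\<^sub>v u + f \<mu>) $ i" .
  qed (use H in \<open>simp add: carrier_vecD[OF fmc]\<close>)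
  \<comment> \<open>The resonant part vanishes because \<open>H - \<mu>\<close> is self-adjoint for
    real \<open>\<mu>\<close>: the product of \<open>(H - \<mu>) u\<close> with
    \<open>f \<mu>\<close> equals that of \<open>u\<close> with
    \<open>(H - \<mu>) (f \<mu>) = 0\<close>.\<close>
  have "f \<mu> \<bullet>c f \<mu> = (H *\<^sub>v u - \<mu> \<cdot>\<^sub>v u) \<bullet>c f \<mu>"
  proof -
    have "H *\<^sub>v u - \<mu> \<cdot>\<^sub>v u = f \<mu>"
      unfolding Hu by (rule eq_vecI) (simp_all add: carrier_vecD[OF fmc] carrier_vecD[OF uc])
    then show ?thesis by simp
  qed
  also have "\<dots> = (H *\<^sub>v u) \<bullet>c f \<mu> - \<mu> * (u \<bullet>c f \<mu>)"
    using H by (subst minus_scalar_prod_distrib[of _ n])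
      (auto simp: smult_scalar_prod_distrib[OF uc carrier_vec_conjugate[OF fmc]])
  also have "(H *\<^sub>v u) \<bullet>c f \<mu> = u \<bullet>c (H *\<^sub>v f \<mu>)"
    by (rule cscalar_prod_hermitian[OF herm n]) auto
  also have "\<dots> = \<mu> * (u \<bullet>c f \<mu>)"
    using \<mu> fe[OF \<mu>(1)]
    by (auto simp: conjugate_smult_vec Reals_cnj_iff scalar_prod_smult_distrib[OF uc carrier_vec_conjugate[OF fmc]])
  finally have "f \<mu> \<bullet>c f \<mu> = 0" by simp
  then have f0: "f \<mu> = 0\<^sub>v n" using conjugate_square_eq_0_vec[OF fmc] by simp
  define g where "g \<nu> = (if \<nu> = \<mu> then u else (1 / (\<nu> - \<mu>)) \<cdot>\<^sub>v f \<nu>)" for \<nu>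
  have "g \<nu> \<in> carrier_vec n \<and> H *\<^sub>v g \<nu> = \<nu> \<cdot>\<^sub>v g \<nu>" if "\<nu> \<in> F" for \<nu>
  proof (cases "\<nu> = \<mu>")
    case True
    then show ?thesis unfolding g_def using Hu f0 uc by auto
  next
    case False
    then show ?thesis
      using fc[OF that] fe[OF that] H by (auto simp: g_def mult_mat_vec smult_smult_assoc mult_ac)
  qed
  moreover have "p = lincomb_vec n F (\<lambda>_. 1) g"
  proof (rule eq_vecI)
    fix i assume "i < dim_vec (lincomb_vec n F (\<lambda>_. 1) g)"
    then have i: "i < n" by (simp add: lincomb_vec_def)
    have "(\<Sum>\<nu>\<in>F. g \<nu> $ i) = u $ i + (\<Sum>\<nu>\<in>F - {\<mu>}. g \<nu> $ i)"
      by (simp add: sum.remove[OF F \<mu>(1)] g_def)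
    also have "(\<Sum>\<nu>\<in>F - {\<mu>}. g \<nu> $ i) = w $ i"
      using carrier_vecD[OF fc] i by (auto simp: w_def lincomb_vec_def g_def intro!: sum.cong)
    also have "u $ i + w $ i = p $ i"
      using i by (simp add: u_def carrier_vecD[OF wc])
    finally show "p $ i = lincomb_vec n F (\<lambda>_. 1) g $ i" using i by (simp add: lincomb_vec_def)
  qed (use p in \<open>auto simp: lincomb_vec_def\<close>)
  ultimately show ?thesis unfolding spectral_sum_def n by (intro exI[of _ g]) auto
qed

text \<open>Schur triangulation \<open>H * P = P * B\<close> reads column by column as
  \<open>B $$ (j,j)\<close> times column \<open>j\<close> plus a combination of earlier columns, so
  induction on \<open>j\<close> puts every column of \<open>P\<close> into the span of eigenvectors,
  and invertibility of \<open>P\<close> extends this to all vectors. The diagonal of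
  \<open>B\<close> lists the roots of the characteristic polynomial, which are eigenvalues and hence
  real by assumption.\<close>

lemma hermitian_spectral_sum:
  assumes herm: "hermitian_mat H" and n: "dim_row H = n"
    and real: "\<And>v \<mu>. eigenvector H v \<mu> \<Longrightarrow> \<mu> \<in> \<real>"
  obtains F where "finite F" "F \<subseteq> \<real>" "\<And>w. w \<in> carrier_vec n \<Longrightarrow> spectral_sum H F w"
proof -
  have H: "H \<in> carrier_mat n n" using herm n by (auto simp: hermitian_mat_def)
  obtain es where es: "char_poly H = (\<Prod>a\<leftarrow>es. [:- a, 1:])"
    using char_poly_factorized[OF H] by blast
  obtain B P Q where "schur_decomposition H es = (B, P, Q)" by (cases "schur_decomposition H es") auto
  from schur_decomposition[OF H es this]
  have sim: "similar_mat_wit H B P Q" and ut: "upper_triangular B" and dB: "diag_mat B = es" by auto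
  note S = similar_mat_witD2[OF H sim]
  have esreal: "\<mu> \<in> \<real>" if "\<mu> \<in> set es" for \<mu>
  proof -
    have "poly (char_poly H) \<mu> = 0" using that by (simp add: es poly_prod_list prod_list_zero_iff)
    then have "eigenvalue H \<mu>" using eigenvalue_root_char_poly[OF H] by simp
    then show ?thesis unfolding eigenvalue_def using real by blast
  qed
  have HP: "H * P = P * B"
  proof -
    have "H * P = P * B * (Q * P)" using S by (simp add: assoc_mult_mat[of _ n n _ n _ n])
    then show ?thesis using S by simp
  qed
  have cols: "spectral_sum H (set es) (col P j)" if "j < n" for j
    using that
  proof (induction j rule: less_induct)
    case (less j)
    define v where "v = lincomb_vec n {..<j} (\<lambda>i. B $$ (i,j)) (\<lambda>i. col P i)"
    have v: "spectral_sum H (set es) v"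
      unfolding v_def by (rule spectral_sum_lincomb[OF H]) (use less in auto)
    have Hp: "H *\<^sub>v col P j = B $$ (j,j) \<cdot>\<^sub>v col P j + v"
    proof (rule eq_vecI)
      fix i assume "i < dim_vec (B $$ (j,j) \<cdot>\<^sub>v col P j + v)"
      then have i: "i < n" by (simp add: v_def lincomb_vec_def)
      have "(H *\<^sub>v col P j) $ i = (H * P) $$ (i,j)"
        using S H i less.prems by auto
      also have "\<dots> = (\<Sum>k=0..<n. P $$ (i,k) * B $$ (k,j))"
        unfolding HP using S i less.prems by (auto simp: scalar_prod_def)
      also have "\<dots> = (\<Sum>k\<in>{..<Suc j}. P $$ (i,k) * B $$ (k,j))"
        using less.prems upper_triangularD[OF ut] S by (intro sum.mono_neutral_right) auto
      also have "\<dots> = (B $$ (j,j) \<cdot>\<^sub>v col P j + v) $ i"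
        using i less.prems S by (auto simp: v_def lincomb_vec_def mult_ac intro!: sum.cong)
      finally show "(H *\<^sub>v col P j) $ i = (B $$ (j,j) \<cdot>\<^sub>v col P j + v) $ i" .
    qed (use H in \<open>auto simp: v_def lincomb_vec_def\<close>)
    have "B $$ (j,j) \<in> set es" using less.prems S by (auto simp: dB[symmetric] diag_mat_def)
    then show ?case
      using S less.prems by (intro spectral_sum_step[OF herm n _ _ esreal _ v Hp]) auto
  qed
  have all: "spectral_sum H (set es) w" if w: "w \<in> carrier_vec n" for w
  proof -
    define a where "a = Q *\<^sub>v w"
    have "w = P *\<^sub>v a"
      unfolding a_def using S w by (simp add: assoc_mult_mat_vec[of P n n Q n w, symmetric])
    also have "\<dots> = lincomb_vec n {..<n} (\<lambda>j. a $ j) (\<lambda>j. col P j)"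
      by (rule eq_vecI) (use S w in \<open>auto simp: a_def lincomb_vec_def scalar_prod_def mult_ac lessThan_atLeast0\<close>)
    finally show ?thesis
      using spectral_sum_lincomb[OF H, of "{..<n}" "set es" "\<lambda>j. col P j" "\<lambda>j. a $ j"] cols by simp
  qed
  show thesis by (rule that[of "set es"]) (use esreal all in auto)
qed


section \<open>Evolution and its matrix elements in terms of eigenvectors\<close>

lemma evolution_eigenspace:
  assumes "is_evolution H U" and "dim_row H = n" and v: "v \<in> carrier_vec n" and "H *\<^sub>v v = \<mu> \<cdot>\<^sub>v v"
  shows "U t *\<^sub>v v = exp (- 2 * pi * \<i> * \<mu> * complex_of_real t) \<cdot>\<^sub>v v"
proof (cases "v = 0\<^sub>v n")
  \<comment> \<open>The predicate \<open>eigenvector\<close> excludes zero, whereas components of a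
    \<open>spectral_sum\<close> may be zero.\<close>
  case True
  have "U t \<in> carrier_mat n n" using assms by (auto simp: is_evolution_def)
  then show ?thesis using True by (auto intro!: eq_vecI simp: scalar_prod_def)
next
  case False
  then show ?thesis using assms by (auto simp: is_evolution_def eigenvector_def)
qed

lemma hermitian_eigenvectors_orthogonal:
  assumes "hermitian_mat H" and "dim_row H = n"
    and u: "u \<in> carrier_vec n" "H *\<^sub>v u = \<mu> \<cdot>\<^sub>v u" and v: "v \<in> carrier_vec n" "H *\<^sub>v v = \<nu> \<cdot>\<^sub>v v"
    and "\<nu> \<in> \<real>" and "\<mu> \<noteq> \<nu>"
  shows "u \<bullet>c v = 0"
proof -
  have "\<mu> * (u \<bullet>c v) = (H *\<^sub>v u) \<bullet>c v" using u v by simp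
  also have "\<dots> = u \<bullet>c (H *\<^sub>v v)" by (rule cscalar_prod_hermitian[OF assms(1,2) u(1) v(1)])
  also have "\<dots> = \<nu> * (u \<bullet>c v)" using u v assms(7) by (auto simp: conjugate_smult_vec Reals_cnj_iff)
  finally show ?thesis using assms(8) by simp
qed

lemma cmod_cscalar_prod_self:
  assumes "v \<in> carrier_vec n"
  shows "complex_of_real (cmod (v \<bullet>c v)) = v \<bullet>c v"
proof -
  have "v \<bullet>c v = complex_of_real (\<Sum>i=0..<n. (cmod (v $ i))\<^sup>2)"
    using assms by (auto simp: scalar_prod_def complex_norm_square simp del: of_real_power)
  moreover have "(\<Sum>i=0..<n. (cmod (v $ i))\<^sup>2) \<ge> 0" by (intro sum_nonneg) auto
  ultimately show ?thesis by (metis abs_of_nonneg norm_of_real)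
qed

text \<open>Pairing with an eigenvector \<open>v\<close> kills every component of \<open>w\<close>
  outside the eigenspace of \<open>v\<close>, so \<open>U t\<close> contributes a single phase.
  Pairing with \<open>w\<close> itself turns the squared norms of its components into the
  nonnegative weights \<open>q\<close>; as the eigenvalues are real, \<open>Re \<nu>\<close> is
  \<open>\<nu>\<close> read as a real number.\<close>

lemma evolution_cscalar_prod:
  assumes herm: "hermitian_mat H" and n: "dim_row H = n" and ev: "is_evolution H U"
    and real: "\<And>v \<mu>. eigenvector H v \<mu> \<Longrightarrow> \<mu> \<in> \<real>"
    and w: "w \<in> carrier_vec n"
  shows evolution_cscalar_prod_eigenvector:
      "\<And>v \<mu>. v \<in> carrier_vec n \<Longrightarrow> H *\<^sub>v v = \<mu> \<cdot>\<^sub>v v \<Longrightarrow> \<mu> \<in> \<real> \<Longrightarrow>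
        (U t *\<^sub>v w) \<bullet>c v = exp (- 2 * pi * \<i> * \<mu> * complex_of_real t) * (w \<bullet>c v)"
    and evolution_cscalar_prod_self: "\<exists>F q. finite F \<and> (\<forall>\<nu>\<in>F. q \<nu> \<ge> 0) \<and>
      (\<Sum>\<nu>\<in>F. q \<nu>) = cmod (w \<bullet>c w) \<and>
      (\<forall>t. (U t *\<^sub>v w) \<bullet>c w =
        (\<Sum>\<nu>\<in>F. complex_of_real (q \<nu>) * exp (- 2 * pi * \<i> * complex_of_real (Re \<nu>) * complex_of_real t)))"
proof -
  obtain F where F: "finite F" "F \<subseteq> \<real>" and "spectral_sum H F w"
    using hermitian_spectral_sum[OF herm n] real w by metis
  then obtain f where fc: "\<And>\<nu>. \<nu> \<in> F \<Longrightarrow> f \<nu> \<in> carrier_vec n"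
    and fe: "\<And>\<nu>. \<nu> \<in> F \<Longrightarrow> H *\<^sub>v f \<nu> = \<nu> \<cdot>\<^sub>v f \<nu>"
    and fw: "w = lincomb_vec n F (\<lambda>_. 1) f"
    unfolding spectral_sum_def n by metis
  define e where "e t \<mu> = exp (- 2 * pi * \<i> * \<mu> * complex_of_real t)" for t \<mu>
  have Uw: "U t *\<^sub>v w = lincomb_vec n F (e t) f" for t
  proof -
    have Uc: "U t \<in> carrier_mat n n" using ev n by (auto simp: is_evolution_def)
    have "U t *\<^sub>v w = lincomb_vec n F (\<lambda>_. 1) (\<lambda>\<nu>. U t *\<^sub>v f \<nu>)"
      unfolding fw using mult_mat_lincomb_vec[OF Uc, of F f] fc by blast
    also have "\<dots> = lincomb_vec n F (e t) f"
      by (rule eq_vecI) (use carrier_vecD[OF fc] in \<open>auto simp: lincomb_vec_def e_def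
          evolution_eigenspace[OF ev n fc fe] intro!: sum.cong\<close>)
    finally show ?thesis .
  qed
  have "(U t *\<^sub>v w) \<bullet>c v = e t \<mu> * (w \<bullet>c v)"
    if v: "v \<in> carrier_vec n" "H *\<^sub>v v = \<mu> \<cdot>\<^sub>v v" "\<mu> \<in> \<real>" for t v \<mu>
  proof -
    have "(U t *\<^sub>v w) \<bullet>c v = (\<Sum>\<nu>\<in>F. e t \<nu> * (f \<nu> \<bullet>c v))"
      unfolding Uw by (rule cscalar_prod_lincomb_left[OF fc v(1)])
    also have "\<dots> = (\<Sum>\<nu>\<in>F. e t \<mu> * (1 * (f \<nu> \<bullet>c v)))"
      using hermitian_eigenvectors_orthogonal[OF herm n fc fe v] by (intro sum.cong refl) auto
    also have "\<dots> = e t \<mu> * (w \<bullet>c v)"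
      unfolding fw by (subst cscalar_prod_lincomb_left[OF fc v(1)]) (auto simp: sum_distrib_left)
    finally show ?thesis .
  qed
  then show "\<And>v \<mu>. v \<in> carrier_vec n \<Longrightarrow> H *\<^sub>v v = \<mu> \<cdot>\<^sub>v v \<Longrightarrow> \<mu> \<in> \<real> \<Longrightarrow>
        (U t *\<^sub>v w) \<bullet>c v = exp (- 2 * pi * \<i> * \<mu> * complex_of_real t) * (w \<bullet>c v)"
    by (simp add: e_def)
  have fw': "f \<nu> \<bullet>c w = complex_of_real (cmod (f \<nu> \<bullet>c f \<nu>))" if \<nu>: "\<nu> \<in> F" for \<nu>
  proof -
    have "f \<nu> \<bullet>c w = (\<Sum>\<mu>\<in>F. f \<nu> \<bullet>c f \<mu>)"
      unfolding fw by (subst cscalar_prod_lincomb_right[OF fc fc[OF \<nu>]]) auto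
    also have "\<dots> = (\<Sum>\<mu>\<in>F. if \<mu> = \<nu> then f \<nu> \<bullet>c f \<nu> else 0)"
      using F hermitian_eigenvectors_orthogonal[OF herm n fc[OF \<nu>] fe[OF \<nu>] fc fe]
      by (intro sum.cong refl) auto
    finally show ?thesis using F \<nu> by (simp add: cmod_cscalar_prod_self[OF fc])
  qed
  have "w \<bullet>c w = (\<Sum>\<nu>\<in>F. f \<nu> \<bullet>c w)"
    by (subst (1) fw, subst cscalar_prod_lincomb_left[OF fc w]) auto
  then have "w \<bullet>c w = complex_of_real (\<Sum>\<nu>\<in>F. cmod (f \<nu> \<bullet>c f \<nu>))" by (simp add: fw')
  then have ww: "(\<Sum>\<nu>\<in>F. cmod (f \<nu> \<bullet>c f \<nu>)) = cmod (w \<bullet>c w)"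
    by (simp only: norm_of_real) (simp add: sum_nonneg)
  have Uww: "(U t *\<^sub>v w) \<bullet>c w =
      (\<Sum>\<nu>\<in>F. complex_of_real (cmod (f \<nu> \<bullet>c f \<nu>)) * e t (complex_of_real (Re \<nu>)))" for t
  proof -
    have "(U t *\<^sub>v w) \<bullet>c w = (\<Sum>\<nu>\<in>F. e t \<nu> * (f \<nu> \<bullet>c w))"
      unfolding Uw by (rule cscalar_prod_lincomb_left[OF fc w])
    also have "\<dots> = (\<Sum>\<nu>\<in>F. complex_of_real (cmod (f \<nu> \<bullet>c f \<nu>)) * e t (complex_of_real (Re \<nu>)))"
      using F by (intro sum.cong refl) (auto simp: fw' mult.commute complex_is_Real_iff complex_eq_iff subset_iff)
    finally show ?thesis .
  qed
  show "\<exists>F q. finite F \<and> (\<forall>\<nu>\<in>F. q \<nu> \<ge> 0) \<and> (\<Sum>\<nu>\<in>F. q \<nu>) = cmod (w \<bullet>c w) \<and>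
      (\<forall>t. (U t *\<^sub>v w) \<bullet>c w =
        (\<Sum>\<nu>\<in>F. complex_of_real (q \<nu>) * exp (- 2 * pi * \<i> * complex_of_real (Re \<nu>) * complex_of_real t)))"
    using F(1) ww Uww unfolding e_def
    by (intro exI[of _ F] exI[of _ "\<lambda>\<nu>. cmod (f \<nu> \<bullet>c f \<nu>)"]) auto
qed

text \<open>The cross terms vanish: the \<open>psis s\<close> are orthonormal, and
  \<open>U t *\<^sub>v psires\<close> stays orthogonal to each of them, since pairing with an
  eigenvector only multiplies by a phase. \<open>psires\<close> itself is expanded in
  eigencomponents, whose weights are scaled by the squared modulus of \<open>cres\<close>.\<close>

lemma overlap_decomposition:
  fixes S :: nat
  assumes herm: "hermitian_mat H" and ev: "is_evolution H U"
    and real: "\<And>v \<mu>. eigenvector H v \<mu> \<Longrightarrow> \<mu> \<in> \<real>"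
    and eig: "\<And>s. s \<in> {1..S} \<Longrightarrow> psis s \<in> carrier_vec (dim_row H) \<and>
                   H *\<^sub>v psis s = complex_of_real (lam s) \<cdot>\<^sub>v psis s"
    and on: "\<And>s s'. s \<in> {1..S} \<Longrightarrow> s' \<in> {1..S} \<Longrightarrow> psis s \<bullet>c psis s' = (if s = s' then 1 else 0)"
    and res: "psires \<in> carrier_vec (dim_row H)" "psires \<bullet>c psires = 1"
      "\<And>s. s \<in> {1..S} \<Longrightarrow> psis s \<bullet>c psires = 0"
    and psi: "psi = vec (dim_row H) (\<lambda>i. (\<Sum>s\<in>{1..S}. c s * psis s $ i) + cres * psires $ i)"
    and norm: "psi \<bullet>c psi = 1"
  shows overlap_weights: "(\<Sum>s\<in>{1..S}. (cmod (c s))\<^sup>2) + (cmod cres)\<^sup>2 = 1"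
    and overlap_spectral: "\<exists>(F::complex set) q. finite F \<and> (\<forall>\<nu>\<in>F. q \<nu> \<ge> 0) \<and> (\<Sum>\<nu>\<in>F. q \<nu>) = (cmod cres)\<^sup>2 \<and>
      (\<forall>t. overlap U psi t =
          (\<Sum>s\<in>{1..S}. complex_of_real ((cmod (c s))\<^sup>2) * exp (- 2 * pi * \<i> * lam s * t)) +
          (\<Sum>\<nu>\<in>F. complex_of_real (q \<nu>) * exp (- 2 * pi * \<i> * Re \<nu> * t)))"
proof -
  define n where "n = dim_row H"
  have n: "dim_row H = n" by (simp add: n_def)
  \<comment> \<open>Index 0 stands for the residual part, so that \<open>psi\<close> is one
    \<open>lincomb_vec\<close> over an orthonormal family.\<close>
  define d where "d s = (if s = 0 then cres else c s)" for s :: nat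
  define p where "p s = (if s = 0 then psires else psis s)" for s :: nat
  define e where "e t s = exp (- 2 * pi * \<i> * lam s * complex_of_real t)" for t s
  have split: "(\<Sum>s\<in>{0..S}. g s) = g 0 + (\<Sum>s\<in>{1..S}. g s)" for g :: "nat \<Rightarrow> complex"
    by (simp add: sum.atLeast_Suc_atMost)
  have "(\<Sum>s\<in>{1..S}. d s * p s $ i) = (\<Sum>s\<in>{1..S}. c s * psis s $ i)" for i
    by (intro sum.cong) (auto simp: d_def p_def)
  then have psi': "psi = lincomb_vec n {0..S} d p"
    unfolding psi n lincomb_vec_def split by (auto simp: d_def p_def)
  have pc: "p s \<in> carrier_vec n" if "s \<in> {0..S}" for s
    using eig[of s] res that by (auto simp: p_def n)
  have res': "psires \<bullet>c psis s = 0" if "s \<in> {1..S}" for s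
    using cscalar_prod_cnj[OF res(1), of "psis s"] eig[OF that] res(3)[OF that] by auto
  have on': "p s \<bullet>c p s' = (if s = s' then 1 else 0)" if "s \<in> {0..S}" "s' \<in> {0..S}" for s s'
    using on[of s s'] res res' that by (auto simp: p_def)
  have psic: "psi \<in> carrier_vec n" by (simp add: psi')
  have ppsi: "v \<bullet>c psi = (\<Sum>s\<in>{0..S}. cnj (d s) * (v \<bullet>c p s))" if "v \<in> carrier_vec n" for v
    unfolding psi' by (rule cscalar_prod_lincomb_right[OF pc that])
  have ppsi': "p s \<bullet>c psi = cnj (d s)" if s: "s \<in> {0..S}" for s
  proof -
    have "p s \<bullet>c psi = (\<Sum>s'\<in>{0..S}. if s' = s then cnj (d s) else 0)"
      unfolding ppsi[OF pc[OF s]] using on'[OF s] by (intro sum.cong refl) auto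
    then show ?thesis using s by (simp del: atLeastAtMost_iff)
  qed
  have "psi \<bullet>c psi = (\<Sum>s\<in>{0..S}. d s * (p s \<bullet>c psi))"
    by (subst (1) psi', rule cscalar_prod_lincomb_left[OF pc psic])
  also have "\<dots> = (\<Sum>s\<in>{0..S}. complex_of_real ((cmod (d s))\<^sup>2))"
    by (intro sum.cong refl) (simp add: ppsi' complex_norm_square del: of_real_power)
  also have "\<dots> = complex_of_real ((cmod cres)\<^sup>2) + (\<Sum>s\<in>{1..S}. complex_of_real ((cmod (c s))\<^sup>2))"
    unfolding split by (simp add: d_def)
  also have "\<dots> = complex_of_real ((\<Sum>s\<in>{1..S}. (cmod (c s))\<^sup>2) + (cmod cres)\<^sup>2)" by simp
  finally show "(\<Sum>s\<in>{1..S}. (cmod (c s))\<^sup>2) + (cmod cres)\<^sup>2 = 1"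
    using norm by (metis of_real_eq_1_iff)
  have Uc: "U t \<in> carrier_mat n n" for t using ev n by (auto simp: is_evolution_def)
  have Up: "U t *\<^sub>v p s \<in> carrier_vec n" if "s \<in> {0..S}" for t s
    using pc[OF that] Uc[of t] by auto
  have Us: "(U t *\<^sub>v p s) \<bullet>c psi = e t s * cnj (c s)" if s: "s \<in> {1..S}" for t s
  proof -
    have "U t *\<^sub>v p s = e t s \<cdot>\<^sub>v p s"
      unfolding e_def using eig[OF s] s
      by (intro evolution_eigenspace[OF ev n]) (auto simp: p_def n)
    then have "(U t *\<^sub>v p s) \<bullet>c psi = e t s * (p s \<bullet>c psi)" using pc[of s] psic s by auto
    then show ?thesis using ppsi'[of s] s by (auto simp: d_def)
  qed
  have U0: "(U t *\<^sub>v p 0) \<bullet>c psi = cnj cres * ((U t *\<^sub>v psires) \<bullet>c psires)" for t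
  proof -
    have "(U t *\<^sub>v p 0) \<bullet>c p s = 0" if s: "s \<in> {1..S}" for s
    proof -
      have "(U t *\<^sub>v p 0) \<bullet>c p s = exp (- 2 * pi * \<i> * complex_of_real (lam s) * complex_of_real t) * (p 0 \<bullet>c p s)"
        using eig[OF s] s pc[of 0] pc[of s]
        by (intro evolution_cscalar_prod_eigenvector[OF herm n ev real]) (auto simp: p_def n)
      then show ?thesis using on'[of 0 s] s by auto
    qed
    then have "(\<Sum>s\<in>{1..S}. cnj (d s) * ((U t *\<^sub>v p 0) \<bullet>c p s)) = 0" by (intro sum.neutral) auto
    then show ?thesis
      using ppsi[OF Up[of 0]] unfolding split by (simp add: d_def p_def)
  qed
  have ov: "overlap U psi t = (\<Sum>s\<in>{1..S}. complex_of_real ((cmod (c s))\<^sup>2) * e t s) +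
      complex_of_real ((cmod cres)\<^sup>2) * ((U t *\<^sub>v psires) \<bullet>c psires)" for t
  proof -
    have "overlap U psi t = lincomb_vec n {0..S} d (\<lambda>s. U t *\<^sub>v p s) \<bullet>c psi"
      unfolding overlap_def by (subst (1) psi', subst mult_mat_lincomb_vec[OF Uc pc]) auto
    also have "\<dots> = (\<Sum>s\<in>{0..S}. d s * ((U t *\<^sub>v p s) \<bullet>c psi))"
      by (rule cscalar_prod_lincomb_left[OF Up psic])
    also have "\<dots> = cres * (cnj cres * ((U t *\<^sub>v psires) \<bullet>c psires)) + (\<Sum>s\<in>{1..S}. c s * (e t s * cnj (c s)))"
      unfolding split U0 by (intro arg_cong2[of _ _ _ _ "(+)"] sum.cong refl) (auto simp: d_def Us)
    also have "(\<Sum>s\<in>{1..S}. c s * (e t s * cnj (c s))) = (\<Sum>s\<in>{1..S}. complex_of_real ((cmod (c s))\<^sup>2) * e t s)"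
      by (intro sum.cong refl) (simp add: complex_norm_square del: of_real_power)
    finally show ?thesis by (simp add: complex_norm_square mult.assoc del: of_real_power)
  qed
  have "\<exists>F q. finite F \<and> (\<forall>\<nu>\<in>F. q \<nu> \<ge> 0) \<and> (\<Sum>\<nu>\<in>F. q \<nu>) = cmod (psires \<bullet>c psires) \<and>
      (\<forall>t. (U t *\<^sub>v psires) \<bullet>c psires =
        (\<Sum>\<nu>\<in>F. complex_of_real (q \<nu>) * exp (- 2 * pi * \<i> * complex_of_real (Re \<nu>) * complex_of_real t)))"
    by (rule evolution_cscalar_prod_self[OF herm n ev]) (use res(1) n in \<open>auto intro: real\<close>)
  then obtain F :: "complex set" and q where F: "finite F" "\<forall>\<nu>\<in>F. q \<nu> \<ge> 0" and q1: "(\<Sum>\<nu>\<in>F. q \<nu>) = 1"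
    and Uq: "\<And>t. (U t *\<^sub>v psires) \<bullet>c psires =
        (\<Sum>\<nu>\<in>F. complex_of_real (q \<nu>) * exp (- 2 * pi * \<i> * complex_of_real (Re \<nu>) * complex_of_real t))"
    using res(2) by auto
  show "\<exists>(F::complex set) q. finite F \<and> (\<forall>\<nu>\<in>F. q \<nu> \<ge> 0) \<and> (\<Sum>\<nu>\<in>F. q \<nu>) = (cmod cres)\<^sup>2 \<and>
      (\<forall>t. overlap U psi t =
          (\<Sum>s\<in>{1..S}. complex_of_real ((cmod (c s))\<^sup>2) * exp (- 2 * pi * \<i> * lam s * t)) +
          (\<Sum>\<nu>\<in>F. complex_of_real (q \<nu>) * exp (- 2 * pi * \<i> * Re \<nu> * t)))"
  proof (intro exI[of _ F] exI[of _ "\<lambda>\<nu>. (cmod cres)\<^sup>2 * q \<nu>"] conjI allI)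
    show "(\<Sum>\<nu>\<in>F. (cmod cres)\<^sup>2 * q \<nu>) = (cmod cres)\<^sup>2"
      by (simp add: sum_distrib_left[symmetric] q1)
    show "overlap U psi t =
          (\<Sum>s\<in>{1..S}. complex_of_real ((cmod (c s))\<^sup>2) * exp (- 2 * pi * \<i> * lam s * t)) +
          (\<Sum>\<nu>\<in>F. complex_of_real ((cmod cres)\<^sup>2 * q \<nu>) * exp (- 2 * pi * \<i> * Re \<nu> * t))" for t
      unfolding ov Uq e_def by (simp add: sum_distrib_left mult.assoc)
  qed (use F in auto)
qed

section \<open>Concentration of the Hadamard-test estimates\<close>

text \<open>Hoeffding's lemma for a variable in [-1, 1]: the width is 2, so the exponent is
  \<open>l\<^sup>2 * 2\<^sup>2 / 8\<close>. The lower tail is the same lemma for the negated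
  variable.\<close>

lemma nn_integral_exp_pm1_pmf:
  assumes "\<bar>a\<bar> \<le> 1" and "l > 0"
  shows "(\<integral>\<^sup>+x. ennreal (exp (l * (x - a))) \<partial>pm1_pmf a) \<le> ennreal (exp (l\<^sup>2 / 2))"
    and "(\<integral>\<^sup>+x. ennreal (exp (l * (a - x))) \<partial>pm1_pmf a) \<le> ennreal (exp (l\<^sup>2 / 2))"
proof -
  have sup: "x \<in> {1, -1}" if "x \<in> set_pmf (pm1_pmf a)" for x
    using that by (auto simp: pm1_pmf_def split: if_splits)
  have mean: "measure_pmf.expectation (pm1_pmf a) (\<lambda>x. x) = a"
    unfolding pm1_pmf_def using assms(1) by (auto simp: field_simps)
  have meann: "measure_pmf.expectation (pm1_pmf a) (\<lambda>x. - x) = - a"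
    using mean by simp
  interpret A: interval_bounded_random_variable "pm1_pmf a" "\<lambda>x. x" "-1" 1
    by unfold_locales (auto simp: AE_measure_pmf_iff dest!: sup)
  interpret B: interval_bounded_random_variable "pm1_pmf a" "\<lambda>x. - x" "-1" 1
    by unfold_locales (auto simp: AE_measure_pmf_iff dest!: sup)
  show "(\<integral>\<^sup>+x. ennreal (exp (l * (x - a))) \<partial>pm1_pmf a) \<le> ennreal (exp (l\<^sup>2 / 2))"
    using A.Hoeffdings_lemma_nn_integral[OF assms(2)] by (simp add: mean)
  show "(\<integral>\<^sup>+x. ennreal (exp (l * (a - x))) \<partial>pm1_pmf a) \<le> ennreal (exp (l\<^sup>2 / 2))"
    using B.Hoeffdings_lemma_nn_integral[OF assms(2)] by (simp add: meann mean algebra_simps)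
qed

lemma nn_integral_iid_pmf_exp_sum:
  fixes h :: "'a \<Rightarrow> real"
  shows "(\<integral>\<^sup>+xs. ennreal (exp (\<Sum>x\<leftarrow>xs. h x)) \<partial>iid_pmf n p) = (\<integral>\<^sup>+x. ennreal (exp (h x)) \<partial>p) ^ n"
proof (induction n)
  case (Suc n)
  have "(\<integral>\<^sup>+xs. ennreal (exp (\<Sum>x\<leftarrow>xs. h x)) \<partial>iid_pmf (Suc n) p)
      = (\<integral>\<^sup>+x. \<integral>\<^sup>+xs. ennreal (exp (h x)) * ennreal (exp (\<Sum>x\<leftarrow>xs. h x)) \<partial>iid_pmf n p \<partial>p)"
    by (simp add: nn_integral_bind_pmf nn_integral_map_pmf exp_add ennreal_mult)
  also have "\<dots> = (\<integral>\<^sup>+x. ennreal (exp (h x)) * (\<integral>\<^sup>+x. ennreal (exp (h x)) \<partial>p) ^ n \<partial>p)"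
    by (simp add: nn_integral_cmult Suc.IH)
  also have "\<dots> = (\<integral>\<^sup>+x. ennreal (exp (h x)) \<partial>p) ^ Suc n"
    by (simp add: nn_integral_multc)
  finally show ?case .
qed auto

text \<open>Exponential Markov inequality with parameter \<open>l = s\<close>, which minimises the
  exponent \<open>n * (l\<^sup>2 / 2 - l * s)\<close>.\<close>

lemma prob_iid_pmf_sum_ge:
  fixes h :: "'a \<Rightarrow> real" and p :: "'a pmf"
  assumes mgf: "\<And>l. l > 0 \<Longrightarrow> (\<integral>\<^sup>+x. ennreal (exp (l * h x)) \<partial>p) \<le> ennreal (exp (l\<^sup>2 / 2))"
    and "s > 0"
  shows "measure_pmf.prob (iid_pmf n p) {xs. (\<Sum>x\<leftarrow>xs. h x) \<ge> real n * s} \<le> exp (- real n * s\<^sup>2 / 2)"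
proof -
  let ?A = "{xs. (\<Sum>x\<leftarrow>xs. h x) \<ge> real n * s}"
  have "emeasure (iid_pmf n p) ?A = (\<integral>\<^sup>+xs. indicator ?A xs \<partial>iid_pmf n p)" by simp
  also have "\<dots> \<le> (\<integral>\<^sup>+xs. ennreal (exp (- real n * s\<^sup>2)) * ennreal (exp (\<Sum>x\<leftarrow>xs. s * h x)) \<partial>iid_pmf n p)"
  proof (intro nn_integral_mono)
    fix xs :: "'a list"
    show "indicator ?A xs \<le> ennreal (exp (- real n * s\<^sup>2)) * ennreal (exp (\<Sum>x\<leftarrow>xs. s * h x))"
    proof (cases "xs \<in> ?A")
      case True
      then have "s * (real n * s) \<le> s * (\<Sum>x\<leftarrow>xs. h x)" using \<open>s > 0\<close> by (intro mult_left_mono) auto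
      then have "1 \<le> exp (- real n * s\<^sup>2 + (\<Sum>x\<leftarrow>xs. s * h x))"
        by (simp add: sum_list_const_mult power2_eq_square mult_ac)
      then show ?thesis using True
        by (simp add: ennreal_mult[symmetric] exp_add[symmetric] ennreal_le_iff flip: ennreal_1)
    qed auto
  qed
  also have "\<dots> = ennreal (exp (- real n * s\<^sup>2)) * (\<integral>\<^sup>+x. ennreal (exp (s * h x)) \<partial>p) ^ n"
    by (simp add: nn_integral_cmult nn_integral_iid_pmf_exp_sum[where h = "\<lambda>x. s * h x"])
  also have "\<dots> \<le> ennreal (exp (- real n * s\<^sup>2)) * ennreal (exp (s\<^sup>2 / 2)) ^ n"
    by (intro mult_left_mono power_mono mgf \<open>s > 0\<close>) auto
  also have "\<dots> = ennreal (exp (- real n * s\<^sup>2 / 2))"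
    by (simp add: ennreal_power ennreal_mult[symmetric] exp_of_nat_mult[symmetric] exp_add[symmetric] field_simps)
  finally show ?thesis
    by (simp add: measure_pmf.emeasure_eq_measure)
qed

lemma length_iid_pmf: "xs \<in> set_pmf (iid_pmf n p) \<Longrightarrow> length xs = n"
  by (induction n arbitrary: xs) auto

lemma prob_avg_pm1_deviation:
  assumes a: "\<bar>a\<bar> \<le> 1" and "s > 0" and "n > 0"
  shows "measure_pmf.prob (iid_pmf n (pm1_pmf a)) {xs. \<bar>avg xs - a\<bar> \<ge> s} \<le> 2 * exp (- real n * s\<^sup>2 / 2)"
proof -
  let ?p = "iid_pmf n (pm1_pmf a)"
  let ?A = "{xs. (\<Sum>x\<leftarrow>xs. x - a) \<ge> real n * s}" and ?B = "{xs. (\<Sum>x\<leftarrow>xs. a - x) \<ge> real n * s}"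
  have "measure_pmf.prob ?p {xs. \<bar>avg xs - a\<bar> \<ge> s} \<le> measure_pmf.prob ?p (?A \<union> ?B)"
  proof (rule measure_pmf.finite_measure_mono_AE)
    show "AE xs in ?p. xs \<in> {xs. \<bar>avg xs - a\<bar> \<ge> s} \<longrightarrow> xs \<in> ?A \<union> ?B"
    proof (subst AE_measure_pmf_iff, intro ballI impI)
      fix xs assume "xs \<in> set_pmf ?p" and "xs \<in> {xs. \<bar>avg xs - a\<bar> \<ge> s}"
      then have "length xs = n" "\<bar>avg xs - a\<bar> \<ge> s" by (auto dest: length_iid_pmf)
      moreover have "(\<Sum>x\<leftarrow>xs. x - a) = sum_list xs - real (length xs) * a"
        "(\<Sum>x\<leftarrow>xs. a - x) = real (length xs) * a - sum_list xs"
        by (simp_all add: sum_list_subtractf sum_list_triv)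
      ultimately show "xs \<in> ?A \<union> ?B" using \<open>n > 0\<close>
        by (auto simp: avg_def abs_if field_simps split: if_splits)
    qed
  qed auto
  also have "\<dots> \<le> measure_pmf.prob ?p ?A + measure_pmf.prob ?p ?B"
    by (rule measure_subadditive) auto
  also have "\<dots> \<le> exp (- real n * s\<^sup>2 / 2) + exp (- real n * s\<^sup>2 / 2)"
    using nn_integral_exp_pm1_pmf[OF a] \<open>s > 0\<close> by (intro add_mono prob_iid_pmf_sum_ge) auto
  finally show ?thesis by simp
qed

text \<open>Union bound for a two-stage experiment whose second stage depends on the outcome of the
  first. It combines the real with the imaginary part, the times within a level, and the levels of
  an adaptive run.\<close>

lemma prob_bind_pmf_le:
  assumes "\<And>x. x \<in> set_pmf p \<Longrightarrow> x \<notin> B \<Longrightarrow> measure_pmf.prob (q x) A \<le> b" and "b \<ge> 0"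
  shows "measure_pmf.prob (bind_pmf p q) A \<le> measure_pmf.prob p B + b"
proof -
  have "emeasure (bind_pmf p q) A = (\<integral>\<^sup>+x. emeasure (q x) A \<partial>p)"
    by simp
  also have "\<dots> \<le> (\<integral>\<^sup>+x. indicator B x + ennreal b \<partial>p)"
  proof (intro nn_integral_mono_AE, subst AE_measure_pmf_iff, intro ballI)
    fix x assume "x \<in> set_pmf p"
    then show "emeasure (q x) A \<le> indicator B x + ennreal b"
      using assms(1)[of x] add_mono[OF measure_pmf.prob_le_1[of "q x" A] \<open>b \<ge> 0\<close>] \<open>b \<ge> 0\<close>
      by (cases "x \<in> B") (auto simp: measure_pmf.emeasure_eq_measure ennreal_leI
          simp flip: ennreal_1 ennreal_plus intro!: ennreal_leI)
  qed
  also have "\<dots> = emeasure p B + ennreal b"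
    by (simp add: nn_integral_add)
  finally show ?thesis
    using \<open>b \<ge> 0\<close> by (simp add: measure_pmf.emeasure_eq_measure flip: ennreal_plus)
qed

lemma prob_estimate_deviation:
  assumes g: "cmod (g t) \<le> 1" and "\<alpha> > 0" and N: "N div 2 > 0"
  shows "measure_pmf.prob (estimate_pmf g N t) {y. cmod (y - g t) \<ge> \<alpha>} \<le> 4 * exp (- real (N div 2) * \<alpha>\<^sup>2 / 4)"
proof -
  \<comment> \<open>Deviations below \<open>\<alpha> / sqrt 2\<close> in both the real and the
    imaginary part give one below \<open>\<alpha>\<close> in modulus.\<close>
  let ?n = "N div 2" and ?s = "\<alpha> / sqrt 2"
  let ?b = "2 * exp (- real ?n * ?s\<^sup>2 / 2)"
  have s: "?s > 0" using \<open>\<alpha> > 0\<close> by simp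
  have re: "\<bar>Re (g t)\<bar> \<le> 1" and im: "\<bar>Im (g t)\<bar> \<le> 1"
    using g abs_Re_le_cmod[of "g t"] abs_Im_le_cmod[of "g t"] by auto
  have "measure_pmf.prob (estimate_pmf g N t) {y. cmod (y - g t) \<ge> \<alpha>}
     \<le> measure_pmf.prob (iid_pmf ?n (pm1_pmf (Re (g t)))) {xs. \<bar>avg xs - Re (g t)\<bar> \<ge> ?s} + ?b"
    unfolding estimate_pmf_def
  proof (rule prob_bind_pmf_le)
    fix xs assume "xs \<notin> {xs. \<bar>avg xs - Re (g t)\<bar> \<ge> ?s}"
    then have x: "\<bar>avg xs - Re (g t)\<bar> < ?s" by simp
    have "measure_pmf.prob (map_pmf (\<lambda>zs. Complex (avg xs) (avg zs)) (iid_pmf ?n (pm1_pmf (Im (g t))))) {y. cmod (y - g t) \<ge> \<alpha>}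
      \<le> measure_pmf.prob (iid_pmf ?n (pm1_pmf (Im (g t)))) {zs. \<bar>avg zs - Im (g t)\<bar> \<ge> ?s}"
      unfolding measure_map_pmf
    proof (rule measure_pmf.finite_measure_mono)
      show "(\<lambda>zs. Complex (avg xs) (avg zs)) -` {y. cmod (y - g t) \<ge> \<alpha>} \<subseteq> {zs. \<bar>avg zs - Im (g t)\<bar> \<ge> ?s}"
      proof (rule subsetI, rule ccontr)
        fix zs assume zs: "zs \<in> (\<lambda>zs. Complex (avg xs) (avg zs)) -` {y. cmod (y - g t) \<ge> \<alpha>}"
          and "zs \<notin> {zs. \<bar>avg zs - Im (g t)\<bar> \<ge> ?s}"
        then have z: "\<bar>avg zs - Im (g t)\<bar> < ?s" by simp
        have "(avg xs - Re (g t))\<^sup>2 < ?s\<^sup>2" "(avg zs - Im (g t))\<^sup>2 < ?s\<^sup>2"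
          using power_strict_mono[OF x, of 2] power_strict_mono[OF z, of 2] by auto
        then have "(cmod (Complex (avg xs) (avg zs) - g t))\<^sup>2 < \<alpha>\<^sup>2"
          by (simp add: cmod_power2 power_divide)
        then have "cmod (Complex (avg xs) (avg zs) - g t) < \<alpha>"
          by (rule power_less_imp_less_base) (use \<open>\<alpha> > 0\<close> in simp)
        then show False using zs by simp
      qed
    qed auto
    also have "\<dots> \<le> ?b" by (rule prob_avg_pm1_deviation[OF im s N])
    finally show "measure_pmf.prob (map_pmf (\<lambda>zs. Complex (avg xs) (avg zs)) (iid_pmf ?n (pm1_pmf (Im (g t))))) {y. cmod (y - g t) \<ge> \<alpha>} \<le> ?b" .
  qed simp
  also have "\<dots> \<le> ?b + ?b" by (intro add_right_mono prob_avg_pm1_deviation[OF re s N])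
  also have "\<dots> = 4 * exp (- real ?n * \<alpha>\<^sup>2 / 4)" by (simp add: power_divide)
  finally show ?thesis .
qed

lemma prob_seq_pmf_union:
  assumes "\<And>k. k < length ps \<Longrightarrow> measure_pmf.prob (ps ! k) {y. Q k y} \<le> b" and "b \<ge> 0"
  shows "measure_pmf.prob (seq_pmf ps) {ys. \<exists>k<length ps. Q k (ys ! k)} \<le> real (length ps) * b"
  using assms(1)
proof (induction ps arbitrary: Q)
  case (Cons p ps)
  let ?R = "\<lambda>k. Q (Suc k)"
  have IH: "measure_pmf.prob (seq_pmf ps) {ys. \<exists>k<length ps. ?R k (ys ! k)} \<le> real (length ps) * b"
    by (rule Cons.IH) (use Cons.prems[of "Suc _"] in auto)
  have "measure_pmf.prob (seq_pmf (p # ps)) {ys. \<exists>k<length (p # ps). Q k (ys ! k)}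
      \<le> measure_pmf.prob p {y. Q 0 y} + real (length ps) * b"
    unfolding seq_pmf.simps
  proof (rule prob_bind_pmf_le)
    fix x assume x: "x \<notin> {y. Q 0 y}"
    have "(\<lambda>xs. x # xs) -` {ys. \<exists>k<length (p # ps). Q k (ys ! k)} \<subseteq> {ys. \<exists>k<length ps. ?R k (ys ! k)}"
    proof
      fix ys assume "ys \<in> (\<lambda>xs. x # xs) -` {ys. \<exists>k<length (p # ps). Q k (ys ! k)}"
      then obtain k where "k < Suc (length ps)" "Q k ((x # ys) ! k)" by auto
      then show "ys \<in> {ys. \<exists>k<length ps. ?R k (ys ! k)}" using x by (cases k) auto
    qed
    then have "measure_pmf.prob (map_pmf (\<lambda>xs. x # xs) (seq_pmf ps)) {ys. \<exists>k<length (p # ps). Q k (ys ! k)}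
      \<le> measure_pmf.prob (seq_pmf ps) {ys. \<exists>k<length ps. ?R k (ys ! k)}"
      unfolding measure_map_pmf by (rule measure_pmf.finite_measure_mono) auto
    also note IH
    finally show "measure_pmf.prob (map_pmf (\<lambda>xs. x # xs) (seq_pmf ps)) {ys. \<exists>k<length (p # ps). Q k (ys ! k)}
      \<le> real (length ps) * b" .
  qed (use \<open>b \<ge> 0\<close> in auto)
  also have "\<dots> \<le> b + real (length ps) * b" using Cons.prems[of 0] by auto
  finally show ?case by (simp add: algebra_simps)
qed auto

text \<open>The origin of \<open>N_HR\<close>. With \<open>n\<close> runs per variant and
  \<open>x\<close> the sum of the three logarithms, \<open>n * \<alpha>\<^sup>2 / 4 \<ge> x\<close>,
  so one estimate fails with probability at most
  \<open>4 * exp (- x) = \<rho> / ((L + 1) * (K + 1))\<close>. The \<open>K + 1\<close> times of a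
  level then leave \<open>\<rho> / (L + 1)\<close>, to be spent on at most \<open>L + 1\<close>
  levels.\<close>

lemma prob_level_failure:
  assumes g: "\<And>t. cmod (g t) \<le> 1" and "\<alpha> > 0" and "0 < \<rho>" and "\<rho> < 1" and "0 < \<epsilon>" and "\<epsilon> \<le> \<eta>"
  defines "L \<equiv> nat \<lceil>log 2 (\<eta> / \<epsilon>)\<rceil>"
  shows "measure_pmf.prob (level_pmf g (N_HR \<alpha> \<rho> \<eta> \<epsilon> K) K M)
      {ys. \<exists>k\<le>K. cmod (ys ! k - g (M * real k)) \<ge> \<alpha>} \<le> \<rho> / (real L + 1)"
proof -
  define N where "N = N_HR \<alpha> \<rho> \<eta> \<epsilon> K"
  define n where "n = N div 2"
  define x where "x = ln (4 / \<rho>) + ln (real L + 1) + ln (real K + 1)"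
  have "log 2 (\<eta> / \<epsilon>) \<ge> 0" using assms by (subst zero_le_log_cancel_iff) auto
  then have L: "real_of_int \<lceil>log 2 (\<eta> / \<epsilon>)\<rceil> = real L"
    unfolding L_def by (simp add: ceiling_mono order_trans[OF _ le_of_int_ceiling])
  have n: "n = nat \<lceil>4 / \<alpha>\<^sup>2 * x\<rceil>"
    by (simp add: n_def N_def N_HR_def x_def L)
  have "x > 0" unfolding x_def using \<open>0 < \<rho>\<close> \<open>\<rho> < 1\<close> by (intro add_pos_nonneg) (auto simp: field_simps)
  then have pos: "4 / \<alpha>\<^sup>2 * x > 0" using \<open>\<alpha> > 0\<close> by simp
  then have n0: "n > 0" by (simp add: n)
  have "real n \<ge> 4 / \<alpha>\<^sup>2 * x" unfolding n by linarith
  then have nx: "real n * \<alpha>\<^sup>2 / 4 \<ge> x" using \<open>\<alpha> > 0\<close> by (simp add: field_simps)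
  define b where "b = 4 * exp (- real n * \<alpha>\<^sup>2 / 4)"
  have "b \<le> 4 * exp (- x)" using nx by (simp add: b_def)
  also have "\<dots> = \<rho> / ((real L + 1) * (real K + 1))"
  proof -
    have "exp x = 4 / \<rho> * ((real L + 1) * (real K + 1))"
      unfolding x_def using \<open>\<rho> > 0\<close> by (simp add: exp_add)
    moreover have "(real L + 1) * (real K + 1) > 0" by simp
    ultimately show ?thesis using \<open>\<rho> > 0\<close> by (simp only: exp_minus) (simp add: divide_simps)
  qed
  finally have b: "b \<le> \<rho> / ((real L + 1) * (real K + 1))" .
  let ?ps = "map (\<lambda>k. estimate_pmf g N (M * real k)) [0..<K+1]"
  have eq: "{ys. \<exists>k\<le>K. cmod (ys ! k - g (M * real k)) \<ge> \<alpha>} =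
      {ys. \<exists>k<length ?ps. cmod (ys ! k - g (M * real k)) \<ge> \<alpha>}"
    by (auto simp: less_Suc_eq_le)
  have "measure_pmf.prob (level_pmf g N K M) {ys. \<exists>k\<le>K. cmod (ys ! k - g (M * real k)) \<ge> \<alpha>}
      \<le> real (length ?ps) * b"
    unfolding level_pmf_def eq
  proof (rule prob_seq_pmf_union)
    fix k assume k: "k < length ?ps"
    then have "?ps ! k = estimate_pmf g N (M * real k)" by (simp del: upt_Suc)
    then show "measure_pmf.prob (?ps ! k) {y. \<alpha> \<le> cmod (y - g (M * real k))} \<le> b"
      using prob_estimate_deviation[OF g \<open>\<alpha> > 0\<close>] n0 by (simp add: b_def n_def)
  qed (simp add: b_def)
  also have "\<dots> \<le> (real K + 1) * (\<rho> / ((real L + 1) * (real K + 1)))"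
    using b by (intro mult_mono) (auto simp: b_def)
  also have "\<dots> = \<rho> / (real L + 1)"
  proof -
    have "a > 0 \<Longrightarrow> b > 0 \<Longrightarrow> a * (\<rho> / (b * a)) = \<rho> / b" for a b :: real by simp
    then show ?thesis by (metis of_nat_0_less_iff of_nat_Suc zero_less_Suc add.commute)
  qed
  finally show ?thesis by (simp add: N_def)
qed

section \<open>Poisson summation for the Gaussian\<close>

lemma summable_on_int_abs:
  fixes f :: "nat \<Rightarrow> real"
  assumes "summable f" and nonneg: "\<And>n. f n \<ge> 0"
  shows "(\<lambda>n::int. f (nat \<bar>n\<bar>)) summable_on UNIV"
proof -
  have f: "f summable_on UNIV" using assms by (simp add: summable_on_UNIV_nonneg_real_iff)
  have "(\<lambda>n::int. f (nat \<bar>n\<bar>)) summable_on range int"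
    by (subst summable_on_reindex) (use f in \<open>auto simp: o_def\<close>)
  moreover have "(\<lambda>n::int. f (nat \<bar>n\<bar>)) summable_on range (\<lambda>n. - int n)"
    by (subst summable_on_reindex) (use f in \<open>auto simp: o_def inj_def\<close>)
  ultimately have "(\<lambda>n::int. f (nat \<bar>n\<bar>)) summable_on range int \<union> range (\<lambda>n. - int n)"
    by (rule summable_on_union)
  moreover have "n \<in> range int \<union> range (\<lambda>n. - int n)" for n :: int
    by (cases n) (auto intro: rev_image_eqI[of "Suc _"])
  then have "range int \<union> range (\<lambda>n. - int n) = UNIV" by blast
  ultimately show ?thesis by simp
qed

lemma exp_abs_int_summable:
  assumes "c > 0"
  shows "(\<lambda>n::int. exp (- c * \<bar>real_of_int n\<bar>)) summable_on UNIV"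
proof -
  have "summable (\<lambda>n::nat. exp (- c) ^ n)" using assms by (intro summable_geometric) auto
  from summable_on_int_abs[OF this] show ?thesis
    by (simp add: exp_of_nat_mult[symmetric] mult_ac)
qed

lemma gaussian_int_summable:
  assumes "c > 0"
  shows "(\<lambda>k::int. exp (- c * (real_of_int k)\<^sup>2)) summable_on UNIV"
proof (rule summable_on_comparison_test[OF exp_abs_int_summable[OF assms]])
  fix k :: int
  have "\<bar>real_of_int k\<bar> * 1 \<le> \<bar>real_of_int k\<bar> * \<bar>real_of_int k\<bar>"
    by (cases "k = 0") (simp, intro mult_left_mono, auto)
  then have "\<bar>real_of_int k\<bar> \<le> (real_of_int k)\<^sup>2" by (simp add: power2_eq_square)
  then show "exp (- c * (real_of_int k)\<^sup>2) \<le> exp (- c * \<bar>real_of_int k\<bar>)" using assms by simp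
qed auto

text \<open>Expanding \<open>(\<bar>x + y\<bar> - 1)\<^sup>2 \<ge> 0\<close> trades the quadratic
  exponent for a linear one. For \<open>y\<close> running over the integers this is a summable
  majorant, uniform in bounded \<open>x\<close>, as the M-test requires.\<close>

lemma gaussian_shift_bound:
  fixes c x y :: real
  assumes "c > 0" and "\<bar>x\<bar> \<le> B"
  shows "exp (- c * (x + y)\<^sup>2) \<le> exp (c * (1 + B)) * exp (- c * \<bar>y\<bar>)"
proof -
  have "(\<bar>x + y\<bar> - 1)\<^sup>2 \<ge> 0" by simp
  then have "(x + y)\<^sup>2 \<ge> 2 * \<bar>x + y\<bar> - 1" by (simp add: power2_eq_square algebra_simps abs_mult_self_eq)
  moreover have "\<bar>x + y\<bar> \<ge> \<bar>y\<bar> - B" using assms by linarith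
  moreover have "u \<le> a \<Longrightarrow> 0 \<le> a \<Longrightarrow> 2 * a - 1 \<le> w \<Longrightarrow> u - 1 \<le> w" for a u w :: real by linarith
  ultimately have "(x + y)\<^sup>2 \<ge> \<bar>y\<bar> - B - 1" by (meson abs_ge_zero)
  then have "c * (x + y)\<^sup>2 \<ge> c * (\<bar>y\<bar> - B - 1)" using assms by simp
  then show ?thesis by (simp add: exp_add[symmetric] algebra_simps)
qed

text \<open>Translates of a Gaussian of total mass 1 whose Fourier transform is
  \<open>exp (- pi * k\<^sup>2 / \<kappa>\<^sup>2)\<close>. For
  \<open>\<kappa> = K / \<sigma>\<close> the Fourier coefficients are therefore the filter weights
  \<open>phihat\<close>.\<close>

definition periodized_gaussian :: "real \<Rightarrow> real \<Rightarrow> real" where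
  "periodized_gaussian \<kappa> x = (\<Sum>\<^sub>\<infinity>n::int. \<kappa> * exp (- pi * \<kappa>\<^sup>2 * (x + real_of_int n)\<^sup>2))"

definition gaussian_series :: "real \<Rightarrow> real \<Rightarrow> real" where
  "gaussian_series \<kappa> x = (\<Sum>\<^sub>\<infinity>k::int. exp (- pi / \<kappa>\<^sup>2 * (real_of_int k)\<^sup>2) * cos (2 * pi * real_of_int k * x))"

lemma periodized_gaussian_summable:
  assumes "\<kappa> > 0"
  shows "(\<lambda>n::int. \<kappa> * exp (- pi * \<kappa>\<^sup>2 * (x + real_of_int n)\<^sup>2)) summable_on UNIV"
proof (rule summable_on_comparison_test)
  show "(\<lambda>n::int. \<kappa> * (exp (pi * \<kappa>\<^sup>2 * (1 + \<bar>x\<bar>)) * exp (- (pi * \<kappa>\<^sup>2) * \<bar>real_of_int n\<bar>))) summable_on UNIV"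
    using assms by (intro summable_on_cmult_right exp_abs_int_summable) simp
  fix n :: int
  show "\<kappa> * exp (- pi * \<kappa>\<^sup>2 * (x + real_of_int n)\<^sup>2) \<le>
      \<kappa> * (exp (pi * \<kappa>\<^sup>2 * (1 + \<bar>x\<bar>)) * exp (- (pi * \<kappa>\<^sup>2) * \<bar>real_of_int n\<bar>))"
    using gaussian_shift_bound[of "pi * \<kappa>\<^sup>2" x "\<bar>x\<bar>" "real_of_int n"] assms by (intro mult_left_mono) auto
qed (use assms in auto)

text \<open>The factor \<open>cos\<close> is carried along so that termwise integration yields every
  cosine coefficient; \<open>k = 0\<close> yields continuity of the sum itself.\<close>

lemma uniform_limit_periodized_gaussian:
  assumes "\<kappa> > 0"
  shows "uniform_limit {0..1} (\<lambda>Y x. \<Sum>n\<in>Y. \<kappa> * exp (- pi * \<kappa>\<^sup>2 * (x + real_of_int n)\<^sup>2) * cos (2 * pi * real_of_int k * x))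
     (\<lambda>x. periodized_gaussian \<kappa> x * cos (2 * pi * real_of_int k * x)) (finite_subsets_at_top UNIV)"
proof (rule Weierstrass_m_test_general')
  show "(\<lambda>n::int. \<kappa> * (exp (pi * \<kappa>\<^sup>2 * (1 + 1)) * exp (- (pi * \<kappa>\<^sup>2) * \<bar>real_of_int n\<bar>))) summable_on UNIV"
    using assms by (intro summable_on_cmult_right exp_abs_int_summable) simp
  fix n :: int and x :: real assume "x \<in> {0..1}"
  then have "\<kappa> * exp (- pi * \<kappa>\<^sup>2 * (x + real_of_int n)\<^sup>2) \<le>
      \<kappa> * (exp (pi * \<kappa>\<^sup>2 * (1 + 1)) * exp (- (pi * \<kappa>\<^sup>2) * \<bar>real_of_int n\<bar>))"
    using gaussian_shift_bound[of "pi * \<kappa>\<^sup>2" x 1 "real_of_int n"] assms by (intro mult_left_mono) auto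
  moreover have "norm (\<kappa> * exp (- pi * \<kappa>\<^sup>2 * (x + real_of_int n)\<^sup>2) * cos (2 * pi * real_of_int k * x))
      \<le> \<kappa> * exp (- pi * \<kappa>\<^sup>2 * (x + real_of_int n)\<^sup>2) * 1"
    unfolding norm_mult using assms by (intro mult_mono) auto
  ultimately show "norm (\<kappa> * exp (- pi * \<kappa>\<^sup>2 * (x + real_of_int n)\<^sup>2) * cos (2 * pi * real_of_int k * x))
     \<le> \<kappa> * (exp (pi * \<kappa>\<^sup>2 * (1 + 1)) * exp (- (pi * \<kappa>\<^sup>2) * \<bar>real_of_int n\<bar>))" by linarith
next
  fix x :: real
  show "((\<lambda>n. \<kappa> * exp (- pi * \<kappa>\<^sup>2 * (x + real_of_int n)\<^sup>2) * cos (2 * pi * real_of_int k * x)) has_sum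
      periodized_gaussian \<kappa> x * cos (2 * pi * real_of_int k * x)) UNIV"
    unfolding periodized_gaussian_def
    by (intro has_sum_cmult_left has_sum_infsum periodized_gaussian_summable assms)
qed

lemma gaussian_series_has_sum:
  assumes "\<kappa> > 0"
  shows "((\<lambda>k. exp (- pi / \<kappa>\<^sup>2 * (real_of_int k)\<^sup>2) * cos (2 * pi * real_of_int k * x)) has_sum
      gaussian_series \<kappa> x) UNIV"
  unfolding gaussian_series_def
proof (rule has_sum_infsum, rule abs_summable_summable, rule summable_on_comparison_test)
  show "(\<lambda>k::int. exp (- (pi / \<kappa>\<^sup>2) * (real_of_int k)\<^sup>2)) summable_on UNIV"
    using assms by (intro gaussian_int_summable) simp
  fix k :: int
  have "norm (exp (- pi / \<kappa>\<^sup>2 * (real_of_int k)\<^sup>2) * cos (2 * pi * real_of_int k * x))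
      \<le> exp (- pi / \<kappa>\<^sup>2 * (real_of_int k)\<^sup>2) * 1"
    unfolding norm_mult by (intro mult_mono) auto
  then show "norm (exp (- pi / \<kappa>\<^sup>2 * (real_of_int k)\<^sup>2) * cos (2 * pi * real_of_int k * x))
      \<le> exp (- (pi / \<kappa>\<^sup>2) * (real_of_int k)\<^sup>2)" by simp
qed auto

lemma uniform_limit_gaussian_series:
  assumes "\<kappa> > 0"
  shows "uniform_limit {0..1} (\<lambda>Y x. \<Sum>k\<in>Y. exp (- pi / \<kappa>\<^sup>2 * (real_of_int k)\<^sup>2) * cos (2 * pi * real_of_int k * x) * cos (2 * pi * real_of_int j * x))
     (\<lambda>x. gaussian_series \<kappa> x * cos (2 * pi * real_of_int j * x)) (finite_subsets_at_top UNIV)"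
proof (rule Weierstrass_m_test_general')
  show "(\<lambda>k::int. exp (- (pi / \<kappa>\<^sup>2) * (real_of_int k)\<^sup>2)) summable_on UNIV"
    using assms by (intro gaussian_int_summable) simp
  fix k :: int and x :: real
  have "norm (exp (- pi / \<kappa>\<^sup>2 * (real_of_int k)\<^sup>2) * cos (2 * pi * real_of_int k * x) * cos (2 * pi * real_of_int j * x))
      \<le> exp (- pi / \<kappa>\<^sup>2 * (real_of_int k)\<^sup>2) * 1 * 1"
    unfolding norm_mult by (intro mult_mono) auto
  then show "norm (exp (- pi / \<kappa>\<^sup>2 * (real_of_int k)\<^sup>2) * cos (2 * pi * real_of_int k * x) * cos (2 * pi * real_of_int j * x))
      \<le> exp (- (pi / \<kappa>\<^sup>2) * (real_of_int k)\<^sup>2)" by simp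
qed (intro has_sum_cmult_left gaussian_series_has_sum assms)

text \<open>A rescaled characteristic function: substituting \<open>s * x\<close> with
  \<open>s = \<kappa> * sqrt (2 * pi)\<close> relates the integrand to the standard normal density
  times \<open>cos (t * x)\<close>, whose integral is the real part of the characteristic function
  at \<open>t = 2 * pi * k / s\<close>.\<close>

lemma gaussian_cos_integral:
  assumes "\<kappa> > 0"
  shows "integrable lborel (\<lambda>x. \<kappa> * exp (- pi * \<kappa>\<^sup>2 * x\<^sup>2) * cos (2 * pi * k * x))"
    and "(LBINT x. \<kappa> * exp (- pi * \<kappa>\<^sup>2 * x\<^sup>2) * cos (2 * pi * k * x)) = exp (- pi / \<kappa>\<^sup>2 * k\<^sup>2)"
proof -
  define s where "s = \<kappa> * sqrt (2 * pi)"
  define t where "t = 2 * pi * k / s"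
  have s: "s > 0" "s \<noteq> 0" using assms by (auto simp: s_def)
  interpret real_distribution std_normal_distribution by (rule real_dist_normal_dist)
  let ?h = "\<lambda>x. std_normal_density x * cos (t * x)"
  have int: "integrable std_normal_distribution (\<lambda>x. iexp (t * x))"
    by (rule integrable_iexp) auto
  have "integrable std_normal_distribution (\<lambda>x. Re (iexp (t * x)))"
    by (rule integrable_Re[OF int])
  then have "integrable std_normal_distribution (\<lambda>x. cos (t * x))" by (simp add: cos_exp_eq Re_exp)
  then have int1: "integrable lborel ?h"
    by (subst (asm) integrable_density) (auto simp: normal_density_nonneg)
  have "Re (char std_normal_distribution t) = (LINT x|std_normal_distribution. Re (iexp (t * x)))"
    unfolding char_def by (rule integral_Re[OF int, symmetric])
  also have "\<dots> = (LINT x|std_normal_distribution. cos (t * x))" by (simp add: Re_exp)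
  also have "\<dots> = (LBINT x. ?h x)"
    by (subst integral_density) (auto simp: normal_density_nonneg)
  finally have val: "(LBINT x. ?h x) = exp (- (t\<^sup>2) / 2)" by (simp add: char_std_normal_distribution)
  have eq: "s * ?h (0 + s * x) = \<kappa> * exp (- pi * \<kappa>\<^sup>2 * x\<^sup>2) * cos (2 * pi * k * x)" for x
  proof -
    have "std_normal_density (s * x) = 1 / sqrt (2 * pi) * exp (- pi * \<kappa>\<^sup>2 * x\<^sup>2)"
      by (simp add: std_normal_density_def s_def power_mult_distrib mult_ac)
    moreover have "t * (s * x) = 2 * pi * k * x" using s by (simp add: t_def)
    moreover have "s * (1 / sqrt (2 * pi) * E) = \<kappa> * E" for E by (simp add: s_def)
    ultimately show ?thesis by (metis add_0 mult.assoc)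
  qed
  have "integrable lborel (\<lambda>x. s * ?h (0 + s * x))"
    using lborel_integrable_real_affine[OF int1 s(2), of 0] by (rule integrable_mult_right)
  then show "integrable lborel (\<lambda>x. \<kappa> * exp (- pi * \<kappa>\<^sup>2 * x\<^sup>2) * cos (2 * pi * k * x))"
    by (simp only: eq)
  have "exp (- (t\<^sup>2) / 2) = (LBINT x. s * ?h (0 + s * x))"
    using lborel_integral_real_affine[OF s(2), of ?h 0] s val by simp
  also have "\<dots> = (LBINT x. \<kappa> * exp (- pi * \<kappa>\<^sup>2 * x\<^sup>2) * cos (2 * pi * k * x))"
    by (simp only: eq)
  finally show "(LBINT x. \<kappa> * exp (- pi * \<kappa>\<^sup>2 * x\<^sup>2) * cos (2 * pi * k * x)) = exp (- pi / \<kappa>\<^sup>2 * k\<^sup>2)"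
    using assms by (simp add: t_def s_def power_divide power_mult_distrib power2_eq_square field_simps)
qed

lemma tendsto_integral_symmetric_interval:
  fixes h :: "real \<Rightarrow> real"
  assumes h: "integrable lborel h"
  shows "(\<lambda>N. integral {- real N..real N} h) \<longlonglongrightarrow> (LBINT x. h x)"
proof -
  have "(\<lambda>N. LBINT x. indicator {- real N..real N} x *\<^sub>R h x) \<longlonglongrightarrow> (LBINT x. h x)"
  proof (rule integral_dominated_convergence[where w = "\<lambda>x. \<bar>h x\<bar>"])
    show "AE x in lborel. (\<lambda>N. indicator {- real N..real N} x *\<^sub>R h x) \<longlonglongrightarrow> h x"
    proof (intro AE_I2 tendsto_eventually)
      fix x :: real
      obtain N0 :: nat where "\<bar>x\<bar> \<le> real N0" using real_arch_simple by blast
      then show "\<forall>\<^sub>F N in sequentially. indicator {- real N..real N} x *\<^sub>R h x = h x"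
        by (intro eventually_sequentiallyI[of N0]) (auto simp: indicator_def)
    qed
  qed (use h in \<open>auto split: split_indicator\<close>)
  moreover have "(LBINT x. indicator {- real N..real N} x *\<^sub>R h x) = integral {- real N..real N} h" for N
  proof -
    have "set_integrable lborel {- real N..real N} h"
      unfolding set_integrable_def by (intro integrable_mult_indicator h) auto
    then show ?thesis
      using set_borel_integral_eq_integral(2) unfolding set_lebesgue_integral_def by blast
  qed
  ultimately show ?thesis by simp
qed

text \<open>Unfolding: since \<open>cos (2 * pi * k * x)\<close> has period 1, integrating the
  translates over [0, 1] amounts to integrating the unperiodised Gaussian over consecutive unit
  intervals, hence over the line.\<close>

lemma fourier_coeff_periodized_gaussian:
  assumes "\<kappa> > 0"
  shows "integral {0..1} (\<lambda>x. periodized_gaussian \<kappa> x * cos (2 * pi * real_of_int k * x))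
    = exp (- pi / \<kappa>\<^sup>2 * (real_of_int k)\<^sup>2)"
proof -
  define h where "h x = \<kappa> * exp (- pi * \<kappa>\<^sup>2 * x\<^sup>2) * cos (2 * pi * real_of_int k * x)" for x
  have cont: "continuous_on A h" for A unfolding h_def by (intro continuous_intros)
  have shift: "\<kappa> * exp (- pi * \<kappa>\<^sup>2 * (x + real_of_int n)\<^sup>2) * cos (2 * pi * real_of_int k * x) = h (x + real_of_int n)"
    for x n
  proof -
    have "cos (2 * pi * real_of_int k * (x + real_of_int n)) =
        cos (2 * pi * real_of_int k * x + 2 * pi * real_of_int (k * n))"
      by (simp add: algebra_simps)
    also have "\<dots> = cos (2 * pi * real_of_int k * x)"
      by (simp add: cos_add del: of_int_mult)
    finally show ?thesis by (simp add: h_def)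
  qed
  obtain I J where I: "\<And>Y. ((\<lambda>x. \<Sum>n\<in>Y. h (x + real_of_int n)) has_integral I Y) {0..1}"
    and J: "((\<lambda>x. periodized_gaussian \<kappa> x * cos (2 * pi * real_of_int k * x)) has_integral J) {0..1}"
    and IJ: "(I \<longlongrightarrow> J) (finite_subsets_at_top UNIV)"
  proof (rule uniform_limit_integral[OF uniform_limit_periodized_gaussian[OF assms, of k, unfolded shift]])
    show "continuous_on {0..1} (\<lambda>x. \<Sum>n\<in>Y. h (x + real_of_int n))" for Y
      by (intro continuous_on_sum continuous_on_compose2[OF cont[of UNIV]]) (auto intro!: continuous_intros)
  qed auto
  have hint: "h integrable_on {a..b}" for a b by (intro integrable_continuous_real cont)
  have unit: "integral {0..1} (\<lambda>x. h (x + real_of_int n)) = integral {real_of_int n..real_of_int n + 1} h" for n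
    using integral_shift_Icc_real[of 0 1 h "real_of_int n"] by (simp add: add.commute o_def)
  have IN: "I {- int N..<int N} = integral {- real N..real N} h" for N
  proof (induction N)
    case 0
    then show ?case using has_integral_unique[OF I[of "{}"]] by simp
  next
    case (Suc N)
    have I': "I Y = (\<Sum>n\<in>Y. integral {real_of_int n..real_of_int n + 1} h)" for Y
    proof -
      have "I Y = integral {0..1} (\<lambda>x. \<Sum>n\<in>Y. h (x + real_of_int n))"
        using I[of Y] by (simp add: integral_unique)
      also have "\<dots> = (\<Sum>n\<in>Y. integral {0..1} (\<lambda>x. h (x + real_of_int n)))"
      proof (cases "finite Y")
        case True
        then show ?thesis
          by (intro integral_sum integrable_continuous_real continuous_on_compose2[OF cont[of UNIV]])
            (auto intro!: continuous_intros)
      qed simp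
      finally show ?thesis by (simp add: unit)
    qed
    have "{- int (Suc N)..<int (Suc N)} = insert (- int (Suc N)) (insert (int N) {- int N..<int N})"
      by auto
    then have "I {- int (Suc N)..<int (Suc N)} = integral {- 1 - real N..- real N} h
        + (integral {real N..real N + 1} h + integral {- real N..real N} h)"
      using Suc.IH by (simp add: I' algebra_simps)
    also have "\<dots> = integral {- 1 - real N..- real N} h + integral {- real N..real N + 1} h"
      using Henstock_Kurzweil_Integration.integral_combine[of "- real N" "real N" "real N + 1" h] hint by simp
    also have "\<dots> = integral {- 1 - real N..real N + 1} h"
      using Henstock_Kurzweil_Integration.integral_combine[of "- 1 - real N" "- real N" "real N + 1" h] hint by simp
    finally show ?case by (simp add: algebra_simps)
  qed
  \<comment> \<open>Convergence holds along all finite sets of integers; the ranges from -N to N - 1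
    eventually contain each of them and turn the partial sums into integrals over [-N, N].\<close>
  have "filterlim (\<lambda>N. {- int N..<int N}) (finite_subsets_at_top UNIV) sequentially"
  proof (subst filterlim_finite_subsets_at_top, intro allI impI)
    fix X :: "int set" assume "finite X \<and> X \<subseteq> UNIV"
    then have fin: "finite X" by simp
    define N0 where "N0 = nat (\<Sum>x\<in>X. \<bar>x\<bar>) + 1"
    have "x \<in> {- int N..<int N}" if "N0 \<le> N" "x \<in> X" for N x
    proof -
      have "\<bar>x\<bar> \<le> (\<Sum>x\<in>X. \<bar>x\<bar>)" using fin that by (intro member_le_sum) auto
      then show ?thesis using that by (auto simp: N0_def)
    qed
    then show "\<forall>\<^sub>F N in sequentially. finite {- int N..<int N} \<and> X \<subseteq> {- int N..<int N} \<and> {- int N..<int N} \<subseteq> UNIV"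
      by (intro eventually_sequentiallyI[of N0]) blast
  qed
  from filterlim_compose[OF IJ this] have "(\<lambda>N. integral {- real N..real N} h) \<longlonglongrightarrow> J" by (simp add: IN)
  moreover have "(\<lambda>N. integral {- real N..real N} h) \<longlonglongrightarrow> (LBINT x. h x)"
    unfolding h_def by (rule tendsto_integral_symmetric_interval[OF gaussian_cos_integral(1)[OF assms]])
  ultimately have "J = (LBINT x. h x)" by (rule LIMSEQ_unique)
  then show ?thesis
    using J gaussian_cos_integral(2)[OF assms, of "real_of_int k"] by (simp add: h_def integral_unique)
qed

section \<open>Uniqueness of cosine coefficients\<close>

lemma integral_cos_int:
  "integral {0..1} (\<lambda>x. cos (2 * pi * real_of_int k * x)) = (if k = 0 then 1 else 0)"
proof (cases "k = 0")
  case False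
  have "((\<lambda>x. cos (2 * pi * real_of_int k * x)) has_integral
      (sin (2 * pi * real_of_int k * 1) / (2 * pi * real_of_int k) - sin (2 * pi * real_of_int k * 0) / (2 * pi * real_of_int k))) {0..1}"
    using False by (intro fundamental_theorem_of_calculus)
      (auto intro!: derivative_eq_intros simp flip: has_real_derivative_iff_has_vector_derivative)
  then show ?thesis using False by (simp add: integral_unique)
qed simp

lemma integral_cos_cos_int:
  "integral {0..1} (\<lambda>x. cos (2 * pi * real_of_int k * x) * cos (2 * pi * real_of_int j * x))
    = ((if k = j then 1 else 0) + (if k = - j then 1 else 0)) / 2"
proof -
  have "cos (2 * pi * real_of_int k * x) * cos (2 * pi * real_of_int j * x)
      = (cos (2 * pi * real_of_int (k - j) * x) + cos (2 * pi * real_of_int (k + j) * x)) / 2" for x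
    by (simp add: cos_times_cos left_diff_distrib right_diff_distrib distrib_left distrib_right)
  moreover have "integral {0..1} (\<lambda>x. (cos (2 * pi * real_of_int (k - j) * x) + cos (2 * pi * real_of_int (k + j) * x)) / 2)
      = (integral {0..1} (\<lambda>x. cos (2 * pi * real_of_int (k - j) * x)) +
         integral {0..1} (\<lambda>x. cos (2 * pi * real_of_int (k + j) * x))) / 2"
    by (subst Henstock_Kurzweil_Integration.integral_add[symmetric])
      (auto intro!: integrable_continuous_real continuous_intros)
  ultimately show ?thesis unfolding integral_cos_int by (simp only: eq_neg_iff_add_eq_0 right_minus_eq)
qed

text \<open>Only \<open>k = j\<close> and \<open>k = - j\<close> survive orthogonality, each with
  half the coefficient; for \<open>j = 0\<close> the two coincide and their halves add up.\<close>

lemma fourier_coeff_gaussian_series: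
  assumes "\<kappa> > 0"
  shows "integral {0..1} (\<lambda>x. gaussian_series \<kappa> x * cos (2 * pi * real_of_int j * x))
    = exp (- pi / \<kappa>\<^sup>2 * (real_of_int j)\<^sup>2)"
proof -
  let ?c = "\<lambda>k::int. exp (- pi / \<kappa>\<^sup>2 * (real_of_int k)\<^sup>2)"
  obtain I J where I: "\<And>Y. ((\<lambda>x. \<Sum>k\<in>Y. ?c k * cos (2 * pi * real_of_int k * x) * cos (2 * pi * real_of_int j * x)) has_integral I Y) {0..1}"
    and J: "((\<lambda>x. gaussian_series \<kappa> x * cos (2 * pi * real_of_int j * x)) has_integral J) {0..1}"
    and IJ: "(I \<longlongrightarrow> J) (finite_subsets_at_top UNIV)"
  proof (rule uniform_limit_integral[OF uniform_limit_gaussian_series[OF assms, of j]])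
    show "continuous_on {0..1} (\<lambda>x. \<Sum>k\<in>Y. ?c k * cos (2 * pi * real_of_int k * x) * cos (2 * pi * real_of_int j * x))" for Y
      by (intro continuous_intros)
  qed auto
  have IY: "I Y = ?c j" if Y: "finite Y" "{j, - j} \<subseteq> Y" for Y
  proof -
    have "I Y = integral {0..1} (\<lambda>x. \<Sum>k\<in>Y. ?c k * (cos (2 * pi * real_of_int k * x) * cos (2 * pi * real_of_int j * x)))"
      using I[of Y] by (simp add: integral_unique mult.assoc)
    also have "\<dots> = (\<Sum>k\<in>Y. integral {0..1} (\<lambda>x. ?c k * (cos (2 * pi * real_of_int k * x) * cos (2 * pi * real_of_int j * x))))"
      using Y by (intro integral_sum integrable_continuous_real continuous_intros)
    also have "\<dots> = (\<Sum>k\<in>Y. ?c k * (((if k = j then 1 else 0) + (if k = - j then 1 else 0)) / 2))"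
      by (intro sum.cong refl) (simp only: integral_mult_right integral_cos_cos_int)
    also have "\<dots> = (\<Sum>k\<in>Y. (if k = j then ?c j / 2 else 0) + (if k = - j then ?c j / 2 else 0))"
      by (intro sum.cong refl) auto
    also have "\<dots> = ?c j"
      using Y by (simp add: sum.distrib)
    finally show ?thesis .
  qed
  have "(I \<longlongrightarrow> ?c j) (finite_subsets_at_top UNIV)"
    by (rule tendsto_eventually, subst eventually_finite_subsets_at_top)
      (auto intro!: exI[of _ "{j, - j}"] simp: IY)
  then have "J = ?c j" using IJ by (intro tendsto_unique[OF _ IJ]) auto
  then show ?thesis using J by (simp add: integral_unique)
qed

text \<open>An even 1-periodic function is a function of \<open>cos (2 * pi * x)\<close>, which Weierstrass approximates by
  polynomials; polynomials in \<open>cos\<close> are trigonometric polynomials.\<close>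
lemma even_periodic_eq_0_if_cos_coeffs_0:
  fixes D :: "real \<Rightarrow> real"
  assumes cont: "continuous_on {0..1} D" and per: "\<And>x. D (x + 1) = D x" and even: "\<And>x. D (- x) = D x"
    and coeff: "\<And>k::int. integral {0..1} (\<lambda>x. D x * cos (2 * pi * real_of_int k * x)) = 0"
    and x: "x \<in> {0..1}"
  shows "D x = 0"
proof -
  let ?C = "\<lambda>x. cos (2 * pi * x)"
  \<comment> \<open>Product-to-sum formula: one factor \<open>?C x\<close> moves the frequency
    \<open>k\<close> to \<open>k - 1\<close> and \<open>k + 1\<close>, hence the induction over
    powers with \<open>k\<close> arbitrary.\<close>
  have pow: "integral {0..1} (\<lambda>x. D x * cos (2 * pi * real_of_int k * x) * ?C x ^ n) = 0" for n and k :: int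
  proof (induction n arbitrary: k)
    case (Suc n)
    have "D x * cos (2 * pi * real_of_int k * x) * ?C x ^ Suc n =
        (D x * cos (2 * pi * real_of_int (k - 1) * x) * ?C x ^ n + D x * cos (2 * pi * real_of_int (k + 1) * x) * ?C x ^ n) / 2" for x
    proof -
      have "cos (2 * pi * real_of_int k * x) * ?C x = (cos (2 * pi * real_of_int (k - 1) * x) + cos (2 * pi * real_of_int (k + 1) * x)) / 2"
        by (simp add: cos_times_cos left_diff_distrib right_diff_distrib distrib_left distrib_right)
      then have "D x * (cos (2 * pi * real_of_int k * x) * ?C x) * ?C x ^ n =
        D x * ((cos (2 * pi * real_of_int (k - 1) * x) + cos (2 * pi * real_of_int (k + 1) * x)) / 2) * ?C x ^ n" by simp
      then show ?thesis by (simp add: algebra_simps add_divide_distrib)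
    qed
    moreover have "integral {0..1} (\<lambda>x. (D x * cos (2 * pi * real_of_int (k - 1) * x) * ?C x ^ n + D x * cos (2 * pi * real_of_int (k + 1) * x) * ?C x ^ n) / 2)
       = (integral {0..1} (\<lambda>x. D x * cos (2 * pi * real_of_int (k - 1) * x) * ?C x ^ n) +
          integral {0..1} (\<lambda>x. D x * cos (2 * pi * real_of_int (k + 1) * x) * ?C x ^ n)) / 2"
      by (subst Henstock_Kurzweil_Integration.integral_add[symmetric])
        (auto intro!: integrable_continuous_real continuous_intros cont)
    ultimately show ?case by (simp only: Suc.IH) simp
  qed (use coeff in auto)
  \<comment> \<open>\<open>arccos\<close> inverts the cosine on the first half period; periodicity
    and evenness give \<open>D (1 - y) = D y\<close>, which covers the second.\<close>
  define h where "h u = D (arccos u / (2 * pi))" for u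
  have hD: "D y = h (?C y)" if y: "y \<in> {0..1}" for y
  proof (cases "y \<le> 1 / 2")
    case True
    then have "arccos (?C y) = 2 * pi * y" using y by (intro arccos_cos) auto
    then show ?thesis by (simp add: h_def)
  next
    case False
    have "cos (2 * pi * (1 - y)) = ?C y" by (simp add: algebra_simps cos_diff)
    moreover have "arccos (cos (2 * pi * (1 - y))) = 2 * pi * (1 - y)" using y False by (intro arccos_cos) auto
    ultimately have "h (?C y) = D (1 - y)" by (simp add: h_def)
    also have "\<dots> = D y" using per[of "- y"] even[of y] by simp
    finally show ?thesis by simp
  qed
  have "continuous_on {-1..1} h"
    unfolding h_def
  proof (rule continuous_on_compose2[OF cont])
    show "(\<lambda>u. arccos u / (2 * pi)) ` {-1..1} \<subseteq> {0..1}"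
      using arccos_bounded by (fastforce simp: field_simps)
  qed (auto intro!: continuous_intros)
  define A where "A = integral {0..1} (\<lambda>x. \<bar>D x\<bar>)"
  have "A \<ge> 0" unfolding A_def by (intro integral_nonneg integrable_continuous_real continuous_intros cont) auto
  \<comment> \<open>\<open>D\<close> is orthogonal to \<open>p (?C x)\<close>, so the integral of
    \<open>(D x)\<^sup>2\<close> equals that of \<open>D x * (h (?C x) - p (?C x))\<close>, whose
    second factor is below \<open>e\<close> in modulus.\<close>
  have small: "integral {0..1} (\<lambda>x. (D x)\<^sup>2) \<le> e * A" if "e > 0" for e
  proof -
    obtain p where p: "real_polynomial_function p" and pe: "\<And>u. u \<in> {-1..1} \<Longrightarrow> \<bar>h u - p u\<bar> < e"
      using Stone_Weierstrass_real_polynomial_function[OF compact_Icc \<open>continuous_on {-1..1} h\<close> \<open>e > 0\<close>] by metis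
    obtain a n where pa: "p = (\<lambda>x. \<Sum>i\<le>n. a i * x ^ i)"
      using p real_polynomial_function_iff_sum by metis
    have pc: "continuous_on {0..1} (\<lambda>x. p (?C x))" unfolding pa by (intro continuous_intros)
    have "integral {0..1} (\<lambda>x. D x * p (?C x)) = integral {0..1} (\<lambda>x. \<Sum>i\<le>n. a i * (D x * cos (2 * pi * real_of_int 0 * x) * ?C x ^ i))"
      by (simp add: pa sum_distrib_left mult_ac)
    also have "\<dots> = (\<Sum>i\<le>n. integral {0..1} (\<lambda>x. a i * (D x * cos (2 * pi * real_of_int 0 * x) * ?C x ^ i)))"
      by (intro integral_sum integrable_continuous_real continuous_intros cont) auto
    also have "\<dots> = 0" by (simp only: integral_mult_right pow) simp
    finally have 0: "integral {0..1} (\<lambda>x. D x * p (?C x)) = 0" .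
    have "integral {0..1} (\<lambda>x. (D x)\<^sup>2) = integral {0..1} (\<lambda>x. (D x)\<^sup>2) - integral {0..1} (\<lambda>x. D x * p (?C x))"
      using 0 by simp
    also have "\<dots> = integral {0..1} (\<lambda>x. (D x)\<^sup>2 - D x * p (?C x))"
      by (intro Henstock_Kurzweil_Integration.integral_diff[symmetric] integrable_continuous_real continuous_intros cont pc)
    also have "\<dots> \<le> integral {0..1} (\<lambda>x. e * \<bar>D x\<bar>)"
    proof (intro integral_le integrable_continuous_real continuous_intros cont pc)
      fix y :: real assume y: "y \<in> {0..1}"
      have "(D y)\<^sup>2 - D y * p (?C y) = D y * (h (?C y) - p (?C y))"
        using hD[OF y] by (simp add: power2_eq_square algebra_simps)
      also have "\<dots> \<le> \<bar>D y\<bar> * \<bar>h (?C y) - p (?C y)\<bar>" by (metis abs_ge_self abs_mult)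
      also have "\<dots> \<le> \<bar>D y\<bar> * e" using pe[of "?C y"] by (intro mult_left_mono) auto
      finally show "(D y)\<^sup>2 - D y * p (?C y) \<le> e * \<bar>D y\<bar>" by (simp add: mult.commute)
    qed
    finally show ?thesis by (simp add: A_def)
  qed
  have "integral {0..1} (\<lambda>x. (D x)\<^sup>2) \<le> 0"
  proof (rule field_le_epsilon)
    fix e :: real assume "e > 0"
    have "integral {0..1} (\<lambda>x. (D x)\<^sup>2) \<le> e / (A + 1) * A"
      using \<open>A \<ge> 0\<close> \<open>e > 0\<close> by (intro small) simp
    also have "\<dots> \<le> e" using \<open>A \<ge> 0\<close> \<open>e > 0\<close> by (simp add: field_simps)
    finally show "integral {0..1} (\<lambda>x. (D x)\<^sup>2) \<le> 0 + e" by simp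
  qed
  moreover have "integral {0..1} (\<lambda>x. (D x)\<^sup>2) \<ge> 0"
    by (intro integral_nonneg integrable_continuous_real continuous_intros cont) auto
  ultimately have "integral {0..1} (\<lambda>x. (D x)\<^sup>2) = 0" by simp
  then have "\<forall>x\<in>{0..1}. (D x)\<^sup>2 = 0"
    by (subst (asm) integral_eq_0_iff) (auto intro!: continuous_intros cont)
  then show ?thesis using x by simp
qed

lemma periodized_gaussian_shift: "periodized_gaussian \<kappa> (x + real_of_int m) = periodized_gaussian \<kappa> x"
  unfolding periodized_gaussian_def
  by (rule infsum_reindex_bij_witness[of _ "\<lambda>n. n - m" "\<lambda>n. n + m"]) (auto simp: algebra_simps)

lemma periodized_gaussian_even: "periodized_gaussian \<kappa> (- x) = periodized_gaussian \<kappa> x"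
  unfolding periodized_gaussian_def
  by (rule infsum_reindex_bij_witness[of _ uminus uminus]) (auto simp: power2_eq_square algebra_simps)

lemma gaussian_series_shift: "gaussian_series \<kappa> (x + real_of_int m) = gaussian_series \<kappa> x"
proof -
  have "cos (2 * pi * real_of_int k * (x + real_of_int m)) = cos (2 * pi * real_of_int k * x)" for k
  proof -
    have "cos (2 * pi * real_of_int k * (x + real_of_int m)) =
        cos (2 * pi * real_of_int k * x + 2 * pi * real_of_int (k * m))"
      by (simp add: algebra_simps)
    then show ?thesis by (simp add: cos_add del: of_int_mult)
  qed
  then show ?thesis by (simp add: gaussian_series_def)
qed

text \<open>Both sides are even, 1-periodic and have equal cosine coefficients; uniform convergence
  makes them continuous on [0, 1], so their difference vanishes there. The gain is positivity and
  decay: neither is visible in the cosine series that the filter computes.\<close>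

theorem poisson_summation_gaussian:
  assumes "\<kappa> > 0"
  shows "gaussian_series \<kappa> x = periodized_gaussian \<kappa> x"
proof -
  let ?D = "\<lambda>x. periodized_gaussian \<kappa> x - gaussian_series \<kappa> x"
  have cP: "continuous_on {0..1} (periodized_gaussian \<kappa>)"
    using uniform_limit_theorem[OF _ uniform_limit_periodized_gaussian[OF assms, of 0]]
    by (simp add: continuous_intros)
  have cG: "continuous_on {0..1} (gaussian_series \<kappa>)"
    using uniform_limit_theorem[OF _ uniform_limit_gaussian_series[OF assms, of 0]]
    by (simp add: continuous_intros)
  have "?D (frac x) = 0"
  proof (rule even_periodic_eq_0_if_cos_coeffs_0[where D = ?D])
    show "continuous_on {0..1} ?D" by (intro continuous_intros cP cG)
    fix y :: real
    show "?D (y + 1) = ?D y"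
      using periodized_gaussian_shift[of \<kappa> y 1] gaussian_series_shift[of \<kappa> y 1] by simp
    show "?D (- y) = ?D y"
      using periodized_gaussian_even[of \<kappa> y] by (simp add: gaussian_series_def)
  next
    fix k :: int
    have "integral {0..1} (\<lambda>x. ?D x * cos (2 * pi * real_of_int k * x)) =
      integral {0..1} (\<lambda>x. periodized_gaussian \<kappa> x * cos (2 * pi * real_of_int k * x)) -
      integral {0..1} (\<lambda>x. gaussian_series \<kappa> x * cos (2 * pi * real_of_int k * x))"
      by (subst Henstock_Kurzweil_Integration.integral_diff[symmetric])
        (auto intro!: integrable_continuous_real continuous_intros cP cG simp: left_diff_distrib)
    then show "integral {0..1} (\<lambda>x. ?D x * cos (2 * pi * real_of_int k * x)) = 0"
      by (simp add: fourier_coeff_periodized_gaussian[OF assms] fourier_coeff_gaussian_series[OF assms])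
  qed (use frac_lt_1[of x] in auto)
  then have "?D (frac x + real_of_int \<lfloor>x\<rfloor>) = 0"
    unfolding periodized_gaussian_shift gaussian_series_shift .
  then show ?thesis by (simp add: frac_def)
qed

section \<open>Gaussian filtering\<close>

lemma periodized_gaussian_ge:
  assumes "\<kappa> > 0"
  shows "periodized_gaussian \<kappa> x \<ge> 0" and "periodized_gaussian \<kappa> 0 \<ge> \<kappa>"
proof -
  show "periodized_gaussian \<kappa> x \<ge> 0"
    unfolding periodized_gaussian_def by (rule infsum_nonneg) (use assms in auto)
  have "(\<Sum>\<^sub>\<infinity>n\<in>{0::int}. \<kappa> * exp (- pi * \<kappa>\<^sup>2 * (0 + real_of_int n)\<^sup>2)) \<le> periodized_gaussian \<kappa> 0"
    unfolding periodized_gaussian_def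
    by (rule infsum_mono_neutral)
      (use assms periodized_gaussian_summable[OF assms, of 0] in auto)
  then show "periodized_gaussian \<kappa> 0 \<ge> \<kappa>" by simp
qed

text \<open>Rounding moves \<open>x\<close> to \<open>y\<close> in [-1/2, 1/2] by periodicity, and
  the central term gives the factor with \<open>r\<close>. For \<open>n \<ge> 1\<close>,
  \<open>(n - 1/2)\<^sup>2 = 1/4 + (n - 1)\<^sup>2 + (n - 1)\<close>, so each other term is at most
  \<open>exp (- pi * \<kappa>\<^sup>2 / 4)\<close> times the term of
  \<open>periodized_gaussian \<kappa> 0\<close> one step closer to 0. The factor 2 counts the two
  sides.\<close>

lemma periodized_gaussian_far:
  assumes \<kappa>: "\<kappa> > 0" and "r \<ge> 0" and far: "\<And>n::int. \<bar>x + real_of_int n\<bar> \<ge> r"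
  shows "periodized_gaussian \<kappa> x \<le> (exp (- pi * (\<kappa> * r)\<^sup>2) + 2 * exp (- pi * \<kappa>\<^sup>2 / 4)) * periodized_gaussian \<kappa> 0"
proof -
  define y where "y = x + real_of_int (- round x)"
  have y2: "\<bar>y\<bar> \<le> 1 / 2" using of_int_round_abs_le[of x] by (simp add: y_def abs_minus_commute)
  have yr: "\<bar>y\<bar> \<ge> r" unfolding y_def by (rule far)
  let ?P = "periodized_gaussian \<kappa> 0" and ?q = "exp (- pi * \<kappa>\<^sup>2 / 4)"
  let ?f = "\<lambda>n::int. \<kappa> * exp (- pi * \<kappa>\<^sup>2 * (y + real_of_int n)\<^sup>2)"
  let ?g = "\<lambda>n::int. \<kappa> * exp (- pi * \<kappa>\<^sup>2 * (0 + real_of_int n)\<^sup>2)"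
  have fs: "?f summable_on A" for A
    by (rule summable_on_subset_banach[OF periodized_gaussian_summable[OF \<kappa>]]) auto
  have gs: "?g summable_on A" for A
    by (rule summable_on_subset_banach[OF periodized_gaussian_summable[OF \<kappa>]]) auto
  have step: "(\<Sum>\<^sub>\<infinity>n\<in>A. ?f n) \<le> ?q * ?P"
    if bound: "\<And>n. n \<in> A \<Longrightarrow> (y + real_of_int n)\<^sup>2 \<ge> 1 / 4 + (real_of_int (n + e))\<^sup>2" for A :: "int set" and e
  proof -
    have "(\<Sum>\<^sub>\<infinity>n\<in>A. ?f n) \<le> (\<Sum>\<^sub>\<infinity>n\<in>A. ?q * ?g (n + e))"
    proof (rule infsum_mono)
      show "(\<lambda>n. ?q * ?g (n + e)) summable_on A"
      proof (rule summable_on_cmult_right)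
        have "inj_on (\<lambda>n. n + e) A" by (simp add: inj_on_def)
        from gs[of "(\<lambda>n. n + e) ` A", unfolded summable_on_reindex[OF this]]
        show "(\<lambda>n. ?g (n + e)) summable_on A" by (simp only: o_def)
      qed
      fix n assume "n \<in> A"
      then have "pi * \<kappa>\<^sup>2 * (1 / 4 + (real_of_int (n + e))\<^sup>2) \<le> pi * \<kappa>\<^sup>2 * (y + real_of_int n)\<^sup>2"
        by (intro mult_left_mono bound) auto
      then have "exp (- pi * \<kappa>\<^sup>2 * (y + real_of_int n)\<^sup>2) \<le> exp (- pi * \<kappa>\<^sup>2 / 4 + - pi * \<kappa>\<^sup>2 * (0 + real_of_int (n + e))\<^sup>2)"
        by (simp add: distrib_left)
      then show "?f n \<le> ?q * ?g (n + e)" using \<kappa> unfolding exp_add by simp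
    qed (rule fs)
    also have "\<dots> = ?q * (\<Sum>\<^sub>\<infinity>n\<in>A. ?g (n + e))" by (rule infsum_cmult_right')
    also have "(\<Sum>\<^sub>\<infinity>n\<in>A. ?g (n + e)) = (\<Sum>\<^sub>\<infinity>n\<in>(\<lambda>n. n + e) ` A. ?g n)"
      by (subst infsum_reindex) (auto simp: o_def inj_on_def)
    also have "\<dots> \<le> (\<Sum>\<^sub>\<infinity>n. ?g n)"
      by (rule infsum_mono_neutral) (use \<kappa> gs in auto)
    finally show ?thesis by (simp add: periodized_gaussian_def)
  qed
  have yn: "(\<bar>real_of_int n\<bar> - 1 / 2)\<^sup>2 \<le> (y + real_of_int n)\<^sup>2" if "n \<noteq> 0" for n
  proof -
    have "\<bar>real_of_int n\<bar> \<ge> 1" using that by linarith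
    then have "\<bar>real_of_int n\<bar> - 1 / 2 \<le> \<bar>y + real_of_int n\<bar>" "0 \<le> \<bar>real_of_int n\<bar> - 1 / 2"
      using y2 by linarith+
    from power_mono[OF this, of 2] show ?thesis by simp
  qed
  have "(\<Sum>\<^sub>\<infinity>n\<in>{1..}. ?f n) \<le> ?q * ?P"
  proof (rule step[of _ "-1"])
    fix n :: int assume n: "n \<in> {1..}"
    have "(\<bar>real_of_int n\<bar> - 1 / 2)\<^sup>2 = 1 / 4 + (real_of_int (n + -1))\<^sup>2 + (real_of_int n - 1)"
      using n by (simp add: power2_eq_square algebra_simps)
    then show "1 / 4 + (real_of_int (n + -1))\<^sup>2 \<le> (y + real_of_int n)\<^sup>2"
      using yn[of n] n by auto
  qed
  moreover have "(\<Sum>\<^sub>\<infinity>n\<in>{..-1}. ?f n) \<le> ?q * ?P"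
  proof (rule step[of _ "1"])
    fix n :: int assume n: "n \<in> {..-1}"
    have "(\<bar>real_of_int n\<bar> - 1 / 2)\<^sup>2 = 1 / 4 + (real_of_int (n + 1))\<^sup>2 + (- real_of_int n - 1)"
      using n by (simp add: power2_eq_square algebra_simps)
    moreover have "real_of_int n \<le> -1" using n by simp
    ultimately show "1 / 4 + (real_of_int (n + 1))\<^sup>2 \<le> (y + real_of_int n)\<^sup>2"
      using yn[of n] n by auto
  qed
  moreover have "(\<Sum>\<^sub>\<infinity>n\<in>{0::int}. ?f n) \<le> exp (- pi * (\<kappa> * r)\<^sup>2) * ?P"
  proof -
    have "r\<^sup>2 \<le> y\<^sup>2" using power_mono[OF yr \<open>r \<ge> 0\<close>, of 2] by simp
    then have "pi * \<kappa>\<^sup>2 * r\<^sup>2 \<le> pi * \<kappa>\<^sup>2 * y\<^sup>2" by (intro mult_left_mono) auto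
    then have "exp (- pi * \<kappa>\<^sup>2 * y\<^sup>2) \<le> exp (- pi * (\<kappa> * r)\<^sup>2)" by (simp add: power_mult_distrib mult_ac)
    then have "exp (- pi * \<kappa>\<^sup>2 * y\<^sup>2) * \<kappa> \<le> exp (- pi * (\<kappa> * r)\<^sup>2) * ?P"
      using periodized_gaussian_ge[OF \<kappa>] \<kappa> by (intro mult_mono) auto
    then show ?thesis by (simp add: mult.commute)
  qed
  moreover have "periodized_gaussian \<kappa> y = (\<Sum>\<^sub>\<infinity>n\<in>{0::int}. ?f n) + (\<Sum>\<^sub>\<infinity>n\<in>{1..}. ?f n) + (\<Sum>\<^sub>\<infinity>n\<in>{..-1}. ?f n)"
  proof -
    have "(UNIV :: int set) = ({0} \<union> {1..}) \<union> {..-1}" by auto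
    then have "periodized_gaussian \<kappa> y = (\<Sum>\<^sub>\<infinity>n\<in>({0} \<union> {1..}) \<union> {..-1}. ?f n)"
      by (simp only: periodized_gaussian_def)
    also have "\<dots> = (\<Sum>\<^sub>\<infinity>n\<in>{0} \<union> {1..}. ?f n) + (\<Sum>\<^sub>\<infinity>n\<in>{..-1}. ?f n)"
      by (rule infsum_Un_disjoint[OF fs fs]) auto
    also have "(\<Sum>\<^sub>\<infinity>n\<in>{0} \<union> {1..}. ?f n) = (\<Sum>\<^sub>\<infinity>n\<in>{0::int}. ?f n) + (\<Sum>\<^sub>\<infinity>n\<in>{1..}. ?f n)"
      by (rule infsum_Un_disjoint[OF fs fs]) auto
    finally show ?thesis .
  qed
  moreover have "periodized_gaussian \<kappa> y = periodized_gaussian \<kappa> x"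
    unfolding y_def by (rule periodized_gaussian_shift)
  ultimately show ?thesis by (simp add: algebra_simps)
qed

section \<open>The truncated filter kernel and the filtered signal\<close>

lemma phihat_pos: "phihat \<sigma> K k > 0"
  by (simp add: phihat_def)

lemma phihat_minus: "phihat \<sigma> K (- k) = phihat \<sigma> K k"
  by (simp add: phihat_def power2_eq_square)

text \<open>The response of the filter to a single phase at distance \<open>u\<close>; it is real
  because the weights are even in \<open>k\<close>.\<close>

definition trunc_series :: "real \<Rightarrow> nat \<Rightarrow> real \<Rightarrow> real" where
  "trunc_series \<sigma> K u = (\<Sum>k\<in>{- int K..int K}. phihat \<sigma> K k * cos (2 * pi * real_of_int k * u))"

context
  fixes \<sigma> :: real and K :: nat
  assumes \<sigma>: "\<sigma> > 0" and K: "K > 0"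
begin

lemma phihat_eq: "phihat \<sigma> K k = exp (- pi / (real K / \<sigma>)\<^sup>2 * (real_of_int k)\<^sup>2)"
  using \<sigma> K by (simp add: phihat_def power_divide power_mult_distrib field_simps)

lemma phihat_summable: "phihat \<sigma> K summable_on A"
proof (rule summable_on_subset_banach)
  have "(\<lambda>k. exp (- (pi / (real K / \<sigma>)\<^sup>2) * (real_of_int k)\<^sup>2)) summable_on UNIV"
    by (rule gaussian_int_summable) (use \<sigma> K in simp)
  then show "phihat \<sigma> K summable_on UNIV" by (simp add: phihat_eq[abs_def])
qed auto

lemma phis_eq: "phis \<sigma> K = gaussian_series (real K / \<sigma>) 0"
  by (simp add: phis_def gaussian_series_def phihat_eq)

lemma phis_ge_sum:
  assumes "finite A"
  shows "(\<Sum>k\<in>A. phihat \<sigma> K k) \<le> phis \<sigma> K"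
proof -
  have "(\<Sum>\<^sub>\<infinity>k\<in>A. phihat \<sigma> K k) \<le> phis \<sigma> K"
    unfolding phis_def by (rule infsum_mono_neutral) (use phihat_summable phihat_pos in \<open>auto intro: less_imp_le\<close>)
  then show ?thesis using assms by simp
qed

lemma phis_pos: "phis \<sigma> K > 0"
  using phis_ge_sum[of "{0}"] phihat_pos[of \<sigma> K 0] by simp

text \<open>Since \<open>(K + j)\<^sup>2 \<ge> K\<^sup>2 + j\<^sup>2\<close>, shifting the tail back by \<open>K\<close> gains the factor \<open>exp (- pi * \<sigma>\<^sup>2)\<close>.\<close>
lemma phihat_tail: "(\<Sum>\<^sub>\<infinity>k\<in>- {- int K..int K}. phihat \<sigma> K k) \<le> exp (- pi * \<sigma>\<^sup>2) * phis \<sigma> K"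
proof -
  \<comment> \<open>\<open>?h\<close> moves each nonzero integer away from 0 by \<open>K\<close>, a
    bijection onto the integers beyond \<open>K\<close> in modulus.\<close>
  let ?h = "\<lambda>j::int. j + sgn j * int K"
  have inj: "inj_on ?h (- {0})"
    by (rule inj_onI) (auto simp: sgn_if split: if_splits)
  have img: "- {- int K..int K} = ?h ` (- {0})"
  proof (intro equalityI subsetI)
    fix k assume k: "k \<in> - {- int K..int K}"
    show "k \<in> ?h ` (- {0})"
      by (rule image_eqI[of _ _ "k - sgn k * int K"]) (use k in \<open>auto simp: sgn_if split: if_splits\<close>)
  qed (auto simp: sgn_if split: if_splits)
  have "(\<Sum>\<^sub>\<infinity>k\<in>- {- int K..int K}. phihat \<sigma> K k) = (\<Sum>\<^sub>\<infinity>j\<in>- {0}. phihat \<sigma> K (?h j))"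
    unfolding img by (subst infsum_reindex[OF inj]) (simp add: o_def)
  also have "\<dots> \<le> (\<Sum>\<^sub>\<infinity>j\<in>- {0::int}. exp (- pi * \<sigma>\<^sup>2) * phihat \<sigma> K j)"
  proof (rule infsum_mono)
    show "(\<lambda>j. phihat \<sigma> K (?h j)) summable_on - {0}"
      using phihat_summable[of "?h ` (- {0})"] by (subst (asm) summable_on_reindex[OF inj]) (simp add: o_def)
    show "(\<lambda>j. exp (- pi * \<sigma>\<^sup>2) * phihat \<sigma> K j) summable_on - {0}"
      by (intro summable_on_cmult_right phihat_summable)
    fix j :: int assume "j \<in> - {0}"
    have "(real_of_int (?h j))\<^sup>2 \<ge> (real K)\<^sup>2 + (real_of_int j)\<^sup>2"
    proof -
      have "(?h j)\<^sup>2 = (int K)\<^sup>2 + j\<^sup>2 + 2 * int K * \<bar>j\<bar>"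
        using \<open>j \<in> - {0}\<close> by (auto simp: sgn_if power2_eq_square algebra_simps)
      then have "(int K)\<^sup>2 + j\<^sup>2 \<le> (?h j)\<^sup>2" by simp
      then have "real_of_int ((int K)\<^sup>2 + j\<^sup>2) \<le> real_of_int ((?h j)\<^sup>2)" by (rule of_int_le_iff[THEN iffD2])
      then show ?thesis by simp
    qed
    then have "pi * (\<sigma> / real K)\<^sup>2 * ((real K)\<^sup>2 + (real_of_int j)\<^sup>2) \<le> pi * (\<sigma> / real K)\<^sup>2 * (real_of_int (?h j))\<^sup>2"
      by (intro mult_left_mono) auto
    moreover have "pi * (\<sigma> / real K)\<^sup>2 * ((real K)\<^sup>2 + (real_of_int j)\<^sup>2) = pi * \<sigma>\<^sup>2 + pi * (real_of_int j * \<sigma> / real K)\<^sup>2"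
      using K by (simp add: field_simps power_divide power_mult_distrib)
    moreover have "pi * (\<sigma> / real K)\<^sup>2 * (real_of_int (?h j))\<^sup>2 = pi * (real_of_int (?h j) * \<sigma> / real K)\<^sup>2"
      by (simp add: power_divide power_mult_distrib)
    ultimately have "pi * \<sigma>\<^sup>2 + pi * (real_of_int j * \<sigma> / real K)\<^sup>2 \<le> pi * (real_of_int (?h j) * \<sigma> / real K)\<^sup>2"
      by (simp only:)
    then have "exp (- pi * (real_of_int (?h j) * \<sigma> / real K)\<^sup>2) \<le> exp (- pi * \<sigma>\<^sup>2 + - pi * (real_of_int j * \<sigma> / real K)\<^sup>2)"
      by simp
    then show "phihat \<sigma> K (?h j) \<le> exp (- pi * \<sigma>\<^sup>2) * phihat \<sigma> K j"
      unfolding phihat_def exp_add .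
  qed
  also have "\<dots> = exp (- pi * \<sigma>\<^sup>2) * (\<Sum>\<^sub>\<infinity>j\<in>- {0::int}. phihat \<sigma> K j)"
    by (rule infsum_cmult_right')
  also have "\<dots> \<le> exp (- pi * \<sigma>\<^sup>2) * phis \<sigma> K"
    unfolding phis_def
    by (intro mult_left_mono infsum_mono_neutral) (use phihat_summable phihat_pos in \<open>auto intro: less_imp_le\<close>)
  finally show ?thesis .
qed

lemma trunc_series_approx:
  "\<bar>trunc_series \<sigma> K u - gaussian_series (real K / \<sigma>) u\<bar> \<le> exp (- pi * \<sigma>\<^sup>2) * phis \<sigma> K"
proof -
  let ?f = "\<lambda>k. phihat \<sigma> K k * cos (2 * pi * real_of_int k * u)"
  have fn: "norm (?f k) \<le> phihat \<sigma> K k" for k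
  proof -
    have "norm (?f k) \<le> \<bar>phihat \<sigma> K k\<bar> * 1" unfolding real_norm_def abs_mult by (intro mult_left_mono) auto
    then show ?thesis using phihat_pos[of \<sigma> K k] by simp
  qed
  have fa: "(\<lambda>k. norm (?f k)) summable_on A" for A
    by (rule summable_on_comparison_test[OF phihat_summable]) (use fn in auto)
  then have fs: "?f summable_on A" for A by (rule abs_summable_summable)
  have "gaussian_series (real K / \<sigma>) u = (\<Sum>\<^sub>\<infinity>k. ?f k)"
    by (simp add: gaussian_series_def phihat_eq)
  also have "\<dots> = (\<Sum>\<^sub>\<infinity>k\<in>{- int K..int K} \<union> - {- int K..int K}. ?f k)" by (simp only: Compl_partition)
  also have "\<dots> = (\<Sum>\<^sub>\<infinity>k\<in>{- int K..int K}. ?f k) + (\<Sum>\<^sub>\<infinity>k\<in>- {- int K..int K}. ?f k)"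
    by (rule infsum_Un_disjoint[OF fs fs]) auto
  finally have "\<bar>trunc_series \<sigma> K u - gaussian_series (real K / \<sigma>) u\<bar> = norm (\<Sum>\<^sub>\<infinity>k\<in>- {- int K..int K}. ?f k)"
    by (simp add: trunc_series_def)
  also have "\<dots> \<le> (\<Sum>\<^sub>\<infinity>k\<in>- {- int K..int K}. norm (?f k))" by (rule norm_infsum_bound[OF fa])
  also have "\<dots> \<le> (\<Sum>\<^sub>\<infinity>k\<in>- {- int K..int K}. phihat \<sigma> K k)"
    by (rule infsum_mono[OF fa phihat_summable fn])
  also note phihat_tail
  finally show ?thesis .
qed

lemma trunc_series_complex:
  "(\<Sum>k\<in>{- int K..int K}. complex_of_real (phihat \<sigma> K k) * exp (2 * pi * \<i> * of_int k * complex_of_real u))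
    = complex_of_real (trunc_series \<sigma> K u)"
proof -
  let ?s = "\<lambda>k. phihat \<sigma> K k * sin (2 * pi * real_of_int k * u)"
  have "(\<Sum>k\<in>{- int K..int K}. ?s k) = (\<Sum>k\<in>{- int K..int K}. ?s (- k))"
    by (rule sum.reindex_bij_witness[of _ uminus uminus]) auto
  also have "\<dots> = - (\<Sum>k\<in>{- int K..int K}. ?s k)"
    by (simp add: phihat_minus sum_negf)
  finally have 0: "(\<Sum>k\<in>{- int K..int K}. ?s k) = 0" by simp
  have "complex_of_real (phihat \<sigma> K k) * exp (2 * pi * \<i> * of_int k * complex_of_real u)
      = Complex (phihat \<sigma> K k * cos (2 * pi * real_of_int k * u)) (?s k)" for k
  proof -
    have "exp (2 * pi * \<i> * of_int k * complex_of_real u) = cis (2 * pi * real_of_int k * u)"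
      by (simp add: cis_conv_exp mult_ac)
    then show ?thesis by (simp add: complex_eq_iff)
  qed
  then have "(\<Sum>k\<in>{- int K..int K}. complex_of_real (phihat \<sigma> K k) * exp (2 * pi * \<i> * of_int k * complex_of_real u))
      = (\<Sum>k\<in>{- int K..int K}. Complex (phihat \<sigma> K k * cos (2 * pi * real_of_int k * u)) (?s k))"
    by (rule sum.cong[OF refl])
  then show ?thesis
    using 0 by (simp only: complex_eq_iff) (simp add: trunc_series_def)
qed

text \<open>The filter is linear in the data, so exact data return the weighted sum of kernels
  shifted to the phases. Real weights make the exact signal conjugate-symmetric, which matches
  \<open>yext\<close>, so errors at negative \<open>k\<close> are controlled too; the error at
  \<open>k\<close> costs at most \<open>\<alpha> * phihat \<sigma> K k\<close>.\<close>

lemma filt_approx: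
  assumes fin: "finite I" and p: "\<And>i. i \<in> I \<Longrightarrow> p i \<ge> 0"
    and y: "\<And>k. k \<le> K \<Longrightarrow> cmod (ys ! k - (\<Sum>i\<in>I. complex_of_real (p i) * exp (- 2 * pi * \<i> * complex_of_real (\<theta> i) * of_nat k))) \<le> \<alpha>"
  shows "cmod (filt \<sigma> K ys x - complex_of_real (\<Sum>i\<in>I. p i * trunc_series \<sigma> K (x - \<theta> i))) \<le> \<alpha> * phis \<sigma> K"
proof -
  let ?g = "\<lambda>k::int. \<Sum>i\<in>I. complex_of_real (p i) * exp (- 2 * pi * \<i> * complex_of_real (\<theta> i) * of_int k)"
  let ?e = "\<lambda>k::int. exp (2 * pi * \<i> * of_int k * complex_of_real x)"
  have \<alpha>: "\<alpha> \<ge> 0" using y[of 0] norm_ge_zero order_trans by blast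
  have yg: "cmod (yext ys k - ?g k) \<le> \<alpha>" if k: "k \<in> {- int K..int K}" for k
  proof (cases "k \<ge> 0")
    case True
    then show ?thesis using y[of "nat k"] k by (simp add: yext_def)
  next
    case False
    have "?g k = cnj (?g (- k))" by (simp add: exp_cnj)
    then have "yext ys k - ?g k = cnj (ys ! nat (- k) - ?g (- k))" using False by (simp add: yext_def)
    then have "cmod (yext ys k - ?g k) = cmod (ys ! nat (- k) - ?g (- k))" by (simp only: complex_mod_cnj)
    then show ?thesis using y[of "nat (- k)"] k False by simp
  qed
  have sum_g: "(\<Sum>k\<in>{- int K..int K}. ?g k * complex_of_real (phihat \<sigma> K k) * ?e k)
      = complex_of_real (\<Sum>i\<in>I. p i * trunc_series \<sigma> K (x - \<theta> i))"
  proof -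
    have "(\<Sum>k\<in>{- int K..int K}. ?g k * complex_of_real (phihat \<sigma> K k) * ?e k)
      = (\<Sum>k\<in>{- int K..int K}. \<Sum>i\<in>I. complex_of_real (p i) * (complex_of_real (phihat \<sigma> K k) * exp (2 * pi * \<i> * of_int k * complex_of_real (x - \<theta> i))))"
    proof (intro sum.cong refl)
      fix k
      have E: "exp (- 2 * pi * \<i> * complex_of_real (\<theta> i) * of_int k) * ?e k = exp (2 * pi * \<i> * of_int k * complex_of_real (x - \<theta> i))" for i
        by (simp add: exp_add[symmetric] algebra_simps)
      have "complex_of_real (p i) * exp (- 2 * pi * \<i> * complex_of_real (\<theta> i) * of_int k) * complex_of_real (phihat \<sigma> K k) * ?e k
          = complex_of_real (p i) * (complex_of_real (phihat \<sigma> K k) * exp (2 * pi * \<i> * of_int k * complex_of_real (x - \<theta> i)))" for i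
        unfolding E[symmetric] by (simp only: mult_ac)
      then show "?g k * complex_of_real (phihat \<sigma> K k) * ?e k = (\<Sum>i\<in>I. complex_of_real (p i) * (complex_of_real (phihat \<sigma> K k) * exp (2 * pi * \<i> * of_int k * complex_of_real (x - \<theta> i))))"
        unfolding sum_distrib_right by (intro sum.cong refl)
    qed
    also have "\<dots> = (\<Sum>i\<in>I. complex_of_real (p i) * (\<Sum>k\<in>{- int K..int K}. complex_of_real (phihat \<sigma> K k) * exp (2 * pi * \<i> * of_int k * complex_of_real (x - \<theta> i))))"
      by (subst sum.swap) (simp add: sum_distrib_left)
    also have "\<dots> = complex_of_real (\<Sum>i\<in>I. p i * trunc_series \<sigma> K (x - \<theta> i))"
      unfolding trunc_series_complex by simp
    finally show ?thesis .
  qed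
  have "cmod (filt \<sigma> K ys x - complex_of_real (\<Sum>i\<in>I. p i * trunc_series \<sigma> K (x - \<theta> i)))
     = cmod (\<Sum>k\<in>{- int K..int K}. (yext ys k - ?g k) * complex_of_real (phihat \<sigma> K k) * ?e k)"
    unfolding sum_g[symmetric] filt_def by (simp add: sum_subtractf left_diff_distrib)
  also have "\<dots> \<le> (\<Sum>k\<in>{- int K..int K}. \<alpha> * phihat \<sigma> K k)"
  proof (rule sum_norm_le)
    fix k assume k: "k \<in> {- int K..int K}"
    have "cmod (?e k) = 1" by simp
    then show "cmod ((yext ys k - ?g k) * complex_of_real (phihat \<sigma> K k) * ?e k) \<le> \<alpha> * phihat \<sigma> K k"
      unfolding norm_mult using yg[OF k] phihat_pos[of \<sigma> K k] by (simp add: mult_right_mono)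
  qed
  also have "\<dots> \<le> \<alpha> * phis \<sigma> K"
    unfolding sum_distrib_left[symmetric] using \<alpha> by (intro mult_left_mono phis_ge_sum) auto
  finally show ?thesis .
qed

end

text \<open>In units of \<open>P = phis \<sigma> K\<close> and with
  \<open>\<delta> = \<beta> - \<omega>\<close>, the threshold is \<omega> + 6\<delta>/11. At an
  eigenphase the filter exceeds \<beta> minus truncation \<delta>/12 minus noise \<delta>/3, that is
  \<omega> + 7\<delta>/12. Far from all of them it is at most \<omega> plus \<delta>/12 for the
  nearest Gaussian, \<delta>/22 for its other images, \<delta>/12 for truncation and \<delta>/3 for
  noise, which add up exactly to the threshold. The weights sum to at most 1, so kernel errors are
  not multiplied by the number of phases.\<close>

lemma Xset_near_eigenphases:
  fixes \<beta> \<omega> \<alpha> :: real and A :: "'i set" and B :: "'j set"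
  assumes \<beta>: "\<beta> \<le> 1" and \<omega>: "0 \<le> \<omega>" "\<omega> < \<beta>" and \<alpha>: "\<alpha> < (\<beta> - \<omega>) / 3"
    and K: "real K \<ge> 24 * tau_of \<beta> \<omega>"
    and fin: "finite A" "finite B"
    and p: "\<And>i. i \<in> A \<Longrightarrow> p i \<ge> \<beta>" and q: "\<And>j. j \<in> B \<Longrightarrow> q j \<ge> 0"
    and q\<omega>: "(\<Sum>j\<in>B. q j) \<le> \<omega>" and pq: "(\<Sum>i\<in>A. p i) + (\<Sum>j\<in>B. q j) \<le> 1"
    and y: "\<And>k. k \<le> K \<Longrightarrow> cmod (ys ! k -
        ((\<Sum>i\<in>A. complex_of_real (p i) * exp (- 2 * pi * \<i> * complex_of_real (\<theta> i) * of_nat k)) +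
         (\<Sum>j\<in>B. complex_of_real (q j) * exp (- 2 * pi * \<i> * complex_of_real (\<xi> j) * of_nat k)))) \<le> \<alpha>"
  shows eigenphase_in_Xset: "\<And>i n. i \<in> A \<Longrightarrow> \<theta> i + real_of_int n \<in> Xset \<beta> \<omega> K ys"
    and Xset_near_eigenphase: "\<And>x. x \<in> Xset \<beta> \<omega> K ys \<Longrightarrow>
      \<exists>i\<in>A. \<exists>n::int. \<bar>x - (\<theta> i + real_of_int n)\<bar> < tau_of \<beta> \<omega> / real K"
proof -
  define \<tau> where "\<tau> = tau_of \<beta> \<omega>"
  define \<sigma> where "\<sigma> = sqrt \<tau>"
  define \<delta> where "\<delta> = \<beta> - \<omega>"
  define \<kappa> where "\<kappa> = real K / \<sigma>"
  have \<delta>: "0 < \<delta>" "\<delta> \<le> 1" using \<omega> \<beta> by (auto simp: \<delta>_def)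
  have \<tau>: "\<tau> > 0" unfolding \<tau>_def tau_of_def using \<delta> by (auto simp: \<delta>_def)
  have e: "exp (- pi * \<tau>) = \<delta> / 12"
  proof -
    have "- pi * \<tau> = - ln (12 / \<delta>)" by (simp add: \<tau>_def tau_of_def \<delta>_def)
    then show ?thesis using \<delta> by (simp add: exp_minus)
  qed
  have K24: "real K \<ge> 24 * \<tau>" using K by (simp add: \<tau>_def)
  have \<sigma>: "\<sigma> > 0" "\<sigma>\<^sup>2 = \<tau>" using \<tau> by (auto simp: \<sigma>_def)
  have K0: "K > 0" using K24 \<tau> by (metis mult_pos_pos not_gr_zero of_nat_0 not_less zero_less_numeral)
  have \<kappa>: "\<kappa> > 0" using \<sigma> K0 by (simp add: \<kappa>_def)
  define P where "P = phis \<sigma> K"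
  have P: "P > 0" unfolding P_def by (rule phis_pos[OF \<sigma>(1) K0])
  define T where "T = trunc_series \<sigma> K"
  define w where "w z = (case z of Inl i \<Rightarrow> p i | Inr j \<Rightarrow> q j)" for z :: "'i + 'j"
  define \<zeta> where "\<zeta> z = (case z of Inl i \<Rightarrow> \<theta> i | Inr j \<Rightarrow> \<xi> j)" for z :: "'i + 'j"
  have w0: "w z \<ge> 0" if "z \<in> A <+> B" for z
    using that p q \<omega> by (fastforce simp: w_def)
  have approx: "cmod (filt \<sigma> K ys x - complex_of_real (\<Sum>z\<in>A <+> B. w z * T (x - \<zeta> z))) \<le> \<alpha> * P" for x
    unfolding P_def T_def
  proof (rule filt_approx[OF \<sigma>(1) K0])
    fix k :: nat assume "k \<le> K"
    then show "cmod (ys ! k - (\<Sum>z\<in>A <+> B. complex_of_real (w z) * exp (- 2 * pi * \<i> * complex_of_real (\<zeta> z) * of_nat k))) \<le> \<alpha>"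
      using y by (simp add: sum.Plus[OF fin] w_def \<zeta>_def)
  qed (use fin w0 in auto)
  have Tg: "\<bar>T u - gaussian_series \<kappa> u\<bar> \<le> \<delta> / 12 * P" for u
    using trunc_series_approx[OF \<sigma>(1) K0, of u] unfolding \<sigma>(2) e T_def \<kappa>_def P_def .
  have g0: "gaussian_series \<kappa> u \<ge> 0" for u
    unfolding poisson_summation_gaussian[OF \<kappa>] by (rule periodized_gaussian_ge[OF \<kappa>])
  have gP: "P = gaussian_series \<kappa> 0" unfolding P_def \<kappa>_def by (rule phis_eq[OF \<sigma>(1) K0])
  have Tlow: "T u \<ge> - (\<delta> / 12 * P)" for u using Tg[of u] g0[of u] by linarith
  have Tup: "T u \<le> P" for u
  proof -
    have "T u \<le> (\<Sum>k\<in>{- int K..int K}. phihat \<sigma> K k)"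
      unfolding T_def trunc_series_def
      by (intro sum_mono mult_left_le) (use phihat_pos in \<open>auto intro: less_imp_le\<close>)
    also have "\<dots> \<le> P" unfolding P_def by (rule phis_ge_sum[OF \<sigma>(1) K0]) simp
    finally show ?thesis .
  qed
  have thr: "(6 * \<beta> + 5 * \<omega>) / 11 = \<omega> + 6 / 11 * \<delta>" by (simp add: \<delta>_def field_simps)
  have X: "x \<in> Xset \<beta> \<omega> K ys \<longleftrightarrow> cmod (filt \<sigma> K ys x) > (\<omega> + 6 / 11 * \<delta>) * P" for x
    unfolding Xset_def Let_def thr \<tau>_def[symmetric] \<sigma>_def[symmetric] P_def by simp
  have W1: "(\<Sum>z\<in>A <+> B. w z) \<le> 1" using pq by (simp add: sum.Plus[OF fin] w_def)
  have \<alpha>P: "\<alpha> * P < \<delta> / 3 * P" using \<alpha> P by (simp add: \<delta>_def)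
  show "\<theta> i + real_of_int n \<in> Xset \<beta> \<omega> K ys" if i: "i \<in> A" for i n
  proof -
    let ?x = "\<theta> i + real_of_int n"
    \<comment> \<open>Raising the kernel by \<open>\<delta> / 12 * P\<close> makes all its values
      nonnegative, so the sum dominates its single term for phase \<open>i\<close>; as the total
      weight is at most 1, the correction costs \<open>\<delta> / 12 * P\<close> only once.\<close>
    have "(\<Sum>z\<in>A <+> B. w z * T (?x - \<zeta> z)) \<ge> (\<beta> - \<delta> / 12) * P"
    proof -
      have "T (real_of_int n) \<ge> P - \<delta> / 12 * P"
        using Tg[of "real_of_int n"] gaussian_series_shift[of \<kappa> 0 n] unfolding gP by (simp only: add_0)
      then have "p i * (T (real_of_int n) + \<delta> / 12 * P) \<ge> \<beta> * P"
        using p[OF i] \<omega> P by (intro mult_mono) auto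
      also have "p i * (T (real_of_int n) + \<delta> / 12 * P) = w (Inl i) * (T (?x - \<zeta> (Inl i)) + \<delta> / 12 * P)"
        by (simp add: w_def \<zeta>_def)
      also have "\<dots> \<le> (\<Sum>z\<in>A <+> B. w z * (T (?x - \<zeta> z) + \<delta> / 12 * P))"
      proof (rule member_le_sum)
        fix z assume "z \<in> (A <+> B) - {Inl i}"
        then show "0 \<le> w z * (T (?x - \<zeta> z) + \<delta> / 12 * P)"
          using w0[of z] Tlow[of "?x - \<zeta> z"] by (intro mult_nonneg_nonneg) auto
      qed (use i fin in auto)
      also have "\<dots> = (\<Sum>z\<in>A <+> B. w z * T (?x - \<zeta> z)) + (\<Sum>z\<in>A <+> B. w z) * (\<delta> / 12 * P)"
        by (simp add: distrib_left sum.distrib sum_distrib_right)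
      also have "\<dots> \<le> (\<Sum>z\<in>A <+> B. w z * T (?x - \<zeta> z)) + 1 * (\<delta> / 12 * P)"
        using W1 \<delta> P by (intro add_left_mono mult_right_mono) auto
      finally show ?thesis by (simp add: algebra_simps)
    qed
    moreover have "cmod (filt \<sigma> K ys ?x) \<ge> (\<Sum>z\<in>A <+> B. w z * T (?x - \<zeta> z)) - \<alpha> * P"
    proof -
      have "cmod (complex_of_real (\<Sum>z\<in>A <+> B. w z * T (?x - \<zeta> z))) - cmod (filt \<sigma> K ys ?x) \<le> \<alpha> * P"
        using order_trans[OF norm_triangle_ineq2 approx[of ?x, unfolded norm_minus_commute[of "filt _ _ _ _"]]] .
      then show ?thesis unfolding norm_of_real by linarith
    qed
    ultimately have "cmod (filt \<sigma> K ys ?x) > (\<beta> - \<delta> / 12) * P - \<delta> / 3 * P" using \<alpha>P by linarith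
    moreover have "(\<beta> - \<delta> / 12) * P - \<delta> / 3 * P = (\<omega> + 7 / 12 * \<delta>) * P" by (simp add: \<delta>_def field_simps)
    moreover have "(\<omega> + 6 / 11 * \<delta>) * P \<le> (\<omega> + 7 / 12 * \<delta>) * P" using P \<delta> by (intro mult_right_mono) auto
    ultimately show ?thesis unfolding X by linarith
  qed
  show "\<exists>i\<in>A. \<exists>n::int. \<bar>x - (\<theta> i + real_of_int n)\<bar> < tau_of \<beta> \<omega> / real K" if x: "x \<in> Xset \<beta> \<omega> K ys" for x
  proof (rule ccontr)
    assume "\<not> ?thesis"
    then have far: "\<bar>(x - \<theta> i) + real_of_int n\<bar> \<ge> \<tau> / real K" if "i \<in> A" for i n
      using that by (auto simp: \<tau>_def not_less algebra_simps dest!: bspec[of _ _ i] spec[of _ "- n"])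
    have gfar: "gaussian_series \<kappa> (x - \<theta> i) \<le> (\<delta> / 12 + \<delta> / 22) * P" if i: "i \<in> A" for i
    proof -
      have "gaussian_series \<kappa> (x - \<theta> i) \<le> (exp (- pi * (\<kappa> * (\<tau> / real K))\<^sup>2) + 2 * exp (- pi * \<kappa>\<^sup>2 / 4)) * P"
        unfolding gP poisson_summation_gaussian[OF \<kappa>]
        by (rule periodized_gaussian_far[OF \<kappa>]) (use \<tau> far[OF i] in auto)
      also have "\<dots> \<le> (\<delta> / 12 + \<delta> / 22) * P"
      proof (intro mult_right_mono add_mono)
        have "(\<kappa> * (\<tau> / real K))\<^sup>2 = \<tau>"
          using \<tau> K0 \<sigma> by (simp add: \<kappa>_def power_divide power_mult_distrib power2_eq_square)
        then show "exp (- pi * (\<kappa> * (\<tau> / real K))\<^sup>2) \<le> \<delta> / 12" using e by simp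
        \<comment> \<open>This makes \<open>\<kappa>\<^sup>2 / 4\<close> at least
          \<open>2 * \<tau>\<close>, so the far images contribute at most
          \<open>2 * (\<delta> / 12)\<^sup>2\<close>, which is at most \<delta>/72.\<close>
        have "8 * \<tau> * \<tau> \<le> real K * real K"
        proof -
          have "8 * \<tau> * \<tau> \<le> (24 * \<tau>) * (24 * \<tau>)" using \<tau> by simp
          also have "\<dots> \<le> real K * real K" using K24 \<tau> by (intro mult_mono) auto
          finally show ?thesis .
        qed
        then have "2 * \<tau> \<le> \<kappa>\<^sup>2 / 4"
          using \<tau> \<sigma> by (simp add: \<kappa>_def power_divide field_simps power2_eq_square)
        then have "pi * (2 * \<tau>) \<le> pi * (\<kappa>\<^sup>2 / 4)" by (intro mult_left_mono) auto
        then have "exp (- pi * \<kappa>\<^sup>2 / 4) \<le> exp (- pi * \<tau> + - pi * \<tau>)" by simp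
        also have "\<dots> = \<delta> / 12 * (\<delta> / 12)" unfolding exp_add e ..
        also have "\<dots> \<le> \<delta> / 12 * (1 / 12)" using \<delta> by (intro mult_left_mono) auto
        finally show "2 * exp (- pi * \<kappa>\<^sup>2 / 4) \<le> \<delta> / 22" using \<delta> by simp
      qed (use P in auto)
      finally show ?thesis .
    qed
    have pA: "(\<Sum>i\<in>A. p i) \<le> 1" using pq sum_nonneg[of B q, OF q] by linarith
    have p0: "p i \<ge> 0" if "i \<in> A" for i using p[OF that] \<omega> by linarith
    have "(\<Sum>i\<in>A. p i * T (x - \<theta> i)) \<le> (\<Sum>i\<in>A. p i * ((\<delta> / 6 + \<delta> / 22) * P))"
    proof (intro sum_mono mult_left_mono p0)
      fix i assume "i \<in> A"
      have "T (x - \<theta> i) \<le> (\<delta> / 12 + \<delta> / 22) * P + \<delta> / 12 * P"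
        using Tg[of "x - \<theta> i"] gfar[OF \<open>i \<in> A\<close>] by linarith
      then show "T (x - \<theta> i) \<le> (\<delta> / 6 + \<delta> / 22) * P" by (simp add: algebra_simps)
    qed
    also have "\<dots> \<le> 1 * ((\<delta> / 6 + \<delta> / 22) * P)"
      unfolding sum_distrib_right[symmetric] using pA P \<delta> by (intro mult_right_mono) auto
    finally have sA: "(\<Sum>i\<in>A. p i * T (x - \<theta> i)) \<le> (\<delta> / 6 + \<delta> / 22) * P" by simp
    \<comment> \<open>Residual phases may lie anywhere, so their kernel values are bounded by the
      maximum \<open>P\<close>.\<close>
    have "(\<Sum>j\<in>B. q j * T (x - \<xi> j)) \<le> (\<Sum>j\<in>B. q j * P)"
      by (intro sum_mono mult_left_mono Tup q)
    also have "\<dots> \<le> \<omega> * P" unfolding sum_distrib_right[symmetric] using q\<omega> P by (intro mult_right_mono) auto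
    finally have sB: "(\<Sum>j\<in>B. q j * T (x - \<xi> j)) \<le> \<omega> * P" .
    have tot: "(\<Sum>z\<in>A <+> B. w z * T (x - \<zeta> z)) \<le> (\<omega> + \<delta> / 6 + \<delta> / 22) * P"
      using sA sB by (simp add: sum.Plus[OF fin] w_def \<zeta>_def algebra_simps)
    \<comment> \<open>\<open>Xset\<close> tests a modulus and the truncated kernel may be negative,
      hence the lower bound as well.\<close>
    have "(\<Sum>z\<in>A <+> B. w z * T (x - \<zeta> z)) \<ge> (\<Sum>z\<in>A <+> B. w z * - (\<delta> / 12 * P))"
      by (intro sum_mono mult_left_mono Tlow w0)
    also have "(\<Sum>z\<in>A <+> B. w z * - (\<delta> / 12 * P)) = - ((\<Sum>z\<in>A <+> B. w z) * (\<delta> / 12 * P))"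
      by (simp add: sum_distrib_right sum_negf)
    also have "\<dots> \<ge> - (1 * (\<delta> / 12 * P))"
      using W1 P \<delta> by (intro le_imp_neg_le mult_right_mono) auto
    finally have "(\<Sum>z\<in>A <+> B. w z * T (x - \<zeta> z)) \<ge> - (\<delta> / 12 * P)" by simp
    moreover have "\<delta> / 12 * P \<le> (\<omega> + \<delta> / 6 + \<delta> / 22) * P" using \<omega> P \<delta> by (intro mult_right_mono) auto
    ultimately have "\<bar>\<Sum>z\<in>A <+> B. w z * T (x - \<zeta> z)\<bar> \<le> (\<omega> + \<delta> / 6 + \<delta> / 22) * P" using tot by linarith
    moreover have "cmod (filt \<sigma> K ys x) \<le> \<bar>\<Sum>z\<in>A <+> B. w z * T (x - \<zeta> z)\<bar> + \<alpha> * P"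
    proof -
      have "cmod (filt \<sigma> K ys x) - cmod (complex_of_real (\<Sum>z\<in>A <+> B. w z * T (x - \<zeta> z))) \<le> \<alpha> * P"
        using order_trans[OF norm_triangle_ineq2 approx[of x]] .
      then show ?thesis unfolding norm_of_real by linarith
    qed
    ultimately have "cmod (filt \<sigma> K ys x) \<le> (\<omega> + \<delta> / 6 + \<delta> / 22) * P + \<delta> / 3 * P" using \<alpha>P by linarith
    also have "\<dots> = (\<omega> + 6 / 11 * \<delta>) * P" by (simp add: field_simps)
    finally show False using x unfolding X by simp
  qed
qed

lemma open_Xset: "open (Xset \<beta> \<omega> K ys)"
proof -
  have "continuous_on UNIV (\<lambda>x. cmod (filt \<sigma> K ys x))" for \<sigma>
    unfolding filt_def by (intro continuous_intros)
  then show ?thesis unfolding Xset_def Let_def by (intro open_Collect_less continuous_on_const)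
qed

section \<open>Closing the gaps and lifting the arcs\<close>

text \<open>\<open>Yset\<close> for an arbitrary set and gap length, which separates the topology of
  the line from the filter. For open \<open>X\<close> the components of its complement are the
  closed gaps, possibly single points.\<close>

definition fill_gaps :: "real set \<Rightarrow> real \<Rightarrow> real set" where
  "fill_gaps X r = closure X \<union> \<Union>{C. C \<in> components (- X) \<and> emeasure lborel C < ennreal r}"

lemma Yset_eq_fill_gaps: "Yset \<beta> \<omega> K ys = fill_gaps (Xset \<beta> \<omega> K ys) (tau_of \<beta> \<omega> / real K)"
  by (simp add: Yset_def fill_gaps_def Let_def)

lemma connected_subset_segment:
  fixes C :: "real set"
  assumes "connected C" "z \<in> C" "z \<in> closed_segment a b" "a \<notin> C" "b \<notin> C"
  shows "C \<subseteq> closed_segment a b"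
proof
  fix c assume "c \<in> C"
  then have "{c..z} \<subseteq> C" "{z..c} \<subseteq> C" using assms connected_contains_Icc by blast+
  then show "c \<in> closed_segment a b"
    using assms(3-5) by (auto simp: closed_segment_eq_real_ivl subset_iff split: if_splits; meson linear)
qed

text \<open>A gap that meets the segment but contains neither end lies inside it, hence is shorter
  than \<open>r\<close> and filled. Only gaps through an end of the segment remain, and
  \<open>ends\<close> disposes of them.\<close>

lemma segment_subset_fill_gaps:
  assumes ab: "\<bar>a - b\<bar> < r"
    and ends: "\<And>C z. C \<in> components (- X) \<Longrightarrow> z \<in> C \<Longrightarrow> z \<in> closed_segment a b \<Longrightarrow> a \<in> C \<or> b \<in> C \<Longrightarrow>
      z \<in> fill_gaps X r"
  shows "closed_segment a b \<subseteq> fill_gaps X r"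
proof
  fix z assume z: "z \<in> closed_segment a b"
  show "z \<in> fill_gaps X r"
  proof (cases "z \<in> X")
    case True
    then show ?thesis using closure_subset by (auto simp: fill_gaps_def)
  next
    case False
    then obtain C where C: "C \<in> components (- X)" "z \<in> C"
      by (metis ComplI Union_components UnionE)
    show ?thesis
    proof (cases "a \<in> C \<or> b \<in> C")
      case True
      then show ?thesis using ends C z by blast
    next
      case False
      then have "C \<subseteq> closed_segment a b"
        using connected_subset_segment[OF in_components_connected[OF C(1)] C(2) z] by blast
      then have "emeasure lborel C \<le> emeasure lborel (closed_segment a b)"
        by (intro emeasure_mono) auto
      also have "\<dots> = ennreal \<bar>a - b\<bar>"
        by (auto simp: closed_segment_eq_real_ivl)
      also have "\<dots> < ennreal r" using ab by (intro ennreal_lessI) auto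
      finally show ?thesis using C by (auto simp: fill_gaps_def)
    qed
  qed
qed

text \<open>If \<open>X\<close> had no point within \<open>r / 2\<close> of \<open>y\<close>, an
  open interval of length \<open>r\<close> around \<open>y\<close> would lie in one gap, which would
  then be too long to be filled.\<close>

lemma fill_gaps_near:
  assumes "open X" and "r > 0" and y: "y \<in> fill_gaps X r"
  shows "\<exists>x\<in>X. \<bar>y - x\<bar> < r / 2"
proof (cases "y \<in> closure X")
  case True
  then obtain x where "x \<in> X" "dist x y < r / 2"
    using \<open>r > 0\<close> by (meson closure_approachable half_gt_zero)
  then show ?thesis by (auto simp: dist_real_def abs_minus_commute)
next
  case False
  then obtain C where C: "C \<in> components (- X)" "y \<in> C" and small: "emeasure lborel C < ennreal r"
    using y by (auto simp: fill_gaps_def)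
  show ?thesis
  proof (rule ccontr)
    assume *: "\<not> ?thesis"
    let ?I = "{y - r / 2<..<y + r / 2}"
    have "?I \<subseteq> - X"
    proof (rule subsetI, rule ComplI)
      fix x assume "x \<in> ?I" "x \<in> X"
      then show False using * by (auto simp: not_less abs_if split: if_splits dest!: bspec[of _ _ x])
    qed
    moreover have "y \<in> ?I" using \<open>r > 0\<close> by simp
    ultimately have "?I \<subseteq> C"
      using C(2) by (intro components_maximal[OF C(1)]) auto
    moreover have "closed C" using closed_components[OF _ C(1)] \<open>open X\<close> by auto
    ultimately have "emeasure lborel ?I \<le> emeasure lborel C" by (intro emeasure_mono) auto
    then have "ennreal r \<le> emeasure lborel C" using \<open>r > 0\<close> by simp
    then show False using small by simp
  qed
qed

text \<open>Joins every point of the filled set to \<open>X\<close> without leaving that set. The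
  delicate case is a point \<open>y\<close> of the closure of \<open>X\<close> that borders a gap:
  the nearby point of \<open>X\<close> may lie across that gap, which may be too long to be filled.
  Then \<open>y\<close> is left on its other side, where \<open>X\<close> accumulates.\<close>

lemma fill_gaps_segment:
  assumes "open X" and "r > 0" and y: "y \<in> fill_gaps X r"
  shows "\<exists>x\<in>X. closed_segment y x \<subseteq> fill_gaps X r"
proof -
  have notC: "x \<notin> C" if "x \<in> X" "C \<in> components (- X)" for x C
    using that in_components_subset by blast
  have cl: "z \<in> fill_gaps X r" if "z \<in> closure X" for z using that by (auto simp: fill_gaps_def)
  obtain x0 where x0: "x0 \<in> X" "\<bar>y - x0\<bar> < r / 2" using fill_gaps_near[OF assms] by blast
  have x0r: "\<bar>y - x0\<bar> < r" using x0 \<open>r > 0\<close> by simp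
  show ?thesis
  proof (cases "y \<in> closure X")
    case False
    then obtain C0 where C0: "C0 \<in> components (- X)" "y \<in> C0" "emeasure lborel C0 < ennreal r"
      using y by (auto simp: fill_gaps_def)
    have "closed_segment y x0 \<subseteq> fill_gaps X r"
    proof (rule segment_subset_fill_gaps[OF x0r])
      fix C z assume "C \<in> components (- X)" "z \<in> C" "y \<in> C \<or> x0 \<in> C"
      then have "C = C0" using notC[OF x0(1)] components_eq[OF _ C0(1)] C0(2) by blast
      then show "z \<in> fill_gaps X r" using C0 \<open>z \<in> C\<close> by (auto simp: fill_gaps_def)
    qed
    then show ?thesis using x0 by blast
  next
    case ycl: True
    show ?thesis
    proof (cases "\<exists>z0 C0. C0 \<in> components (- X) \<and> z0 \<in> C0 \<and> y \<in> C0 \<and> z0 \<in> closed_segment y x0 \<and> z0 \<noteq> y")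
      case False
      have "closed_segment y x0 \<subseteq> fill_gaps X r"
      proof (rule segment_subset_fill_gaps[OF x0r])
        fix C z assume "C \<in> components (- X)" "z \<in> C" "z \<in> closed_segment y x0" "y \<in> C \<or> x0 \<in> C"
        then have "z = y" using False notC[OF x0(1)] by blast
        then show "z \<in> fill_gaps X r" using cl ycl by simp
      qed
      then show ?thesis using x0 by blast
    next
      case True
      then obtain z0 C0 where C0: "C0 \<in> components (- X)" "z0 \<in> C0" "y \<in> C0" and z0: "z0 \<noteq> y" by blast
      have sub: "{u..v} \<subseteq> - X" if "u \<in> C0" "v \<in> C0" for u v
        using connected_contains_Icc[OF in_components_connected[OF C0(1)] that] in_components_subset[OF C0(1)] by blast
      \<comment> \<open>\<open>x1\<close> is closer to \<open>y\<close> than \<open>z0\<close> is,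
        and \<open>C0\<close> covers everything between \<open>y\<close> and \<open>z0\<close>, so
        \<open>x1\<close> lies on the other side of \<open>y\<close>.\<close>
      obtain x1 where x1: "x1 \<in> X" "\<bar>x1 - y\<bar> < min \<bar>z0 - y\<bar> r"
      proof -
        have "min \<bar>z0 - y\<bar> r > 0" using z0 \<open>r > 0\<close> by simp
        then show thesis using that ycl unfolding closure_approachable dist_real_def by blast
      qed
      have opp: "(z0 < y \<and> y < x1) \<or> (x1 < y \<and> y < z0)"
      proof -
        have "x1 \<notin> {z0..y}" "x1 \<notin> {y..z0}" using sub[OF C0(2,3)] sub[OF C0(3,2)] x1(1) by auto
        then show ?thesis using x1(2) z0 by (auto simp: abs_if split: if_splits)
      qed
      have "closed_segment y x1 \<subseteq> fill_gaps X r"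
      proof (rule segment_subset_fill_gaps)
        show "\<bar>y - x1\<bar> < r" using x1 by (simp add: abs_minus_commute)
        fix C z assume C: "C \<in> components (- X)" "z \<in> C" "z \<in> closed_segment y x1" "y \<in> C \<or> x1 \<in> C"
        then have CC0: "C = C0" using notC[OF x1(1)] components_eq[OF _ C0(1)] C0(3) by blast
        \<comment> \<open>Otherwise the gap would extend to both sides of \<open>y\<close> and give
          it a neighbourhood disjoint from \<open>X\<close>, although \<open>y\<close> is in the
          closure of \<open>X\<close>.\<close>
        have "z = y"
        proof (rule ccontr)
          assume "z \<noteq> y"
          then have "y \<in> {min z z0<..<max z z0}"
            using C(3) opp by (auto simp: closed_segment_eq_real_ivl split: if_splits)
          moreover have "{min z z0<..<max z z0} \<inter> X = {}"
          proof -
            have "{z..z0} \<subseteq> - X" "{z0..z} \<subseteq> - X" using sub C(2) CC0 C0(2) by blast+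
            then show ?thesis by (fastforce simp: min_def max_def subset_iff split: if_splits)
          qed
          ultimately show False using ycl
            by (metis open_Int_closure_eq_empty open_greaterThanLessThan disjoint_iff)
        qed
        then show "z \<in> fill_gaps X r" using cl ycl by simp
      qed
      then show ?thesis using x1 by blast
    qed
  qed
qed

text \<open>The purpose of filling gaps. A point of \<open>X\<close> is closer than \<open>r\<close>
  to some \<open>l\<close> in \<open>L\<close>, so whatever separates the two is a chain of short
  gaps. Walking from any point to \<open>X\<close> and on to \<open>L\<close> therefore stays in one
  component.\<close>

lemma fill_gaps_component_meets:
  assumes "open X" and "r > 0" and LX: "L \<subseteq> X" and near: "\<And>x. x \<in> X \<Longrightarrow> \<exists>l\<in>L. \<bar>x - l\<bar> < r"
    and C: "C \<in> components (fill_gaps X r)"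
  shows "C \<inter> L \<noteq> {}"
proof -
  obtain y where y: "y \<in> C" using in_components_nonempty[OF C] by blast
  then have yF: "y \<in> fill_gaps X r" using in_components_subset[OF C] by blast
  obtain x where x: "x \<in> X" "closed_segment y x \<subseteq> fill_gaps X r"
    using fill_gaps_segment[OF assms(1,2) yF] by blast
  obtain l where l: "l \<in> L" "\<bar>x - l\<bar> < r" using near[OF x(1)] by blast
  have "closed_segment x l \<subseteq> fill_gaps X r"
    by (rule segment_subset_fill_gaps[OF l(2)]) (use x(1) l(1) LX in_components_subset in blast)
  then have "closed_segment y x \<union> closed_segment x l \<subseteq> fill_gaps X r" using x by simp
  moreover have "connected (closed_segment y x \<union> closed_segment x l)"
    by (intro connected_Un connected_segment) auto
  ultimately have "closed_segment y x \<union> closed_segment x l \<subseteq> C"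
    using components_maximal[OF C] y by (metis (no_types) UnI1 disjoint_iff ends_in_segment(1))
  then show ?thesis using l(1) by auto
qed

text \<open>The \<open>h\<close>-neighbourhoods of \<open>P\<close> and of its translates by nonzero
  integers are disjoint by \<open>sep\<close> and together cover \<open>J\<close>, so a connected
  \<open>J\<close> that contains a point of \<open>P\<close> stays in the former.\<close>

lemma connected_subset_single_translate:
  fixes J :: "real set"
  assumes "connected J" and fin: "finite P" and p0: "p0 \<in> P" "p0 \<in> J"
    and cover: "\<And>x. x \<in> J \<Longrightarrow> \<exists>p\<in>P. \<exists>n::int. \<bar>x - (p + real_of_int n)\<bar> \<le> h"
    and sep: "\<And>p p' q. p \<in> P \<Longrightarrow> p' \<in> P \<Longrightarrow> q \<noteq> 0 \<Longrightarrow> \<bar>p - p' - real_of_int q\<bar> > 2 * h"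
    and y: "y \<in> J"
  shows "\<exists>p\<in>P. \<bar>y - p\<bar> \<le> h"
proof -
  have "h \<ge> 0" using cover[OF y] by force
  let ?I = "{min p0 y..max p0 y}"
  have IJ: "?I \<subseteq> J"
    using connected_contains_Icc[OF \<open>connected J\<close>] p0 y by (auto simp: min_def max_def)
  obtain b where b: "\<And>p. p \<in> P \<Longrightarrow> \<bar>p\<bar> \<le> b"
    using finite_imp_bounded[OF fin] by (auto simp: bounded_iff)
  \<comment> \<open>Only translates by at most \<open>Q\<close> can come near the bounded interval
    \<open>?I\<close>, so \<open>?B\<close> may be taken as a finite union of closed sets.\<close>
  obtain Q :: nat where Q: "b + \<bar>p0\<bar> + \<bar>y\<bar> + h \<le> real Q" using real_arch_simple by blast
  let ?A = "\<Union>p\<in>P. {p - h..p + h}"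
  let ?B = "\<Union>p\<in>P. \<Union>n\<in>{- int Q..int Q} - {0}. {p + real_of_int n - h..p + real_of_int n + h}"
  have "?A \<inter> ?I = {} \<or> ?B \<inter> ?I = {}"
  proof (rule connected_closedD)
    show "connected ?I" by simp
    show "closed ?A" "closed ?B" using fin by (intro closed_UN finite_UnI finite_Diff finite_atLeastAtMost_int ballI closed_atLeastAtMost; simp)+
    show "?A \<inter> ?B \<inter> ?I = {}"
    proof (rule ccontr)
      assume "?A \<inter> ?B \<inter> ?I \<noteq> {}"
      then obtain x p p' n where "p \<in> P" "p' \<in> P" "n \<noteq> 0" "x \<in> {p - h..p + h}"
        "x \<in> {p' + real_of_int n - h..p' + real_of_int n + h}" by blast
      then show False using sep[of p p' n] by auto
    qed
    show "?I \<subseteq> ?A \<union> ?B"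
    proof
      fix x assume x: "x \<in> ?I"
      then obtain p and n :: int where pn: "p \<in> P" "\<bar>x - (p + real_of_int n)\<bar> \<le> h" using cover IJ by blast
      have "\<bar>x\<bar> \<le> \<bar>p0\<bar> + \<bar>y\<bar>" using x by (auto simp: min_def max_def split: if_splits)
      then have "\<bar>real_of_int n\<bar> \<le> real Q" using pn b[OF pn(1)] Q by linarith
      then have "n \<in> {- int Q..int Q}" by auto
      then show "x \<in> ?A \<union> ?B" using pn by (cases "n = 0") (fastforce simp: abs_le_iff)+
    qed
  qed
  moreover have "p0 \<in> ?A \<inter> ?I" using p0 \<open>h \<ge> 0\<close> by (auto intro!: bexI[of _ p0])
  ultimately have "?B \<inter> ?I = {}" by blast
  have "y \<in> ?I" by auto
  then obtain p and n :: int where pn: "p \<in> P" "\<bar>y - (p + real_of_int n)\<bar> \<le> h" using cover IJ by blast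
  have "\<bar>real_of_int n\<bar> \<le> real Q" using pn b[OF pn(1)] Q abs_ge_zero[of p0] by linarith
  then have n: "n \<in> {- int Q..int Q}" by auto
  have "n = 0"
  proof (rule ccontr)
    assume "n \<noteq> 0"
    then have "y \<in> ?B" using pn n by (fastforce simp: abs_le_iff)
    then show False using \<open>?B \<inter> ?I = {}\<close> \<open>y \<in> ?I\<close> by blast
  qed
  then show ?thesis using pn by auto
qed

text \<open>What a level needs from its multiplier \<open>M\<close>, in a form that the rule for
  \<open>m\<close> supplies at later levels and the range of the spectrum at the first. The first
  clause keeps an arc near one translate of \<Lambda>; the second makes a lift by a wrong integer
  miss \<open>E\<close>.\<close>

definition separated_translates :: "real set \<Rightarrow> real set \<Rightarrow> real \<Rightarrow> real \<Rightarrow> bool" where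
  "separated_translates \<Lambda> E \<eta> M \<longleftrightarrow> (\<forall>q::int. q \<noteq> 0 \<longrightarrow>
     (\<forall>x\<in>\<Lambda>. \<forall>y\<in>\<Lambda>. \<bar>x - y - real_of_int q / M\<bar> > \<eta> / M) \<and>
     (\<forall>x\<in>\<Lambda>. \<forall>e\<in>E. \<bar>e - x - real_of_int q / M\<bar> > \<eta> / (2 * M)))"

text \<open>Shifting the component by \<open>- n\<close> brings its eigenphase back to
  \<open>M * x\<close>; by the first separation clause the whole component then stays within
  \<open>\<eta> / 2\<close> of the points \<open>M * x\<close> with \<open>x\<close> in \<Lambda>.
  Any other lift, divided by \<open>M\<close>, is within \<open>\<eta> / (2 * M)\<close> of a
  nonzero translate of \<Lambda> and so misses \<open>E\<close>.\<close>

lemma valid_lift_unique: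
  assumes M: "M > 0" and fin: "finite \<Lambda>"
    and sep: "separated_translates \<Lambda> E \<eta> M"
    and cover: "\<And>y. y \<in> Y \<Longrightarrow> \<exists>x\<in>\<Lambda>. \<exists>n::int. \<bar>y - (M * x + real_of_int n)\<bar> \<le> \<eta> / 2"
    and C: "C \<in> components Y" and x: "x \<in> \<Lambda>" "M * x + real_of_int n \<in> C"
  shows valid_lift_near: "\<And>z. z \<in> C \<Longrightarrow> \<exists>x\<in>\<Lambda>. \<bar>z - real_of_int n - M * x\<bar> \<le> \<eta> / 2"
    and valid_lift_exact: "\<And>J. J \<in> arc_lifts C \<Longrightarrow> valid_lift M E J \<Longrightarrow> J = (\<lambda>z. z - real_of_int n) ` C"
    and arc_lifts_shift: "(\<lambda>z. z - real_of_int n) ` C \<in> arc_lifts C"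
proof -
  let ?J = "(\<lambda>z. z - real_of_int n) ` C"
  have near: "\<exists>p\<in>(*) M ` \<Lambda>. \<bar>z - p\<bar> \<le> \<eta> / 2" if "z \<in> ?J" for z
  proof (rule connected_subset_single_translate[OF _ _ _ _ _ _ that])
    show "connected ?J"
      using in_components_connected[OF C] by (intro connected_continuous_image continuous_intros)
    show "finite ((*) M ` \<Lambda>)" using fin by simp
    show "M * x \<in> (*) M ` \<Lambda>" using x by blast
    show "M * x \<in> ?J" by (rule image_eqI[OF _ x(2)]) simp
    show "\<exists>p\<in>(*) M ` \<Lambda>. \<exists>m::int. \<bar>u - (p + real_of_int m)\<bar> \<le> \<eta> / 2" if u: "u \<in> ?J" for u
    proof -
      obtain c where c: "c \<in> C" "u = c - real_of_int n" using u by blast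
      then obtain x' and m :: int where "x' \<in> \<Lambda>" "\<bar>c - (M * x' + real_of_int m)\<bar> \<le> \<eta> / 2"
        using cover in_components_subset[OF C] by blast
      then show ?thesis using c(2) by (intro bexI[of _ "M * x'"] exI[of _ "m - n"]) (auto simp: algebra_simps)
    qed
    show "\<bar>p - p' - real_of_int q\<bar> > 2 * (\<eta> / 2)" if pp: "p \<in> (*) M ` \<Lambda>" "p' \<in> (*) M ` \<Lambda>" "q \<noteq> 0" for p p' q
    proof -
      obtain u v where uv: "u \<in> \<Lambda>" "v \<in> \<Lambda>" "p = M * u" "p' = M * v" using pp by blast
      have "\<eta> / M < \<bar>u - v - real_of_int q / M\<bar>" using sep uv pp(3) by (auto simp: separated_translates_def)
      then have "M * (\<eta> / M) < M * \<bar>u - v - real_of_int q / M\<bar>" using M by (intro mult_strict_left_mono)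
      also have "\<dots> = \<bar>M * (u - v - real_of_int q / M)\<bar>" using M by (simp add: abs_mult)
      also have "M * (u - v - real_of_int q / M) = p - p' - real_of_int q" using M uv by (simp add: algebra_simps)
      finally show ?thesis using M by simp
    qed
  qed
  then show near': "\<exists>x\<in>\<Lambda>. \<bar>z - real_of_int n - M * x\<bar> \<le> \<eta> / 2" if "z \<in> C" for z using that by blast
  \<comment> \<open>The whole line would have unit intervals as lifts; it is excluded because the
    component stays near a finite set.\<close>
  have notU: "C \<noteq> UNIV"
  proof
    assume "C = UNIV"
    obtain b where b: "\<And>p. p \<in> (*) M ` \<Lambda> \<Longrightarrow> \<bar>p\<bar> \<le> b"
      using finite_imp_bounded[of "(*) M ` \<Lambda>"] fin by (auto simp: bounded_iff)
    obtain x' where "x' \<in> \<Lambda>" "\<bar>(b + \<eta> / 2 + 1 + real_of_int n) - real_of_int n - M * x'\<bar> \<le> \<eta> / 2"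
      using near' \<open>C = UNIV\<close> by blast
    moreover have "\<bar>M * x'\<bar> \<le> b" using b \<open>x' \<in> \<Lambda>\<close> by blast
    ultimately show False by linarith
  qed
  show "?J \<in> arc_lifts C"
    using notU by (auto simp: arc_lifts_def intro!: exI[of _ "- n"])
  show "J = ?J" if J: "J \<in> arc_lifts C" and v: "valid_lift M E J" for J
  proof -
    obtain m where m: "J = (\<lambda>z. z + real_of_int m) ` C" using J notU by (auto simp: arc_lifts_def)
    obtain c where c: "c \<in> C" "(c + real_of_int m) / M \<in> E" using v unfolding m valid_lift_def by blast
    obtain x' where x': "x' \<in> \<Lambda>" "\<bar>c - real_of_int n - M * x'\<bar> \<le> \<eta> / 2" using near'[OF c(1)] by blast
    have "m + n = 0"
    proof (rule ccontr)
      assume "m + n \<noteq> 0"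
      then have "\<eta> / (2 * M) < \<bar>(c + real_of_int m) / M - x' - real_of_int (m + n) / M\<bar>"
        using sep x'(1) c(2) unfolding separated_translates_def by blast
      then have "M * (\<eta> / (2 * M)) < M * \<bar>(c + real_of_int m) / M - x' - real_of_int (m + n) / M\<bar>"
        using M by (intro mult_strict_left_mono)
      also have "\<dots> = \<bar>M * ((c + real_of_int m) / M - x' - real_of_int (m + n) / M)\<bar>" using M by (simp add: abs_mult)
      also have "M * ((c + real_of_int m) / M - x' - real_of_int (m + n) / M) = c - real_of_int n - M * x'"
        using M by (simp add: right_diff_distrib)
      finally show False using x'(2) M by simp
    qed
    then have "m = - n" by simp
    then show ?thesis by (simp add: m)
  qed
qed

text \<open>An eigenvalue \<open>x\<close> survives the level because the component through
  \<open>M * x\<close> contains this point with integer part of the shift equal to 0, so its unique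
  admissible lift is the component itself.\<close>

lemma level_step:
  assumes M: "M > 0" and fin: "finite \<Lambda>" and \<Lambda>E: "\<Lambda> \<subseteq> E"
    and sep: "separated_translates \<Lambda> E \<eta> M"
    and cover: "\<And>y. y \<in> Y \<Longrightarrow> \<exists>x\<in>\<Lambda>. \<exists>n::int. \<bar>y - (M * x + real_of_int n)\<bar> \<le> \<eta> / 2"
    and meets: "\<And>C. C \<in> components Y \<Longrightarrow> \<exists>x\<in>\<Lambda>. \<exists>n::int. M * x + real_of_int n \<in> C"
    and \<Lambda>Y: "\<And>x. x \<in> \<Lambda> \<Longrightarrow> M * x \<in> Y"
    and J: "\<And>A. \<exists>J\<in>A. valid_lift M E J \<Longrightarrow> lift A \<in> A \<and> valid_lift M E (lift A)"
  shows level_step_valid: "\<And>A. A \<in> arcs Y \<Longrightarrow> lift A \<in> A \<and> valid_lift M E (lift A)"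
    and level_step_lower: "\<Lambda> \<subseteq> (\<Union>A\<in>arcs Y. (\<lambda>z. z / M) ` lift A)"
    and level_step_upper: "(\<Union>A\<in>arcs Y. (\<lambda>z. z / M) ` lift A) \<subseteq> Bset \<Lambda> (\<eta> / (2 * M))"
proof -
  have valid: "lift (arc_lifts C) \<in> arc_lifts C \<and> valid_lift M E (lift (arc_lifts C))"
    if C: "C \<in> components Y" for C
  proof (rule J)
    obtain x and n :: int where x: "x \<in> \<Lambda>" "M * x + real_of_int n \<in> C" using meets[OF C] by blast
    have "x \<in> (\<lambda>z. z / M) ` (\<lambda>z. z - real_of_int n) ` C"
      using M by (intro image_eqI[of _ _ "M * x"] image_eqI[OF _ x(2)]) auto
    then have "valid_lift M E ((\<lambda>z. z - real_of_int n) ` C)"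
      using x(1) \<Lambda>E by (auto simp: valid_lift_def)
    then show "\<exists>J\<in>arc_lifts C. valid_lift M E J"
      using arc_lifts_shift[OF M fin sep cover C x] by blast
  qed
  then show "lift A \<in> A \<and> valid_lift M E (lift A)" if "A \<in> arcs Y" for A
    using that by (auto simp: arcs_def)
  show "\<Lambda> \<subseteq> (\<Union>A\<in>arcs Y. (\<lambda>z. z / M) ` lift A)"
  proof
    fix x assume x: "x \<in> \<Lambda>"
    obtain C where C: "C \<in> components Y" "M * x \<in> C" using \<Lambda>Y[OF x] by (metis Union_components UnionE)
    have "lift (arc_lifts C) = (\<lambda>z. z - real_of_int 0) ` C"
      using valid[OF C(1)] C(2) by (intro valid_lift_exact[OF M fin sep cover C(1) x]) auto
    then have "M * x \<in> lift (arc_lifts C)" using C(2) by auto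
    then have "x \<in> (\<lambda>z. z / M) ` lift (arc_lifts C)" using M by (intro image_eqI[of _ _ "M * x"]) auto
    then show "x \<in> (\<Union>A\<in>arcs Y. (\<lambda>z. z / M) ` lift A)" using C(1) by (auto simp: arcs_def)
  qed
  show "(\<Union>A\<in>arcs Y. (\<lambda>z. z / M) ` lift A) \<subseteq> Bset \<Lambda> (\<eta> / (2 * M))"
  proof
    fix e assume "e \<in> (\<Union>A\<in>arcs Y. (\<lambda>z. z / M) ` lift A)"
    then obtain C u where C: "C \<in> components Y" and u: "u \<in> lift (arc_lifts C)" "e = u / M"
      by (auto simp: arcs_def)
    obtain x and n :: int where x: "x \<in> \<Lambda>" "M * x + real_of_int n \<in> C" using meets[OF C] by blast
    have "lift (arc_lifts C) = (\<lambda>z. z - real_of_int n) ` C"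
      using valid[OF C] by (intro valid_lift_exact[OF M fin sep cover C x]) auto
    then obtain x' where x': "x' \<in> \<Lambda>" "\<bar>u - M * x'\<bar> \<le> \<eta> / 2"
      using u(1) valid_lift_near[OF M fin sep cover C x] by auto
    have "\<bar>u - M * x'\<bar> / M \<le> \<eta> / 2 / M" using x'(2) M by (intro divide_right_mono) auto
    moreover have "\<bar>u - M * x'\<bar> / M = \<bar>e - x'\<bar>"
    proof -
      have "e - x' = (u - M * x') / M" using M u(2) by (simp add: diff_divide_distrib)
      then show ?thesis using M by (simp add: abs_divide)
    qed
    ultimately have "\<bar>e - x'\<bar> \<le> \<eta> / (2 * M)" by simp
    then show "e \<in> Bset \<Lambda> (\<eta> / (2 * M))" using x'(1) by (auto simp: Bset_def abs_le_iff intro!: bexI[of _ x'])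
  qed
qed

text \<open>Numbers in [0, 9/10] have differences at least 1/10 away from nonzero integers, which
  exceeds \<open>\<eta> / 2 \<le> 1 / 16\<close> and, for \<open>S \<ge> 2\<close>, also
  \<open>\<eta> \<le> 1 / 48\<close>. For \<open>S = 1\<close> the eigenvalue differences are 0 and
  \<open>\<eta> \<le> 1 / 8\<close> is enough.\<close>

lemma separated_translates_initial:
  assumes \<Lambda>: "lam ` {1..S} \<subseteq> {0..9/10}" and S: "S \<ge> 1"
    and \<eta>: "0 < \<eta>" "\<eta> \<le> 1 / (8 * real S * (2 * real S - 1))"
  shows "separated_translates (lam ` {1..S}) {0..9/10} \<eta> 1"
proof -
  have S1: "real S \<ge> 1" using S by simp
  have "8 * 1 * 1 \<le> 8 * real S * (2 * real S - 1)" using S1 by (intro mult_mono) auto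
  then have "1 / (8 * real S * (2 * real S - 1)) \<le> 1 / 8" by (intro divide_left_mono) auto
  then have \<eta>8: "\<eta> \<le> 1 / 8" using \<eta> by linarith
  have \<eta>S: "\<eta> \<le> 1 / 48" if "S \<noteq> 1"
  proof -
    have S2: "real S \<ge> 2" using that S by simp
    have "8 * 2 * 3 \<le> 8 * real S * (2 * real S - 1)" using S2 by (intro mult_mono) auto
    then have "1 / (8 * real S * (2 * real S - 1)) \<le> 1 / 48" by (intro divide_left_mono) auto
    then show ?thesis using \<eta> by linarith
  qed
  show ?thesis
    unfolding separated_translates_def
  proof (intro allI impI conjI ballI)
    fix q :: int and x y assume q: "q \<noteq> 0" and xy: "x \<in> lam ` {1..S}" "y \<in> lam ` {1..S}"
    have q1: "\<bar>real_of_int q\<bar> \<ge> 1" using q by linarith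
    show "\<eta> / 1 < \<bar>x - y - real_of_int q / 1\<bar>"
    proof (cases "S = 1")
      case True
      then show ?thesis using xy q1 \<eta>8 by auto
    next
      case False
      have "x \<in> {0..9/10}" "y \<in> {0..9/10}" using xy \<Lambda> by blast+
      then have "\<bar>x - y\<bar> \<le> 9 / 10" by (intro abs_leI) auto
      then show ?thesis using \<eta>S[OF False] q1 by linarith
    qed
  next
    fix q :: int and x e :: real assume q: "q \<noteq> 0" and x: "x \<in> lam ` {1..S}" and e: "e \<in> {0..9/10}"
    have q1: "\<bar>real_of_int q\<bar> \<ge> 1" using q by linarith
    have "x \<in> {0..9/10}" using x \<Lambda> by blast
    then have "\<bar>e - x\<bar> \<le> 9 / 10" using e by (intro abs_leI) auto
    then have "\<eta> / 2 < \<bar>e - x - real_of_int q\<bar>" using \<eta>8 \<eta>(1) q1 by linarith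
    then show "\<eta> / (2 * 1) < \<bar>e - x - real_of_int q / 1\<bar>" by simp
  qed
qed

text \<open>If \<open>e\<close> came within \<open>\<eta> / (2 * Mp)\<close> of
  \<open>x + q / (Mp * m)\<close>, it would lie both in \<open>G\<close> and in its translate. Since
  \<open>m \<ge> 2\<close>, this radius is at least \<open>\<eta> / (Mp * m)\<close>, which covers
  both clauses at the new scale.\<close>

lemma separated_translates_valid_m:
  assumes v: "valid_m \<eta> E Mp m" and Mp: "Mp > 0" and \<eta>: "\<eta> > 0" and \<Lambda>: "\<Lambda> \<subseteq> E"
  shows "separated_translates \<Lambda> E \<eta> (Mp * m)"
proof -
  define G where "G = Bset E (\<eta> / (2 * Mp))"
  have m: "2 \<le> m" and dis: "\<And>q::int. q \<noteq> 0 \<Longrightarrow> ((\<lambda>z. z + real_of_int q / (Mp * m)) ` G) \<inter> G = {}"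
    using v by (auto simp: valid_m_def G_def Let_def)
  have G: "e + u \<in> G" if "e \<in> E" "\<bar>u\<bar> \<le> \<eta> / (2 * Mp)" for e u
    using that by (auto simp: G_def Bset_def abs_le_iff intro!: bexI[of _ e])
  have G0: "e \<in> G" if "e \<in> E" for e using G[OF that, of 0] \<eta> Mp by simp
  have le: "\<eta> / (Mp * m) \<le> \<eta> / (2 * Mp)"
    using m Mp \<eta> by (intro divide_left_mono) auto
  have main: "\<bar>e - x - real_of_int q / (Mp * m)\<bar> > \<eta> / (2 * Mp)" if "q \<noteq> 0" "e \<in> E" "x \<in> E" for q e x
  proof (rule ccontr)
    assume "\<not> ?thesis"
    then have "x + (e - x - real_of_int q / (Mp * m)) \<in> G" using that by (intro G) auto
    then have "e \<in> (\<lambda>z. z + real_of_int q / (Mp * m)) ` G" by (rule rev_image_eqI) simp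
    then show False using dis[OF that(1)] G0[OF that(2)] by blast
  qed
  have "\<eta> / (2 * (Mp * m)) \<le> \<eta> / (Mp * m)" using m Mp \<eta> by (intro divide_left_mono) auto
  then show ?thesis
    unfolding separated_translates_def using main le \<Lambda> by (meson le_less_trans order_trans subsetD)
qed

section \<open>Choice of the multiplier\<close>

lemma Bset_trans:
  assumes "E \<subseteq> Bset \<Lambda> a" and "x \<in> Bset E b"
  shows "\<exists>l\<in>\<Lambda>. \<bar>x - l\<bar> \<le> a + b"
proof -
  obtain e where e: "e \<in> E" "\<bar>x - e\<bar> \<le> b" using assms(2) by (auto simp: Bset_def abs_le_iff)
  then obtain l where l: "l \<in> \<Lambda>" "\<bar>e - l\<bar> \<le> a" using assms(1) by (force simp: Bset_def abs_le_iff)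
  then show ?thesis using e by (intro bexI[of _ l]) auto
qed

text \<open>Points of \<open>G\<close> are within \<open>\<eta> / Mp\<close> of \<Lambda>, half of
  it from \<open>E\<close> and half from the rule, so if \<open>G\<close> meets its translate, two
  eigenvalues violate \<open>gap\<close> after scaling by \<open>Mp\<close>. Exchanging
  \<open>x\<close> and \<open>y\<close> reduces negative \<open>q\<close> to positive.\<close>

lemma valid_mI:
  assumes Mp: "Mp > 0" and E: "E \<subseteq> Bset \<Lambda> (\<eta> / (2 * Mp))" and m: "2 \<le> m" "m \<le> 4"
    and gap: "\<And>x y q. x \<in> \<Lambda> \<Longrightarrow> y \<in> \<Lambda> \<Longrightarrow> q \<ge> 1 \<Longrightarrow> \<bar>Mp * (x - y) - real_of_int q / m\<bar> > 2 * \<eta>"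
  shows "valid_m \<eta> E Mp m"
proof -
  let ?G = "Bset E (\<eta> / (2 * Mp))"
  have gap': "\<bar>Mp * (x - y) - real_of_int q / m\<bar> > 2 * \<eta>" if "x \<in> \<Lambda>" "y \<in> \<Lambda>" "q \<noteq> 0" for x y q
  proof (cases "q \<ge> 1")
    case False
    then have "\<bar>Mp * (y - x) - real_of_int (- q) / m\<bar> > 2 * \<eta>" using that by (intro gap) auto
    moreover have "Mp * (y - x) - real_of_int (- q) / m = - (Mp * (x - y) - real_of_int q / m)"
      by (simp add: algebra_simps)
    ultimately show ?thesis by (metis abs_minus_cancel)
  qed (use that gap in auto)
  have "((\<lambda>z. z + real_of_int q / (Mp * m)) ` ?G) \<inter> ?G = {}" if q: "q \<noteq> 0" for q
  proof (rule ccontr)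
    assume "((\<lambda>z. z + real_of_int q / (Mp * m)) ` ?G) \<inter> ?G \<noteq> {}"
    then obtain z where z: "z \<in> ?G" "z + real_of_int q / (Mp * m) \<in> ?G" by blast
    obtain x where x: "x \<in> \<Lambda>" "\<bar>z + real_of_int q / (Mp * m) - x\<bar> \<le> \<eta> / (2 * Mp) + \<eta> / (2 * Mp)"
      using Bset_trans[OF E z(2)] by blast
    obtain y where y: "y \<in> \<Lambda>" "\<bar>z - y\<bar> \<le> \<eta> / (2 * Mp) + \<eta> / (2 * Mp)"
      using Bset_trans[OF E z(1)] by blast
    have "\<bar>(x - y) - real_of_int q / (Mp * m)\<bar> \<le> 2 * (\<eta> / Mp)" using x y by (auto simp: abs_if split: if_splits)
    then have "Mp * \<bar>(x - y) - real_of_int q / (Mp * m)\<bar> \<le> Mp * (2 * (\<eta> / Mp))"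
      using Mp by (intro mult_left_mono) auto
    also have "Mp * \<bar>(x - y) - real_of_int q / (Mp * m)\<bar> = \<bar>Mp * ((x - y) - real_of_int q / (Mp * m))\<bar>"
      using Mp by (simp add: abs_mult)
    also have "Mp * ((x - y) - real_of_int q / (Mp * m)) = Mp * (x - y) - real_of_int q / m"
      using Mp m by (simp add: field_simps)
    finally show False using gap'[OF x(1) y(1) q] Mp by simp
  qed
  then show ?thesis using m by (simp add: valid_m_def Let_def)
qed

text \<open>For \<open>u = 1 / m\<close> in \<open>[1/4, 1/2]\<close> the multiples \<open>q * u\<close> that can come within \<open>2 * \<eta>\<close> of \<open>d\<close> have
  \<open>a \<le> q \<le> 2 * a\<close>, so the bad values of \<open>u\<close> have total length at most \<open>(a + 1) * 4 * \<eta> / a \<le> 8 * \<eta>\<close>.\<close>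
lemma bad_reciprocal_range:
  fixes d \<eta> u :: real and q :: int
  assumes "0 < \<eta>" "\<eta> \<le> 1 / 48" and u: "1 / 4 \<le> u" "u \<le> 1 / 2" and q: "q \<ge> 1" and near: "\<bar>d - real_of_int q * u\<bar> \<le> 2 * \<eta>"
  defines "a \<equiv> max 1 \<lceil>2 * (d - 2 * \<eta>)\<rceil>"
  shows "q \<in> {a..2 * a}" and "u \<in> {(d - 2 * \<eta>) / real_of_int q..(d + 2 * \<eta>) / real_of_int q}" and "d > 0"
proof -
  have q1: "real_of_int q \<ge> 1" using q by linarith
  have lo: "d - 2 * \<eta> \<le> real_of_int q * u" and hi: "real_of_int q * u \<le> d + 2 * \<eta>" using near by linarith+
  then show "u \<in> {(d - 2 * \<eta>) / real_of_int q..(d + 2 * \<eta>) / real_of_int q}"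
    using q1 by (auto simp: field_simps)
  have "real_of_int q * u \<le> real_of_int q * (1 / 2)" using u q1 by (intro mult_left_mono) auto
  then have "real_of_int q * u \<le> real_of_int q / 2" by simp
  moreover have "w \<le> Q / 2 \<Longrightarrow> v \<le> w \<Longrightarrow> 2 * v \<le> Q" for v w Q :: real by linarith
  ultimately have "2 * (d - 2 * \<eta>) \<le> real_of_int q" using lo by blast
  then have "a \<le> q" using q by (auto simp: a_def ceiling_le_iff)
  have "real_of_int q * (1 / 4) \<le> real_of_int q * u" using u q1 by (intro mult_left_mono) auto
  then have qu: "real_of_int q / 4 \<le> real_of_int q * u" by simp
  \<comment> \<open>Only positive differences can be bad, so each unordered pair of eigenvalues
    counts once.\<close>
  then show "d > 0" using hi q1 assms(1,2) by linarith
  have "real_of_int a \<ge> 2 * (d - 2 * \<eta>)" unfolding a_def using le_of_int_ceiling[of "2 * (d - 2 * \<eta>)"] by linarith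
  then have "real_of_int q < real_of_int (2 * a + 1)" using qu hi assms(2) by simp
  then have "q \<le> 2 * a" by linarith
  then show "q \<in> {a..2 * a}" using \<open>a \<le> q\<close> by simp
qed

text \<open>A measure count for \<open>u = 1 / m\<close> in [1/4, 1/2]. Each pair in
  \<open>R\<close> excludes length at most \<open>8 * \<eta>\<close> and there are at most
  \<open>S * (S - 1) / 2\<close> pairs, so the total is at most
  \<open>(S - 1) / (2 * (2 * S - 1))\<close>, which is below the length 1/4. For
  \<open>S = 1\<close> all differences are 0 and \<open>m = 2\<close> works.\<close>

lemma valid_m_exists:
  fixes lam :: "nat \<Rightarrow> real"
  assumes Mp: "Mp > 0" and S: "S \<ge> 1"
    and \<eta>: "0 < \<eta>" "\<eta> \<le> 1 / (8 * real S * (2 * real S - 1))"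
    and E: "E \<subseteq> Bset (lam ` {1..S}) (\<eta> / (2 * Mp))"
  shows "\<exists>m. valid_m \<eta> E Mp m"
proof (cases "S = 1")
  case True
  have "\<eta> \<le> 1 / 8" using \<eta> True by simp
  have "valid_m \<eta> E Mp 2"
  proof (rule valid_mI[OF Mp E])
    fix x y :: real and q :: int assume "x \<in> lam ` {1..S}" "y \<in> lam ` {1..S}" "q \<ge> 1"
    then have "x - y = 0" "real_of_int q \<ge> 1" using True by auto
    then show "2 * \<eta> < \<bar>Mp * (x - y) - real_of_int q / 2\<bar>" using \<open>\<eta> \<le> 1 / 8\<close> by simp
  qed auto
  then show ?thesis by blast
next
  case False
  have S2: "real S \<ge> 2" using False S by simp
  have "8 * 2 * 3 \<le> 8 * real S * (2 * real S - 1)" using S2 by (intro mult_mono) auto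
  then have "1 / (8 * real S * (2 * real S - 1)) \<le> 1 / 48" by (intro divide_left_mono) auto
  then have \<eta>48: "\<eta> \<le> 1 / 48" using \<eta> by linarith
  define d where "d z = Mp * (lam (fst z) - lam (snd z))" for z
  define R where "R = {z \<in> {1..S} \<times> {1..S}. lam (fst z) > lam (snd z)}"
  define a where "a z = max 1 \<lceil>2 * (d z - 2 * \<eta>)\<rceil>" for z
  define I where "I = (SIGMA z:R. {a z..2 * a z})"
  define Bad where "Bad w = {(d (fst w) - 2 * \<eta>) / real_of_int (snd w)..(d (fst w) + 2 * \<eta>) / real_of_int (snd w)}" for w
  have finR: "finite R" unfolding R_def by simp
  have finI: "finite I" unfolding I_def using finR by auto
  have a1: "a z \<ge> 1" for z by (simp add: a_def)
  have cardR: "real (card R) \<le> real S * (real S - 1) / 2"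
  proof -
    \<comment> \<open>\<open>R\<close>, its mirror image and the diagonal are disjoint subsets of
      the square of indices.\<close>
    let ?D = "(\<lambda>i. (i, i)) ` {1..S}"
    have "card (R \<union> prod.swap ` R \<union> ?D) \<le> card ({1..S} \<times> {1..S})"
      by (rule card_mono) (auto simp: R_def)
    moreover have "card (R \<union> prod.swap ` R \<union> ?D) = card R + card R + S"
    proof -
      have "card (R \<union> prod.swap ` R \<union> ?D) = card (R \<union> prod.swap ` R) + card ?D"
        using finR by (intro card_Un_disjoint) (auto simp: R_def)
      also have "card (R \<union> prod.swap ` R) = card R + card (prod.swap ` R)"
        using finR by (intro card_Un_disjoint) (auto simp: R_def)
      also have "card (prod.swap ` R) = card R" by (intro card_image) auto
      also have "card ?D = S" by (subst card_image) (auto simp: inj_on_def)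
      finally show ?thesis .
    qed
    ultimately have "2 * card R + S \<le> S * S" by (simp add: card_cartesian_product)
    then have "real (2 * card R + S) \<le> real (S * S)" by (rule of_nat_mono)
    then show ?thesis by (simp add: algebra_simps)
  qed
  have tot: "(\<Sum>w\<in>I. 4 * \<eta> / real_of_int (snd w)) < 1 / 4"
  proof -
    have "(\<Sum>w\<in>I. 4 * \<eta> / real_of_int (snd w)) = (\<Sum>z\<in>R. \<Sum>q\<in>{a z..2 * a z}. 4 * \<eta> / real_of_int q)"
      unfolding I_def by (subst sum.Sigma) (use finR in \<open>auto simp: case_prod_beta\<close>)
    also have "\<dots> \<le> (\<Sum>z\<in>R. 8 * \<eta>)"
    proof (rule sum_mono)
      fix z assume "z \<in> R"
      have az: "real_of_int (a z) \<ge> 1" using a1[of z] by linarith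
      have "(\<Sum>q\<in>{a z..2 * a z}. 4 * \<eta> / real_of_int q) \<le> of_nat (card {a z..2 * a z}) * (4 * \<eta> / real_of_int (a z))"
        by (rule sum_bounded_above) (use \<eta> az in \<open>auto intro!: divide_left_mono mult_pos_pos\<close>)
      also have "\<dots> = (real_of_int (a z) + 1) * (4 * \<eta> / real_of_int (a z))" using a1[of z] by simp
      also have "\<dots> \<le> (2 * real_of_int (a z)) * (4 * \<eta> / real_of_int (a z))"
        using az \<eta> by (intro mult_right_mono) auto
      also have "\<dots> = 8 * \<eta>" using az by simp
      finally show "(\<Sum>q\<in>{a z..2 * a z}. 4 * \<eta> / real_of_int q) \<le> 8 * \<eta>" .
    qed
    also have "\<dots> = real (card R) * (8 * \<eta>)" by simp
    also have "\<dots> \<le> (real S * (real S - 1) / 2) * (8 * (1 / (8 * real S * (2 * real S - 1))))"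
      using cardR \<eta> S2 by (intro mult_mono) auto
    also have "\<dots> = (real S - 1) / (2 * (2 * real S - 1))" using S2 by (simp add: field_simps)
    also have "\<dots> < 1 / 4" using S2 by (simp add: field_simps)
    finally show ?thesis .
  qed
  have "\<not> {1 / 4..1 / 2} \<subseteq> (\<Union>w\<in>I. Bad w)"
  proof
    assume sub: "{1 / 4..1 / 2} \<subseteq> (\<Union>w\<in>I. Bad w)"
    have "ennreal (1 / 4) = emeasure lborel {1 / 4..1 / 2 :: real}" by simp
    also have "\<dots> \<le> emeasure lborel (\<Union>w\<in>I. Bad w)"
      using sub finI by (intro emeasure_mono) (auto simp: Bad_def)
    also have "\<dots> \<le> (\<Sum>w\<in>I. emeasure lborel (Bad w))"
      using finI by (intro emeasure_subadditive_finite) (auto simp: Bad_def)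
    also have "\<dots> = (\<Sum>w\<in>I. ennreal (4 * \<eta> / real_of_int (snd w)))"
    proof (intro sum.cong refl)
      fix w assume "w \<in> I"
      then have "snd w \<ge> 1" using a1[of "fst w"] by (auto simp: I_def)
      then have w: "real_of_int (snd w) \<ge> 1" by linarith
      have "(d (fst w) - 2 * \<eta>) / real_of_int (snd w) \<le> (d (fst w) + 2 * \<eta>) / real_of_int (snd w)"
        using w \<eta> by (intro divide_right_mono) auto
      moreover have "(d (fst w) + 2 * \<eta>) / real_of_int (snd w) - (d (fst w) - 2 * \<eta>) / real_of_int (snd w) = 4 * \<eta> / real_of_int (snd w)"
        by (simp add: diff_divide_distrib[symmetric])
      ultimately show "emeasure lborel (Bad w) = ennreal (4 * \<eta> / real_of_int (snd w))"
        by (simp add: Bad_def)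
    qed
    also have "\<dots> = ennreal (\<Sum>w\<in>I. 4 * \<eta> / real_of_int (snd w))"
    proof (rule sum_ennreal)
      fix w assume "w \<in> I"
      then have "snd w \<ge> 1" using a1[of "fst w"] by (auto simp: I_def)
      then show "0 \<le> 4 * \<eta> / real_of_int (snd w)" using \<eta> by simp
    qed
    finally show False using tot by (simp add: ennreal_le_iff2)
  qed
  then obtain u where u: "1 / 4 \<le> u" "u \<le> 1 / 2" "u \<notin> (\<Union>w\<in>I. Bad w)"
    by (meson atLeastAtMost_iff subsetI)
  have "valid_m \<eta> E Mp (1 / u)"
  proof (rule valid_mI[OF Mp E])
    show "2 \<le> 1 / u" "1 / u \<le> 4" using u by (auto simp: field_simps)
    fix x y :: real and q :: int assume xy: "x \<in> lam ` {1..S}" "y \<in> lam ` {1..S}" and q: "q \<ge> 1"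
    then obtain s s' where s: "s \<in> {1..S}" "s' \<in> {1..S}" "x = lam s" "y = lam s'" by blast
    show "2 * \<eta> < \<bar>Mp * (x - y) - real_of_int q / (1 / u)\<bar>"
    proof (rule ccontr)
      assume "\<not> ?thesis"
      then have near: "\<bar>d (s, s') - real_of_int q * u\<bar> \<le> 2 * \<eta>" by (simp add: d_def s)
      note b = bad_reciprocal_range[OF \<eta>(1) \<eta>48 u(1,2) q near]
      have "lam s > lam s'" using b(3) Mp by (simp add: d_def zero_less_mult_iff)
      then have "((s, s'), q) \<in> I" using b(1) s by (auto simp: I_def R_def a_def)
      moreover have "u \<in> Bad ((s, s'), q)" using b(2) by (simp add: Bad_def)
      ultimately show False using u(3) by blast
    qed
  qed
  then show ?thesis by blast
qed

section \<open>Runs of the algorithm\<close>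

context
  fixes g :: "real \<Rightarrow> complex" and \<beta> \<omega> \<eta> \<epsilon> :: real and K N :: nat
    and mch :: "nat \<Rightarrow> real \<Rightarrow> real set \<Rightarrow> real"
    and lch :: "nat \<Rightarrow> real \<Rightarrow> real set \<Rightarrow> real set \<Rightarrow> real set set \<Rightarrow> real set"
  assumes \<epsilon>: "0 < \<epsilon>" "\<epsilon> \<le> \<eta>"
begin

abbreviation run :: "nat \<Rightarrow> nat \<Rightarrow> real \<Rightarrow> real set \<Rightarrow> (real list \<times> real set option) pmf" where
  "run \<equiv> rmpe_run g \<beta> \<omega> \<eta> K N \<epsilon> mch lch"

text \<open>The term \<open>2 * Mp\<close> makes the geometric bound \<open>M\<^sub>1 + \<dots> + M\<^sub>L \<le> 2 * M\<^sub>L\<close> inductive.\<close>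
lemma rmpe_run_times:
  assumes "r \<in> set_pmf (run f l Mp E)" and "Mp > 0" and "l = 0 \<Longrightarrow> Mp = 1" and "l \<noteq> 0 \<Longrightarrow> Mp < \<eta> / \<epsilon>"
  shows "(\<forall>M\<in>set (fst r). 0 \<le> M \<and> M \<le> 4 * \<eta> / \<epsilon>) \<and>
    sum_list (fst r) \<le> 8 * \<eta> / \<epsilon> - (if l = 0 then 0 else 2 * Mp)"
  using assms
proof (induction f arbitrary: l Mp E r)
  case 0
  have "1 \<le> \<eta> / \<epsilon>" using \<epsilon> by simp
  then show ?case using 0 by auto
next
  case (Suc f)
  have \<eta>\<epsilon>: "1 \<le> \<eta> / \<epsilon>" using \<epsilon> by simp
  define m where "m = (if l = 0 then 1 else mch l Mp E)"
  define M where "M = Mp * m"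
  show ?case
  proof (cases "l \<noteq> 0 \<and> \<not> valid_m \<eta> E Mp m")
    case True
    then have "r = ([], None)" using Suc.prems(1) unfolding rmpe_run.simps Let_def m_def[symmetric] by simp
    then show ?thesis using Suc.prems(4) \<eta>\<epsilon> by auto
  next
    case False
    then have m: "l \<noteq> 0 \<Longrightarrow> 2 \<le> m \<and> m \<le> 4" by (auto simp: valid_m_def)
    have M0: "l = 0 \<Longrightarrow> M = 1" using Suc.prems(3) by (simp add: M_def m_def)
    have M2: "l \<noteq> 0 \<Longrightarrow> 2 * Mp \<le> M" and M4: "l \<noteq> 0 \<Longrightarrow> M \<le> 4 * Mp"
      using m Suc.prems(2) by (auto simp: M_def)
    have Mpos: "M > 0" using M0 M2 Suc.prems(2) by (cases "l = 0") auto
    \<comment> \<open>A later level is entered only with \<open>Mp < \<eta> / \<epsilon>\<close>,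
      and \<open>m \<le> 4\<close>.\<close>
    have Mle: "M \<le> 4 * \<eta> / \<epsilon>" using M0 M4 Suc.prems(4) \<eta>\<epsilon> by (cases "l = 0") auto
    from Suc.prems(1) False obtain ys where
      "r \<in> set_pmf (let Y = Yset \<beta> \<omega> K ys; J = lch l M E Y in
          if \<not> (\<forall>A\<in>arcs Y. J A \<in> A \<and> valid_lift M E (J A)) then return_pmf ([M], None) else
          (let E' = (\<Union>A\<in>arcs Y. (\<lambda>z. z / M) ` J A) in
           if \<eta> / M \<le> \<epsilon> then return_pmf ([M], Some E')
           else map_pmf (\<lambda>(Ms, r). (M # Ms, r)) (run f (Suc l) M E')))"
      by (auto simp only: rmpe_run.simps Let_def m_def[symmetric] M_def[symmetric] if_False set_bind_pmf)
    then consider "fst r = [M]" | E' r' where "\<not> \<eta> / M \<le> \<epsilon>" "r' \<in> set_pmf (run f (Suc l) M E')" "fst r = M # fst r'"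
      by (auto simp: Let_def split: if_splits)
    then show ?thesis
    proof cases
      case 1
      then show ?thesis using Mpos Mle M2 \<eta>\<epsilon> M0 by (cases "l = 0") auto
    next
      case 2
      have "M < \<eta> / \<epsilon>" using 2(1) Mpos \<epsilon> by (simp add: field_simps)
      then have "(\<forall>M\<in>set (fst r'). 0 \<le> M \<and> M \<le> 4 * \<eta> / \<epsilon>) \<and>
          sum_list (fst r') \<le> 8 * \<eta> / \<epsilon> - (if Suc l = 0 then 0 else 2 * M)"
        using Mpos by (intro Suc.IH[OF 2(2)]) auto
      then show ?thesis using 2(3) Mpos Mle M2 M0 by (cases "l = 0") auto
    qed
  qed
qed

end

section \<open>Runtimes from the list of multipliers\<close>

lemma T_total_le:
  assumes Ms: "sum_list Ms \<le> C" "\<And>M. M \<in> set Ms \<Longrightarrow> M \<ge> 0"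
  shows "T_total K n Ms \<le> C * (real K)\<^sup>2 * real n"
proof -
  have k2: "(\<Sum>k\<le>K. real k) \<le> (real K)\<^sup>2"
  proof -
    have "(\<Sum>k\<le>K. real k) = (\<Sum>k=1..K. real k)" by (intro sum.mono_neutral_right) (auto simp: Suc_le_eq)
    also have "\<dots> \<le> (\<Sum>k=1..K. real K)" by (intro sum_mono) auto
    finally show ?thesis by (simp add: power2_eq_square)
  qed
  have "(\<Sum>k\<le>K. real n * (M * real k)) = M * (real n * (\<Sum>k\<le>K. real k))" for M
    by (simp add: sum_distrib_left mult_ac)
  then have eq: "T_total K n Ms = sum_list Ms * (real n * (\<Sum>k\<le>K. real k))"
    unfolding T_total_def by (simp add: sum_list_mult_const)
  have "0 \<le> sum_list Ms" using Ms(2) by (intro sum_list_nonneg)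
  then have "sum_list Ms * (real n * (\<Sum>k\<le>K. real k)) \<le> C * (real n * (real K)\<^sup>2)"
    using Ms(1) k2 by (intro mult_mono) (auto intro!: sum_nonneg mult_nonneg_nonneg)
  then show ?thesis by (simp add: eq mult_ac)
qed

lemma T_max_le:
  assumes "\<And>M. M \<in> set Ms \<Longrightarrow> M \<le> C" and "C \<ge> 0"
  shows "T_max K Ms \<le> C * real K"
  using assms by (auto simp: T_max_def intro!: mult_right_mono)

text \<open>The interface between linear algebra and signal processing: of the matrices there
  remains only the overlap \<open>g\<close> as a nonnegative combination of phases, with weights
  \<open>p\<close> on the eigenvalues and \<open>q\<close> on the unknown residual phases.\<close>

locale rmpe_model =
  fixes g :: "real \<Rightarrow> complex" and \<beta> \<omega> \<eta> \<epsilon> \<alpha> :: real and K S :: nat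
    and lam :: "nat \<Rightarrow> real" and p :: "nat \<Rightarrow> real" and F :: "complex set" and q :: "complex \<Rightarrow> real"
    and mch :: "nat \<Rightarrow> real \<Rightarrow> real set \<Rightarrow> real"
    and lch :: "nat \<Rightarrow> real \<Rightarrow> real set \<Rightarrow> real set \<Rightarrow> real set set \<Rightarrow> real set"
  assumes \<epsilon>: "0 < \<epsilon>" "\<epsilon> \<le> \<eta>"
    and \<omega>: "0 \<le> \<omega>" "\<omega> < \<beta>" and \<alpha>: "\<alpha> < (\<beta> - \<omega>) / 3"
    and S: "S \<ge> 1" and \<eta>: "0 < \<eta>" "\<eta> \<le> 1 / (8 * real S * (2 * real S - 1))"
    and K: "real K \<ge> 3 / \<eta> * tau_of \<beta> \<omega>"
    and \<Lambda>: "lam ` {1..S} \<subseteq> {0..9/10}"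
    and p: "\<And>s. s \<in> {1..S} \<Longrightarrow> p s \<ge> \<beta>"
    and F: "finite F" and q: "\<And>\<nu>. \<nu> \<in> F \<Longrightarrow> q \<nu> \<ge> 0" and q\<omega>: "(\<Sum>\<nu>\<in>F. q \<nu>) \<le> \<omega>"
    and pq: "(\<Sum>s\<in>{1..S}. p s) + (\<Sum>\<nu>\<in>F. q \<nu>) = 1"
    and g: "\<And>t. g t = (\<Sum>s\<in>{1..S}. complex_of_real (p s) * exp (- 2 * pi * \<i> * lam s * t)) +
        (\<Sum>\<nu>\<in>F. complex_of_real (q \<nu>) * exp (- 2 * pi * \<i> * Re \<nu> * t))"
    and choices: "good_choices \<eta> mch lch"
begin

lemma \<beta>_le_1: "\<beta> \<le> 1"
proof -
  have "\<beta> \<le> p 1" using p S by auto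
  also have "\<dots> \<le> (\<Sum>s\<in>{1..S}. p s)"
    using p S \<omega> by (intro member_le_sum) (auto intro: order_trans[of 0 \<beta>])
  also have "\<dots> \<le> 1" using pq sum_nonneg[of F q, OF q] by linarith
  finally show ?thesis .
qed

lemma tau_pos: "tau_of \<beta> \<omega> > 0"
  unfolding tau_of_def using \<beta>_le_1 \<omega> by (intro mult_pos_pos) (auto intro!: ln_gt_zero simp: field_simps)

lemma \<eta>_le: "\<eta> \<le> 1 / 8"
proof -
  have "real S \<ge> 1" using S by simp
  then have "8 * 1 * 1 \<le> 8 * real S * (2 * real S - 1)" by (intro mult_mono) auto
  then have "1 / (8 * real S * (2 * real S - 1)) \<le> 1 / 8" by (intro divide_left_mono) auto
  then show ?thesis using \<eta> by linarith
qed

lemma K_ge: "real K \<ge> 24 * tau_of \<beta> \<omega>" and K_pos: "K > 0"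
  and tau_K: "3 * (tau_of \<beta> \<omega> / real K) \<le> \<eta>"
proof -
  have "24 \<le> 3 / \<eta>" using \<eta> \<eta>_le by (simp add: field_simps)
  then have "24 * tau_of \<beta> \<omega> \<le> 3 / \<eta> * tau_of \<beta> \<omega>" using tau_pos by (intro mult_right_mono) auto
  then show K24: "real K \<ge> 24 * tau_of \<beta> \<omega>" using K by linarith
  then have K0: "real K > 0" using tau_pos by linarith
  then show "K > 0" by simp
  show "3 * (tau_of \<beta> \<omega> / real K) \<le> \<eta>" using K K0 \<eta> by (simp add: field_simps)
qed

lemma g_le_1: "cmod (g t) \<le> 1"
proof -
  have "cmod (g t) \<le> (\<Sum>s\<in>{1..S}. p s) + (\<Sum>\<nu>\<in>F. q \<nu>)"
    unfolding g
  proof (intro norm_triangle_le add_mono sum_norm_le)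
    fix s assume "s \<in> {1..S}"
    then have "p s \<ge> 0" using p[of s] \<omega> by auto
    then show "cmod (complex_of_real (p s) * exp (- 2 * pi * \<i> * lam s * t)) \<le> p s"
      by (simp add: norm_mult)
  next
    fix \<nu> assume "\<nu> \<in> F"
    then have "q \<nu> \<ge> 0" using q by auto
    then show "cmod (complex_of_real (q \<nu>) * exp (- 2 * pi * \<i> * Re \<nu> * t)) \<le> q \<nu>"
      by (simp add: norm_mult)
  qed
  then show ?thesis by (simp only: pq)
qed

text \<open>Time \<open>M * k\<close> on eigenvalue \<open>lam s\<close> is frequency
  \<open>k\<close> at phase \<open>M * lam s\<close>, so the phase analysis applies to the scaled
  phases. A point of \<open>Yset\<close> is less than \<open>?r / 2\<close> from \<open>?X\<close>,
  and from there less than \<open>?r\<close> to an eigenphase; \<open>3 * ?r \<le> \<eta>\<close>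
  bounds the sum by \<open>\<eta> / 2\<close>.\<close>

lemma good_level:
  assumes M: "M > 0" and sep: "separated_translates (lam ` {1..S}) E \<eta> M" and \<Lambda>E: "lam ` {1..S} \<subseteq> E"
    and ys: "\<And>k. k \<le> K \<Longrightarrow> cmod (ys ! k - g (M * real k)) < \<alpha>"
  defines "Y \<equiv> Yset \<beta> \<omega> K ys"
  shows good_level_valid: "\<And>A. A \<in> arcs Y \<Longrightarrow> lch l M E Y A \<in> A \<and> valid_lift M E (lch l M E Y A)"
    and good_level_lower: "lam ` {1..S} \<subseteq> (\<Union>A\<in>arcs Y. (\<lambda>z. z / M) ` lch l M E Y A)"
    and good_level_upper: "(\<Union>A\<in>arcs Y. (\<lambda>z. z / M) ` lch l M E Y A) \<subseteq> Bset (lam ` {1..S}) (\<eta> / (2 * M))"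
proof -
  let ?X = "Xset \<beta> \<omega> K ys" and ?r = "tau_of \<beta> \<omega> / real K"
  let ?L = "{M * lam s + real_of_int n | s n. s \<in> {1..S}}"
  have r: "?r > 0" using tau_pos K_pos by simp
  have y: "cmod (ys ! k - ((\<Sum>s\<in>{1..S}. complex_of_real (p s) * exp (- 2 * pi * \<i> * complex_of_real (M * lam s) * of_nat k)) +
         (\<Sum>\<nu>\<in>F. complex_of_real (q \<nu>) * exp (- 2 * pi * \<i> * complex_of_real (M * Re \<nu>) * of_nat k)))) \<le> \<alpha>"
    if "k \<le> K" for k
    using ys[OF that] unfolding g by (simp add: mult_ac)
  have near: "\<And>s n. s \<in> {1..S} \<Longrightarrow> M * lam s + real_of_int n \<in> ?X"
    "\<And>x. x \<in> ?X \<Longrightarrow> \<exists>s\<in>{1..S}. \<exists>n::int. \<bar>x - (M * lam s + real_of_int n)\<bar> < ?r"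
    using Xset_near_eigenphases[where A = "{1..S}" and B = F and p = p and q = q and
      \<theta> = "\<lambda>s. M * lam s" and \<xi> = "\<lambda>\<nu>. M * Re \<nu>",
      OF \<beta>_le_1 \<omega> \<alpha> K_ge finite_atLeastAtMost F p q q\<omega> eq_refl[OF pq] y] by blast+
  have LX: "?L \<subseteq> ?X" using near(1) by blast
  have XL: "\<exists>l\<in>?L. \<bar>x - l\<bar> < ?r" if "x \<in> ?X" for x using near(2)[OF that] by blast
  have cover: "\<exists>x\<in>lam ` {1..S}. \<exists>n::int. \<bar>y - (M * x + real_of_int n)\<bar> \<le> \<eta> / 2" if yY: "y \<in> Y" for y
  proof -
    obtain x where x: "x \<in> ?X" "\<bar>y - x\<bar> < ?r / 2"
      using fill_gaps_near[OF open_Xset r yY[unfolded Y_def Yset_eq_fill_gaps]] by blast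
    obtain s n where s: "s \<in> {1..S}" "\<bar>x - (M * lam s + real_of_int n)\<bar> < ?r" using XL[OF x(1)] by blast
    have "\<bar>y - x\<bar> < t / 2 \<Longrightarrow> \<bar>x - l\<bar> < t \<Longrightarrow> 3 * t \<le> \<eta> \<Longrightarrow> \<bar>y - l\<bar> \<le> \<eta> / 2" for t l by linarith
    from this[OF x(2) s(2) tau_K] have "\<bar>y - (M * lam s + real_of_int n)\<bar> \<le> \<eta> / 2" .
    then show ?thesis using s(1) by blast
  qed
  have meets: "\<exists>x\<in>lam ` {1..S}. \<exists>n::int. M * x + real_of_int n \<in> C" if C: "C \<in> components Y" for C
    using fill_gaps_component_meets[OF open_Xset r LX XL C[unfolded Y_def Yset_eq_fill_gaps]] by blast
  have \<Lambda>Y: "M * x \<in> Y" if x: "x \<in> lam ` {1..S}" for x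
  proof -
    obtain s where s: "s \<in> {1..S}" "x = lam s" using x by blast
    have "M * lam s + real_of_int 0 \<in> ?X" by (rule near(1)[OF s(1)])
    then show ?thesis using s(2) closure_subset[of ?X] by (auto simp: Y_def Yset_def Let_def)
  qed
  have lift: "lch l M E Y A \<in> A \<and> valid_lift M E (lch l M E Y A)" if "\<exists>J\<in>A. valid_lift M E J" for A
    using choices that unfolding good_choices_def by blast
  note step = level_step[where lift = "lch l M E Y", OF M _ \<Lambda>E sep cover meets \<Lambda>Y lift]
  show "\<And>A. A \<in> arcs Y \<Longrightarrow> lch l M E Y A \<in> A \<and> valid_lift M E (lch l M E Y A)"
    and "lam ` {1..S} \<subseteq> (\<Union>A\<in>arcs Y. (\<lambda>z. z / M) ` lch l M E Y A)"
    and "(\<Union>A\<in>arcs Y. (\<lambda>z. z / M) ` lch l M E Y A) \<subseteq> Bset (lam ` {1..S}) (\<eta> / (2 * M))"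
    using step by auto
qed

definition success :: "(real list \<times> real set option) set" where
  "success = {r. \<exists>EL. snd r = Some EL \<and> lam ` {1..S} \<subseteq> EL \<and> EL \<subseteq> Bset (lam ` {1..S}) \<epsilon>}"

text \<open>The last assumption measures the remaining fuel: \<open>M\<close> at least doubles at
  every level except the first, where \<open>m = 1\<close>, hence the factor 1 for
  \<open>l = 0\<close>. With \<open>f = 0\<close> it would contradict
  \<open>Mp < \<eta> / \<epsilon>\<close>, or \<open>\<epsilon> \<le> \<eta>\<close> when
  \<open>l = 0\<close>, so the fuel never runs out, and each level adds at most \<open>b\<close> to
  the failure probability.\<close>

lemma rmpe_run_failure:
  assumes level: "\<And>M. measure_pmf.prob (level_pmf g N K M) {ys. \<exists>k\<le>K. cmod (ys ! k - g (M * real k)) \<ge> \<alpha>} \<le> b"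
    and "b \<ge> 0" and "Mp > 0" and "lam ` {1..S} \<subseteq> E"
    and "l = 0 \<Longrightarrow> Mp = 1 \<and> E = {0..9/10}"
    and "l \<noteq> 0 \<Longrightarrow> Mp < \<eta> / \<epsilon> \<and> E \<subseteq> Bset (lam ` {1..S}) (\<eta> / (2 * Mp))"
    and "2 * (\<eta> / \<epsilon>) \<le> Mp * (if l = 0 then 1 else 2) * 2 ^ f"
  shows "measure_pmf.prob (rmpe_run g \<beta> \<omega> \<eta> K N \<epsilon> mch lch f l Mp E) (- success) \<le> real f * b"
  using assms(3-)
proof (induction f arbitrary: l Mp E)
  case 0
  have "1 \<le> \<eta> / \<epsilon>" using \<epsilon> by simp
  then show ?case using 0 by (cases "l = 0") auto
next
  case (Suc f)
  define m where "m = (if l = 0 then 1 else mch l Mp E)"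
  define M where "M = Mp * m"
  have valid: "valid_m \<eta> E Mp m" if "l \<noteq> 0"
  proof -
    have "\<exists>m. valid_m \<eta> E Mp m"
      using Suc.prems that by (intro valid_m_exists[OF _ S \<eta>]) auto
    then show ?thesis using choices that by (auto simp: good_choices_def m_def)
  qed
  have Mc: "Mp * (if l = 0 then 1 else 2) \<le> M"
    using valid Suc.prems(1) by (auto simp: M_def m_def valid_m_def)
  have Mpos: "M > 0" using Mc Suc.prems(1) by (cases "l = 0") auto
  have sep: "separated_translates (lam ` {1..S}) E \<eta> M"
  proof (cases "l = 0")
    case True
    then show ?thesis using separated_translates_initial[OF \<Lambda> S \<eta>] Suc.prems(3) by (simp add: M_def m_def)
  next
    case False
    then show ?thesis unfolding M_def
      by (intro separated_translates_valid_m valid Suc.prems \<eta>)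
  qed
  let ?bad = "{ys. \<exists>k\<le>K. cmod (ys ! k - g (M * real k)) \<ge> \<alpha>}"
  define cont where "cont ys = (let Y = Yset \<beta> \<omega> K ys; J = lch l M E Y in
          if \<not> (\<forall>A\<in>arcs Y. J A \<in> A \<and> valid_lift M E (J A)) then return_pmf ([M], None) else
          (let E' = (\<Union>A\<in>arcs Y. (\<lambda>z. z / M) ` J A) in
           if \<eta> / M \<le> \<epsilon> then return_pmf ([M], Some E')
           else map_pmf (\<lambda>(Ms, r). (M # Ms, r)) (rmpe_run g \<beta> \<omega> \<eta> K N \<epsilon> mch lch f (Suc l) M E')))" for ys
  have run: "rmpe_run g \<beta> \<omega> \<eta> K N \<epsilon> mch lch (Suc f) l Mp E = bind_pmf (level_pmf g N K M) cont"
  proof -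
    have nv: "\<not> (l \<noteq> 0 \<and> \<not> valid_m \<eta> E Mp m)" using valid by blast
    show ?thesis
      unfolding cont_def rmpe_run.simps Let_def m_def[symmetric] M_def[symmetric] if_not_P[OF nv] ..
  qed
  have "measure_pmf.prob (bind_pmf (level_pmf g N K M) cont) (- success)
      \<le> measure_pmf.prob (level_pmf g N K M) ?bad + real f * b"
  proof (rule prob_bind_pmf_le)
    fix ys assume "ys \<notin> ?bad"
    then have ys: "cmod (ys ! k - g (M * real k)) < \<alpha>" if "k \<le> K" for k using that not_le by blast
    define Y where "Y = Yset \<beta> \<omega> K ys"
    define E' where "E' = (\<Union>A\<in>arcs Y. (\<lambda>z. z / M) ` lch l M E Y A)"
    have lo: "lam ` {1..S} \<subseteq> E'" and hi: "E' \<subseteq> Bset (lam ` {1..S}) (\<eta> / (2 * M))"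
      and val: "\<forall>A\<in>arcs Y. lch l M E Y A \<in> A \<and> valid_lift M E (lch l M E Y A)"
      unfolding E'_def Y_def using good_level[OF Mpos sep Suc.prems(2) ys] by blast+
    have cont: "cont ys = (if \<eta> / M \<le> \<epsilon> then return_pmf ([M], Some E')
           else map_pmf (\<lambda>(Ms, r). (M # Ms, r)) (rmpe_run g \<beta> \<omega> \<eta> K N \<epsilon> mch lch f (Suc l) M E'))"
      unfolding cont_def Let_def Y_def[symmetric] E'_def[symmetric] using val by simp
    show "measure_pmf.prob (cont ys) (- success) \<le> real f * b"
    proof (cases "\<eta> / M \<le> \<epsilon>")
      case True
      have "\<eta> / (2 * M) \<le> \<epsilon>" using True \<eta> Mpos by (simp add: field_simps)
      then have "Bset (lam ` {1..S}) (\<eta> / (2 * M)) \<subseteq> Bset (lam ` {1..S}) \<epsilon>"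
        unfolding Bset_def by (intro UN_mono) auto
      then have "([M], Some E') \<in> success" using lo hi by (auto simp: success_def)
      then have "measure_pmf.prob (cont ys) (- success) = 0"
        unfolding cont using True by (simp add: indicator_def)
      then show ?thesis using \<open>b \<ge> 0\<close> by simp
    next
      case False
      have "(\<lambda>(Ms, r). (M # Ms, r)) -` (- success) = - success"
        by (auto simp: success_def)
      then have "measure_pmf.prob (cont ys) (- success) =
          measure_pmf.prob (rmpe_run g \<beta> \<omega> \<eta> K N \<epsilon> mch lch f (Suc l) M E') (- success)"
        unfolding cont using False by simp
      also have "\<dots> \<le> real f * b"
      proof (rule Suc.IH)
        show "Suc l \<noteq> 0 \<Longrightarrow> M < \<eta> / \<epsilon> \<and> E' \<subseteq> Bset (lam ` {1..S}) (\<eta> / (2 * M))"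
          using False Mpos \<epsilon> hi by (simp add: field_simps)
        have "2 * (\<eta> / \<epsilon>) \<le> Mp * (if l = 0 then 1 else 2) * (2 * 2 ^ f)" using Suc.prems(5) by simp
        also have "\<dots> \<le> M * (2 * 2 ^ f)" using Mc by (intro mult_right_mono) auto
        finally show "2 * (\<eta> / \<epsilon>) \<le> M * (if Suc l = 0 then 1 else 2) * 2 ^ f" by (simp add: mult.assoc)
      qed (use Mpos lo in auto)
      finally show ?thesis .
    qed
  qed (use \<open>b \<ge> 0\<close> in simp)
  also have "\<dots> \<le> b + real f * b" using level by simp
  finally show ?case unfolding run by (simp add: algebra_simps)
qed

text \<open>The fuel \<open>L + 1\<close> is also the number of levels among which \<rho> is
  divided, and \<open>\<eta> / \<epsilon> \<le> 2 ^ L\<close> is the fuel condition at level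
  0.\<close>

lemma rmpe_success:
  assumes "\<alpha> > 0" and "0 < \<rho>" and "\<rho> < 1"
  shows "measure_pmf.prob (rmpe g \<beta> \<omega> \<eta> K (N_HR \<alpha> \<rho> \<eta> \<epsilon> K) \<epsilon> mch lch) success \<ge> 1 - \<rho>"
proof -
  define L where "L = nat \<lceil>log 2 (\<eta> / \<epsilon>)\<rceil>"
  let ?P = "rmpe g \<beta> \<omega> \<eta> K (N_HR \<alpha> \<rho> \<eta> \<epsilon> K) \<epsilon> mch lch"
  have "\<eta> / \<epsilon> \<le> 2 ^ L"
  proof -
    have "log 2 (\<eta> / \<epsilon>) \<le> real L" unfolding L_def by linarith
    then have "\<eta> / \<epsilon> \<le> 2 powr real L" using \<epsilon> \<eta> by (subst (asm) log_le_iff) auto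
    then show ?thesis by (simp add: powr_realpow)
  qed
  then have "measure_pmf.prob ?P (- success) \<le> real (L + 1) * (\<rho> / (real L + 1))"
    unfolding rmpe_def L_def[symmetric]
    using assms \<Lambda> prob_level_failure[OF g_le_1 assms(1,2,3) \<epsilon>, folded L_def]
    by (intro rmpe_run_failure) auto
  also have "\<dots> = \<rho>"
  proof -
    have "real L + 1 \<noteq> 0" by linarith
    then show ?thesis unfolding of_nat_add of_nat_1 by simp
  qed
  finally show ?thesis by (simp add: measure_pmf.prob_compl[of success, simplified, folded Compl_eq_Diff_UNIV])
qed

end

theorem theorem2:
  shows "\<exists>C1 C2 :: real. C1 > 0 \<and> C2 > 0 \<and>
    (\<forall>(H :: complex mat) (U :: real \<Rightarrow> complex mat) (psi :: complex vec)
      (S :: nat) (c :: nat \<Rightarrow> complex) (psis :: nat \<Rightarrow> complex vec) (lam :: nat \<Rightarrow> real)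
      (cres :: complex) (psires :: complex vec)
      (\<beta> :: real) (\<omega> :: real) (\<epsilon> :: real) (\<rho> :: real) (\<alpha> :: real) (\<eta> :: real) (K :: nat)
      (mch :: nat \<Rightarrow> real \<Rightarrow> real set \<Rightarrow> real)
      (lch :: nat \<Rightarrow> real \<Rightarrow> real set \<Rightarrow> real set \<Rightarrow> real set set \<Rightarrow> real set).
      hermitian_mat H \<and> is_evolution H U \<and>
      (\<forall>v \<mu>. eigenvector H v \<mu> \<longrightarrow> \<mu> \<in> complex_of_real ` {0..1}) \<and>
      S \<ge> 1 \<and>
      (\<forall>s\<in>{1..S}. psis s \<in> carrier_vec (dim_row H) \<and>
                   H *\<^sub>v psis s = complex_of_real (lam s) \<cdot>\<^sub>v psis s) \<and>
      (\<forall>s\<in>{1..S}. \<forall>s'\<in>{1..S}. psis s \<bullet>c psis s' = (if s = s' then 1 else 0)) \<and>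
      psires \<in> carrier_vec (dim_row H) \<and> psires \<bullet>c psires = 1 \<and>
      (\<forall>s\<in>{1..S}. psis s \<bullet>c psires = 0) \<and>
      psi = vec (dim_row H) (\<lambda>i. (\<Sum>s\<in>{1..S}. c s * psis s $ i) + cres * psires $ i) \<and>
      psi \<bullet>c psi = 1 \<and>
      \<beta> > 0 \<and> (\<forall>s\<in>{1..S}. (cmod (c s))\<^sup>2 \<ge> \<beta>) \<and> (cmod cres)\<^sup>2 \<le> \<omega> \<and> \<omega> < \<beta> \<and>
      lam ` {1..S} \<subseteq> {0..9/10} \<and>
      \<epsilon> > 0 \<and> \<epsilon> \<le> \<eta> \<and> 0 < \<rho> \<and> \<rho> < 1 \<and> 0 < \<alpha> \<and> \<alpha> < (\<beta> - \<omega>) / 3 \<and>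
      0 < \<eta> \<and> \<eta> \<le> 1 / (8 * real S * (2 * real S - 1)) \<and>
      real K \<ge> 3 / \<eta> * tau_of \<beta> \<omega> \<and>
      good_choices \<eta> mch lch
      \<longrightarrow>
      (let N = N_HR \<alpha> \<rho> \<eta> \<epsilon> K;
           P = rmpe (overlap U psi) \<beta> \<omega> \<eta> K N \<epsilon> mch lch;
           \<Lambda> = lam ` {1..S} in
       measure_pmf.prob P {r. \<exists>EL. snd r = Some EL \<and> \<Lambda> \<subseteq> EL \<and> EL \<subseteq> Bset \<Lambda> \<epsilon>} \<ge> 1 - \<rho> \<and>
       (\<forall>r\<in>set_pmf P.
          T_max K (fst r) \<le> C1 * \<eta> * real K / \<epsilon> \<and>
          T_total K N (fst r) \<le> C2 * \<eta> * (real K)\<^sup>2 * real N / \<epsilon>)))"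
\<comment> \<open>Every multiplier used is at most \<open>4 * \<eta> / \<epsilon>\<close> and their
  sum is at most \<open>8 * \<eta> / \<epsilon>\<close>; these two factors are the
  constants.\<close>
proof (rule exI[of _ 4], rule exI[of _ 8], intro conjI allI impI)
  show "(4::real) > 0" "(8::real) > 0" by simp_all
next
  fix H :: "complex mat" and U :: "real \<Rightarrow> complex mat" and psi :: "complex vec"
    and S :: nat and c :: "nat \<Rightarrow> complex" and psis :: "nat \<Rightarrow> complex vec" and lam :: "nat \<Rightarrow> real"
    and cres :: complex and psires :: "complex vec" and \<beta> \<omega> \<epsilon> \<rho> \<alpha> \<eta> :: real and K :: nat
    and mch :: "nat \<Rightarrow> real \<Rightarrow> real set \<Rightarrow> real"
    and lch :: "nat \<Rightarrow> real \<Rightarrow> real set \<Rightarrow> real set \<Rightarrow> real set set \<Rightarrow> real set"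
  assume asm: "hermitian_mat H \<and> is_evolution H U \<and>
      (\<forall>v \<mu>. eigenvector H v \<mu> \<longrightarrow> \<mu> \<in> complex_of_real ` {0..1}) \<and>
      S \<ge> 1 \<and>
      (\<forall>s\<in>{1..S}. psis s \<in> carrier_vec (dim_row H) \<and>
                   H *\<^sub>v psis s = complex_of_real (lam s) \<cdot>\<^sub>v psis s) \<and>
      (\<forall>s\<in>{1..S}. \<forall>s'\<in>{1..S}. psis s \<bullet>c psis s' = (if s = s' then 1 else 0)) \<and>
      psires \<in> carrier_vec (dim_row H) \<and> psires \<bullet>c psires = 1 \<and>
      (\<forall>s\<in>{1..S}. psis s \<bullet>c psires = 0) \<and>
      psi = vec (dim_row H) (\<lambda>i. (\<Sum>s\<in>{1..S}. c s * psis s $ i) + cres * psires $ i) \<and>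
      psi \<bullet>c psi = 1 \<and>
      \<beta> > 0 \<and> (\<forall>s\<in>{1..S}. (cmod (c s))\<^sup>2 \<ge> \<beta>) \<and> (cmod cres)\<^sup>2 \<le> \<omega> \<and> \<omega> < \<beta> \<and>
      lam ` {1..S} \<subseteq> {0..9/10} \<and>
      \<epsilon> > 0 \<and> \<epsilon> \<le> \<eta> \<and> 0 < \<rho> \<and> \<rho> < 1 \<and> 0 < \<alpha> \<and> \<alpha> < (\<beta> - \<omega>) / 3 \<and>
      0 < \<eta> \<and> \<eta> \<le> 1 / (8 * real S * (2 * real S - 1)) \<and>
      real K \<ge> 3 / \<eta> * tau_of \<beta> \<omega> \<and>
      good_choices \<eta> mch lch"
  have real: "\<mu> \<in> \<real>" if "eigenvector H v \<mu>" for v \<mu> using asm that by fastforce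
  have H: "hermitian_mat H" and U: "is_evolution H U"
    and eig: "\<And>s. s \<in> {1..S} \<Longrightarrow> psis s \<in> carrier_vec (dim_row H) \<and>
                   H *\<^sub>v psis s = complex_of_real (lam s) \<cdot>\<^sub>v psis s"
    and on: "\<And>s s'. s \<in> {1..S} \<Longrightarrow> s' \<in> {1..S} \<Longrightarrow> psis s \<bullet>c psis s' = (if s = s' then 1 else 0)"
    and res: "psires \<in> carrier_vec (dim_row H)" "psires \<bullet>c psires = 1"
      "\<And>s. s \<in> {1..S} \<Longrightarrow> psis s \<bullet>c psires = 0"
    and psi: "psi = vec (dim_row H) (\<lambda>i. (\<Sum>s\<in>{1..S}. c s * psis s $ i) + cres * psires $ i)"
    and norm: "psi \<bullet>c psi = 1"
    using asm by blast+
  have weights: "(\<Sum>s\<in>{1..S}. (cmod (c s))\<^sup>2) + (cmod cres)\<^sup>2 = 1"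
    by (rule overlap_weights[OF H U real eig on res psi norm]; assumption)
  have "\<exists>(F::complex set) q. finite F \<and> (\<forall>\<nu>\<in>F. q \<nu> \<ge> 0) \<and> (\<Sum>\<nu>\<in>F. q \<nu>) = (cmod cres)\<^sup>2 \<and>
      (\<forall>t. overlap U psi t =
          (\<Sum>s\<in>{1..S}. complex_of_real ((cmod (c s))\<^sup>2) * exp (- 2 * pi * \<i> * lam s * t)) +
          (\<Sum>\<nu>\<in>F. complex_of_real (q \<nu>) * exp (- 2 * pi * \<i> * Re \<nu> * t)))"
    by (rule overlap_spectral[OF H U real eig on res psi norm]; assumption)
  then obtain F :: "complex set" and q where F: "finite F" "\<forall>\<nu>\<in>F. q \<nu> \<ge> 0" "(\<Sum>\<nu>\<in>F. q \<nu>) = (cmod cres)\<^sup>2"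
    and ov: "\<And>t. overlap U psi t =
          (\<Sum>s\<in>{1..S}. complex_of_real ((cmod (c s))\<^sup>2) * exp (- 2 * pi * \<i> * lam s * t)) +
          (\<Sum>\<nu>\<in>F. complex_of_real (q \<nu>) * exp (- 2 * pi * \<i> * Re \<nu> * t))"
    by blast
  have \<omega>: "0 \<le> \<omega>" using asm zero_le_power2[of "cmod cres"] by linarith
  interpret rmpe_model "overlap U psi" \<beta> \<omega> \<eta> \<epsilon> \<alpha> K S lam "\<lambda>s. (cmod (c s))\<^sup>2" F q mch lch
    by unfold_locales (use asm F ov \<omega> weights in auto)
  define N where "N = N_HR \<alpha> \<rho> \<eta> \<epsilon> K"
  define P where "P = rmpe (overlap U psi) \<beta> \<omega> \<eta> K N \<epsilon> mch lch"
  have "measure_pmf.prob P success \<ge> 1 - \<rho>"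
    unfolding P_def N_def using asm by (intro rmpe_success) auto
  moreover have "T_max K (fst r) \<le> 4 * \<eta> * real K / \<epsilon> \<and> T_total K N (fst r) \<le> 8 * \<eta> * (real K)\<^sup>2 * real N / \<epsilon>"
    if r: "r \<in> set_pmf P" for r
  proof -
    have "(\<forall>M\<in>set (fst r). 0 \<le> M \<and> M \<le> 4 * \<eta> / \<epsilon>) \<and> sum_list (fst r) \<le> 8 * \<eta> / \<epsilon> - (if (0::nat) = 0 then 0 else 2 * 1)"
      by (rule rmpe_run_times[OF \<epsilon> r[unfolded P_def rmpe_def]]) auto
    then have Ms: "\<And>M. M \<in> set (fst r) \<Longrightarrow> 0 \<le> M" "\<And>M. M \<in> set (fst r) \<Longrightarrow> M \<le> 4 * \<eta> / \<epsilon>"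
      "sum_list (fst r) \<le> 8 * \<eta> / \<epsilon>" by auto
    have "T_max K (fst r) \<le> 4 * \<eta> / \<epsilon> * real K" using \<epsilon> Ms(2) by (intro T_max_le) auto
    moreover have "T_total K N (fst r) \<le> 8 * \<eta> / \<epsilon> * (real K)\<^sup>2 * real N" by (intro T_total_le Ms)
    ultimately show ?thesis by simp
  qed
  ultimately show "let N = N_HR \<alpha> \<rho> \<eta> \<epsilon> K;
           P = rmpe (overlap U psi) \<beta> \<omega> \<eta> K N \<epsilon> mch lch;
           \<Lambda> = lam ` {1..S} in
       measure_pmf.prob P {r. \<exists>EL. snd r = Some EL \<and> \<Lambda> \<subseteq> EL \<and> EL \<subseteq> Bset \<Lambda> \<epsilon>} \<ge> 1 - \<rho> \<and>
       (\<forall>r\<in>set_pmf P.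
          T_max K (fst r) \<le> 4 * \<eta> * real K / \<epsilon> \<and>
          T_total K N (fst r) \<le> 8 * \<eta> * (real K)\<^sup>2 * real N / \<epsilon>)"
    by (simp add: P_def N_def success_def Let_def)
qed

end
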